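(* Let $L:C([-1,0],\mathbb{R})\to\mathbb{R}$ be a bounded linear operator and let $G:C([-1,0],\mathbb{R})\to\mathbb{R}$ be smooth ($C^k$ for every $k$) with $G(0)=0$, $G'(0)=0$. Assume that the characteristic equation $\Delta(z):=z-L\varepsilon_z=0$ of the DDE $\dot x(t)=Lx_t+G(x_t)$ has $d$ roots $\mu=(\mu_1,\dots,\mu_d)$ in the right half of the complex plane and $\Delta(\langle\mu,\beta\rangle)\neq0$ for all $\beta\in\mathbb{N}^d$ with $|\beta|>2$. For $n\in\mathbb{N}$, $n\geq 1$, consider the pseudospectral ODE $$\frac{d}{dt}\begin{pmatrix}y_0\\ y\end{pmatrix}=\mathcal{A}_n\begin{pmatrix}y_0\\ y\end{pmatrix}+\begin{pmatrix}G(P(y_0,y))\\ 0\end{pmatrix},\qquad \mathcal{A}_n\begin{pmatrix}y_0\\ y\end{pmatrix}=\begin{pmatrix}LP(y_0,y)\\ -y_0D\mathbf{1}+Dy\end{pmatrix},\qquad (y_0,y)\in\mathbb{R}\times\mathbb{R}^n .$$ Suppose that the matrix $\mathcal{A}_n$ has $d$ (distinct) eigenvalues in the right half of the complex plane, and unstable dimension $d$, gathered in a vector $\lambda_n=(\lambda_{1,n},\dots,\lambda_{d,n})$; that $\langle\lambda_n,\beta\rangle\notin\sigma(\mathcal{A}_n)$ for all $|\beta|\ge2$; and that $\langle\lambda_n,\beta\rangle\notin\sigma(D)$ for all $|\beta|\ge1$. Let $H_n:\mathcal{S}_d\to\mathcal{S}_d$ be the map with the property that $$G\Big(\sum_{|\beta|\le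 k}x_\beta P\big(1,(D-\langle\lambda_n,\beta\rangle I)^{-1}D\mathbf{1}\big)\sigma^\beta\Big)=\sum_{|\beta|\le k}H_n(x)_\beta\sigma^\beta+\mathcal{O}(\sigma^{k+1})$$ for every sequence $x=(x_\beta)_{\beta\in\mathbb{N}^d}$ (and every $k$). For $|\beta|=1$ fix nonzero scalars $\xi_\beta\in\mathbb{C}$, and define $F_n:\mathcal{S}_d\to\mathcal{S}_d$ by $$F_n(x)_\beta=\begin{cases}x_\beta&\text{if }\beta=0,\\ x_\beta-\xi_\beta&\text{if }|\beta|=1,\\ \Delta_n(\langle\lambda_n,\beta\rangle)x_\beta-H_n(x)_\beta&\text{if }|\beta|\ge2,\end{cases}$$ where $\Delta_n(z)=z-LP(1,(D-zI)^{-1}D\mathbf{1})$. If the sequence $p_n=(p_{n,\beta})_{\beta\in\mathbb{N}^d}$ satisfies $F_n(p_n)=0$ and $\sum_{\beta\in\mathbb{N}^d}|p_{n,\beta}|<\infty$, then the graph (i.e. the image) of the function $$P_n:\mathbb{C}^d\supseteq B(0,1)\to\mathbb{C}^{n+1},\qquad P_n(\sigma)=\sum_{\beta\in\mathbb{N}^d}p_{n,\beta}\begin{pmatrix}1\\ (D-\langle\lambda_n,\beta\rangle I)^{-1}D\mathbf{1}\end{pmatrix}\sigma^\beta$$ is a local unstable manifold (of the equilibrium $0$) for the pseudospectral ODE.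
   Context: $\mathbb{N}$ contains $0$; for $\beta\in\mathbb{N}^d$, $|\beta|=\beta_1+\dots+\beta_d$, $\sigma^\beta=\sigma_1^{\beta_1}\cdots\sigma_d^{\beta_d}$, and $\langle\mu,\beta\rangle=\mu_1\beta_1+\dots+\mu_d\beta_d$. $\mathcal{S}_d=\{(u_\beta)_{\beta\in\mathbb{N}^d}:u_\beta\in\mathbb{C}\}$. $\sigma(\cdot)$ applied to a matrix denotes its spectrum. $x_t(\theta)=x(t+\theta)$, $\theta\in[-1,0]$, is the history segment, and $\varepsilon_z(\theta)=e^{z\theta}$. For $n\ge1$ the mesh points are $\theta_j=\frac12(\cos(j\pi/n)-1)$, $0\le j\le n$; the Lagrange polynomials are $\ell_j(\theta)=\prod_{0\le m\le n,\,m\neq j}\frac{\theta-\theta_m}{\theta_j-\theta_m}$; $D=(\ell_j'(\theta_i))_{1\le i,j\le n}\in\mathbb{R}^{n\times n}$; $\mathbf{1}=(1,\dots,1)^T\in\mathbb{R}^n$; and $P(y_0,y)=y_0\ell_0+\sum_{j=1}^ny_j\ell_j\in C([-1,0])$. The operators $L$ and $P$ are extended complex-linearly, and $G$ is applied to complex arguments through its (complexified) Taylor expansion at $0$, the expansion defining $H_n$ being understood as a formal expansion in $\sigma$. The unstable dimension is the dimension of the unstable subspace of $\mathcal{A}_n$.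
   Formalization: Assumes also that on some open set containing the image of P_n the complexified Taylor series of G at 0 converges locally uniformly, with sum G at real points; otherwise the ODE is undefined at complex arguments, or (for flat G) the claim fails. *)

theory Defs
  imports "HOL-Analysis.Analysis" "HOL-Library.Landau_Symbols"
begin

section \<open>The state space \<open>C([-1,0])\<close>\<close>

typedef delay = "{-1..0::real}"
  by (rule exI[of _ 0]) simp

instantiation delay :: metric_space
begin

definition dist_delay :: "delay \<Rightarrow> delay \<Rightarrow> real" where
  "dist_delay a b = dist (Rep_delay a) (Rep_delay b)"

definition uniformity_delay :: "(delay \<times> delay) filter" where
  "uniformity_delay = (INF e\<in>{0<..}. principal {(a, b). dist a b < e})"

definition open_delay :: "delay set \<Rightarrow> bool" where
  "open_delay S \<longleftrightarrow> (\<forall>a\<in>S. \<forall>\<^sub>F (a', b) in uniformity. a' = a \<longrightarrow> b \<in> S)"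

instance
proof
  fix a b c :: delay
  show "dist a b = 0 \<longleftrightarrow> a = b"
    by (simp add: dist_delay_def Rep_delay_inject)
  show "dist a b \<le> dist a c + dist b c"
    unfolding dist_delay_def by (rule dist_triangle2)
qed (auto simp: uniformity_delay_def open_delay_def)

end

type_synonym hist = "delay \<Rightarrow>\<^sub>C real"

definition hist :: "(real \<Rightarrow> real) \<Rightarrow> hist" where
  "hist f = Bcontfun (\<lambda>\<theta>. f (Rep_delay \<theta>))"

lemma hist_apply:
  assumes "continuous_on {-1..0} f"
  shows "apply_bcontfun (hist f) \<theta> = f (Rep_delay \<theta>)"
proof -
  have R: "Rep_delay t \<in> {-1..0}" for t by (rule Rep_delay)
  have "continuous_on UNIV Rep_delay"
    by (auto simp: continuous_on_iff dist_delay_def)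
  then have "continuous_on UNIV (\<lambda>\<theta>. f (Rep_delay \<theta>))"
    by (rule continuous_on_compose2[OF assms]) (use R in auto)
  moreover have "bounded (range (\<lambda>\<theta>. f (Rep_delay \<theta>)))"
    by (rule bounded_subset[OF compact_imp_bounded[OF compact_continuous_image[OF assms]]])
       (use R in auto)
  ultimately show ?thesis
    by (simp add: hist_def Bcontfun_inverse bcontfun_def)
qed


section \<open>Smooth functionals and complexification\<close>

text \<open>\<open>iter_deriv G [v\<^sub>1, \<dots>, v\<^sub>k] x\<close> is \<open>D\<^sup>kG(x)(v\<^sub>1, \<dots>, v\<^sub>k)\<close>.\<close>

primrec iter_deriv :: "('a::real_normed_vector \<Rightarrow> real) \<Rightarrow> 'a list \<Rightarrow> 'a \<Rightarrow> real" where
  "iter_deriv G [] = G"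
| "iter_deriv G (v # vs) = (\<lambda>x. frechet_derivative (iter_deriv G vs) (at x) v)"

text \<open>The second conjunct is continuity of \<open>D\<^sup>jG\<close> in the operator norm of \<open>j\<close>-linear forms;
  by the mean value theorem it turns the differentiability along fixed directions in the first
  conjunct into Frechet differentiability of \<open>D\<^sup>jG\<close> as a map into \<open>j\<close>-linear forms.\<close>

definition Ck :: "nat \<Rightarrow> ('a::real_normed_vector \<Rightarrow> real) \<Rightarrow> bool" where
  "Ck k G \<longleftrightarrow>
     (\<forall>vs x. length vs < k \<longrightarrow> iter_deriv G vs differentiable (at x)) \<and>
     (\<forall>j\<le>k. \<forall>x. \<forall>e>0. \<exists>\<delta>>0. \<forall>y. dist y x < \<delta> \<longrightarrow>
        (\<forall>vs. length vs = j \<and> (\<forall>v\<in>set vs. norm v \<le> 1) \<longrightarrow>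
           \<bar>iter_deriv G vs y - iter_deriv G vs x\<bar> \<le> e))"

text \<open>Elements of \<open>C([-1,0],\<complex>)\<close> are represented by functions \<open>real \<Rightarrow> complex\<close>, of which only the
  values on \<open>[-1,0]\<close> matter.\<close>

definition lin_complex :: "(hist \<Rightarrow> real) \<Rightarrow> (real \<Rightarrow> complex) \<Rightarrow> complex" where
  "lin_complex L f = of_real (L (hist (\<lambda>\<theta>. Re (f \<theta>)))) + \<i> * of_real (L (hist (\<lambda>\<theta>. Im (f \<theta>))))"

text \<open>The \<open>m\<close>-th term of the complexified Taylor expansion at \<open>0\<close>, that is
  \<open>D\<^sup>mG(0)(a + \<i> b, \<dots>, a + \<i> b) / m!\<close> expanded by multilinearity and symmetry, where \<open>f = a + \<i> b\<close>.\<close>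

definition taylor_term :: "(hist \<Rightarrow> real) \<Rightarrow> nat \<Rightarrow> (real \<Rightarrow> complex) \<Rightarrow> complex" where
  "taylor_term G m f =
     (\<Sum>j\<le>m. of_nat (m choose j) * \<i> ^ j *
        of_real (iter_deriv G (replicate (m - j) (hist (\<lambda>\<theta>. Re (f \<theta>))) @
                               replicate j (hist (\<lambda>\<theta>. Im (f \<theta>)))) 0)) / fact m"

text \<open>Real arguments are fed to \<open>G\<close> itself, all others to its Taylor series (meaningful only where
  that series converges).\<close>

definition nonlin_complex :: "(hist \<Rightarrow> real) \<Rightarrow> (real \<Rightarrow> complex) \<Rightarrow> complex" where
  "nonlin_complex G f =
     (if \<forall>\<theta>\<in>{-1..0}. Im (f \<theta>) = 0 then of_real (G (hist (\<lambda>\<theta>. Re (f \<theta>))))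
      else (\<Sum>m. taylor_term G m f))"

definition char_fun :: "(hist \<Rightarrow> real) \<Rightarrow> complex \<Rightarrow> complex" where
  "char_fun L z = z - lin_complex L (\<lambda>\<theta>. exp (z * of_real \<theta>))"


section \<open>Pseudospectral discretisation\<close>

text \<open>The index set \<open>{1, \<dots>, n}\<close> is a finite linearly ordered type \<open>'n\<close>, with \<open>n = CARD('n)\<close>,
  numbered by \<open>pos\<close>. The index set \<open>{0, \<dots>, n}\<close> is \<open>'n option\<close>, where \<open>None\<close> stands for \<open>0\<close>; so
  \<open>(y\<^sub>0, y)\<close> is \<open>v\<close> with \<open>y\<^sub>0 = v $ None\<close> and \<open>y\<^sub>j = v $ Some j\<close>.\<close>

definition pos :: "'n::{finite,linorder} \<Rightarrow> nat" where
  "pos i = card {..i}"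

lemma bij_betw_pos: "bij_betw (pos :: 'n::{finite,linorder} \<Rightarrow> nat) UNIV {1..CARD('n)}"
proof -
  have inj: "inj (pos :: 'n \<Rightarrow> nat)"
  proof (rule linorder_injI)
    fix a b :: 'n assume "a < b"
    then have "{..a} \<subset> {..b}" by (auto simp: psubset_eq)
    then have "pos a < pos b"
      unfolding pos_def by (intro psubset_card_mono) auto
    then show "pos a \<noteq> pos b" by simp
  qed
  have sub: "range (pos :: 'n \<Rightarrow> nat) \<subseteq> {1..CARD('n)}"
    by (auto simp: pos_def Suc_le_eq card_gt_0_iff intro!: card_mono)
  have "range (pos :: 'n \<Rightarrow> nat) = {1..CARD('n)}"
    by (rule card_subset_eq[OF _ sub]) (auto simp: card_image[OF inj])
  with inj show ?thesis by (simp add: bij_betw_def)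
qed

definition mesh :: "nat \<Rightarrow> nat \<Rightarrow> real" where
  "mesh n j = (cos (real j * pi / real n) - 1) / 2"

definition lagrange :: "nat \<Rightarrow> nat \<Rightarrow> real \<Rightarrow> real" where
  "lagrange n j \<theta> = (\<Prod>m\<in>{0..n} - {j}. (\<theta> - mesh n m) / (mesh n j - mesh n m))"

definition diffmat :: "((real, 'n::{finite,linorder}) vec, 'n) vec" where
  "diffmat = (\<chi> i j. deriv (lagrange CARD('n) (pos j)) (mesh CARD('n) (pos i)))"

definition cdiffmat :: "((complex, 'n::{finite,linorder}) vec, 'n) vec" where
  "cdiffmat = (\<chi> i j. of_real (diffmat $ i $ j))"

definition interp :: "complex^'n::{finite,linorder} option \<Rightarrow> real \<Rightarrow> complex" where
  "interp v \<theta> = v $ None * of_real (lagrange CARD('n) 0 \<theta>)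
     + (\<Sum>j\<in>UNIV. v $ Some j * of_real (lagrange CARD('n) (pos j) \<theta>))"

definition lin_field :: "(hist \<Rightarrow> real) \<Rightarrow> complex^'n::{finite,linorder} option \<Rightarrow> complex^'n option" where
  "lin_field L v = (\<chi> i. case i of
       None \<Rightarrow> lin_complex L (interp v)
     | Some j \<Rightarrow> (- (v $ None *s (cdiffmat *v 1)) + cdiffmat *v (\<chi> k. v $ Some k)) $ j)"

definition lin_mat :: "(hist \<Rightarrow> real) \<Rightarrow> complex^'n::{finite,linorder} option^'n option" where
  "lin_mat L = matrix (lin_field L)"

definition ps_field ::
    "(hist \<Rightarrow> real) \<Rightarrow> (hist \<Rightarrow> real) \<Rightarrow> complex^'n::{finite,linorder} option \<Rightarrow> complex^'n option" where
  "ps_field L G v = lin_mat L *v v + axis None (nonlin_complex G (interp v))"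

text \<open>The vector \<open>(1, (D - z I)\<^sup>-\<^sup>1 D \<one>)\<close>.\<close>

definition ps_exp :: "complex \<Rightarrow> complex^'n::{finite,linorder} option" where
  "ps_exp z = (\<chi> i. case i of
       None \<Rightarrow> 1
     | Some j \<Rightarrow> (matrix_inv (cdiffmat - mat z) *v (cdiffmat *v 1)) $ j)"

definition ps_char_fun :: "'n::{finite,linorder} itself \<Rightarrow> (hist \<Rightarrow> real) \<Rightarrow> complex \<Rightarrow> complex" where
  "ps_char_fun _ L z = z - lin_complex L (interp (ps_exp z :: complex^'n option))"


section \<open>Spectra and unstable subspace\<close>

definition mat_spectrum :: "complex^'m^'m \<Rightarrow> complex set" where
  "mat_spectrum M = {z. \<exists>v. v \<noteq> 0 \<and> M *v v = z *s v}"

definition gen_eigenspace :: "complex^'m^'m \<Rightarrow> complex \<Rightarrow> (complex^'m) set" where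
  "gen_eigenspace M z = {v. \<exists>k. (((*v) (M - mat z)) ^^ k) v = 0}"

definition unstable_subspace :: "complex^'m^'m \<Rightarrow> (complex^'m) set" where
  "unstable_subspace M = vec.span (\<Union>z\<in>{z. Re z > 0}. gen_eigenspace M z)"


section \<open>Multi-indices and the coefficient equations\<close>

type_synonym 'd multi_index = "'d \<Rightarrow> nat"

definition deg :: "'d::finite multi_index \<Rightarrow> nat" where
  "deg \<beta> = (\<Sum>i\<in>UNIV. \<beta> i)"

definition monomial :: "complex^'d \<Rightarrow> 'd::finite multi_index \<Rightarrow> complex" where
  "monomial \<sigma> \<beta> = (\<Prod>i\<in>UNIV. (\<sigma> $ i) ^ \<beta> i)"

definition pairing :: "complex^'d \<Rightarrow> 'd::finite multi_index \<Rightarrow> complex" where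
  "pairing \<mu> \<beta> = (\<Sum>i\<in>UNIV. \<mu> $ i * of_nat (\<beta> i))"

text \<open>\<open>expansion_map TYPE('n) G lam H\<close>: the defining property of \<open>H\<^sub>n\<close>. The expansion is formal in
  \<open>\<sigma>\<close>: modulo order \<open>k + 1\<close> only the Taylor terms of \<open>G\<close> of degree at most \<open>k\<close> contribute, so no
  convergence is involved. Since \<open>G\<close> is expanded at \<open>0\<close>, the inner series must have zero constant
  term; for other sequences the composition has no formal meaning and \<open>H\<close> is unconstrained.\<close>

definition expansion_map ::
    "'n::{finite,linorder} itself \<Rightarrow> (hist \<Rightarrow> real) \<Rightarrow> complex^'d::finite \<Rightarrow>
      (('d multi_index \<Rightarrow> complex) \<Rightarrow> ('d multi_index \<Rightarrow> complex)) \<Rightarrow> bool" where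
  "expansion_map _ G lam H \<longleftrightarrow>
     (\<forall>x k. x (\<lambda>_. 0) = 0 \<longrightarrow>
        (\<lambda>\<sigma>. (\<Sum>m\<le>k. taylor_term G m
                 (\<lambda>\<theta>. \<Sum>\<beta> | deg \<beta> \<le> k.
                    x \<beta> * interp (ps_exp (pairing lam \<beta>) :: complex^'n option) \<theta> * monomial \<sigma> \<beta>))
             - (\<Sum>\<beta> | deg \<beta> \<le> k. H x \<beta> * monomial \<sigma> \<beta>))
        \<in> O[at 0](\<lambda>\<sigma>. of_real (norm \<sigma> ^ (k + 1))))"

definition coeff_map ::
    "'n::{finite,linorder} itself \<Rightarrow> (hist \<Rightarrow> real) \<Rightarrow> complex^'d::finite \<Rightarrow>
      (('d multi_index \<Rightarrow> complex) \<Rightarrow> ('d multi_index \<Rightarrow> complex)) \<Rightarrow>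
      ('d multi_index \<Rightarrow> complex) \<Rightarrow> ('d multi_index \<Rightarrow> complex) \<Rightarrow> ('d multi_index \<Rightarrow> complex)" where
  "coeff_map _ L lam H \<xi> x \<beta> =
     (if deg \<beta> = 0 then x \<beta>
      else if deg \<beta> = 1 then x \<beta> - \<xi> \<beta>
      else ps_char_fun TYPE('n) L (pairing lam \<beta>) * x \<beta> - H x \<beta>)"

definition param ::
    "complex^'d::finite \<Rightarrow> ('d multi_index \<Rightarrow> complex) \<Rightarrow> complex^'d \<Rightarrow>
      complex^'n::{finite,linorder} option" where
  "param lam p \<sigma> = (\<Sum>\<^sub>\<infinity>\<beta>. (p \<beta> * monomial \<sigma> \<beta>) *s ps_exp (pairing lam \<beta>))"

text \<open>The Taylor expansion of \<open>G\<close> at \<open>0\<close> converges locally uniformly on \<open>U\<close>, and on the real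
  points of \<open>U\<close> its sum is \<open>G\<close>.\<close>

definition taylor_valid :: "(hist \<Rightarrow> real) \<Rightarrow> (complex^'n::{finite,linorder} option) set \<Rightarrow> bool" where
  "taylor_valid G U \<longleftrightarrow>
     (\<forall>v\<in>U. \<exists>r>0. uniform_limit (ball v r)
        (\<lambda>N w. \<Sum>m<N. taylor_term G m (interp w)) (\<lambda>w. nonlin_complex G (interp w)) sequentially)"


section \<open>Local unstable manifolds\<close>

text \<open>A holomorphic chart, centred at \<open>w\<close>, of the subset \<open>W\<close>, with Jacobian \<open>J\<close>.\<close>

definition local_chart ::
    "(complex^'m) set \<Rightarrow> complex^'m \<Rightarrow> (complex^'d) set \<Rightarrow>
      (complex^'d \<Rightarrow> complex^'m) \<Rightarrow> (complex^'d \<Rightarrow> complex^'d^'m) \<Rightarrow> bool" where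
  "local_chart W w S \<phi> J \<longleftrightarrow>
     open S \<and> 0 \<in> S \<and> \<phi> 0 = w \<and>
     (\<exists>N \<psi>. open N \<and> homeomorphism S (W \<inter> N) \<phi> \<psi>) \<and>
     (\<forall>s\<in>S. (\<phi> has_derivative ((*v) (J s))) (at s) \<and> inj ((*v) (J s))) \<and>
     continuous_on S J"

text \<open>Points whose backward orbit under \<open>x' = f x\<close> stays in \<open>V\<close> and converges to \<open>0\<close>. Exponential
  convergence is required because the equilibrium may have centre directions; for a hyperbolic
  equilibrium and small \<open>V\<close> it is automatic.\<close>

definition local_unstable_set :: "('a::real_normed_vector \<Rightarrow> 'a) \<Rightarrow> 'a set \<Rightarrow> 'a set" where
  "local_unstable_set f V =
     {x. \<exists>u :: real \<Rightarrow> 'a. u 0 = x \<and>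
        (\<forall>t\<le>0. u t \<in> V \<and> (u has_vector_derivative f (u t)) (at t within {..0})) \<and>
        (\<exists>C. \<exists>\<gamma>>0. \<forall>t\<le>0. norm (u t) \<le> C * exp (\<gamma> * t))}"

text \<open>\<open>W\<close> is a local unstable manifold of the equilibrium \<open>0\<close> of \<open>x' = f x\<close> on the phase space
  \<open>U\<close>, with linearisation \<open>A\<close>: an embedded \<open>CARD('d)\<close>-dimensional submanifold, tangent at \<open>0\<close> to the
  unstable subspace, consisting of the points whose backward orbit remains in some neighbourhood
  \<open>V\<close> of \<open>0\<close> and converges to \<open>0\<close>.\<close>

definition local_unstable_manifold ::
    "'d::finite itself \<Rightarrow> (complex^'m \<Rightarrow> complex^'m) \<Rightarrow> complex^'m^'m \<Rightarrow>
      (complex^'m) set \<Rightarrow> (complex^'m) set \<Rightarrow> bool" where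
  "local_unstable_manifold _ f A U W \<longleftrightarrow>
     f 0 = 0 \<and> (f has_derivative ((*v) A)) (at 0) \<and>
     (\<forall>w\<in>W. \<exists>(S :: (complex^'d) set) \<phi> J. local_chart W w S \<phi> J) \<and>
     (\<exists>(S :: (complex^'d) set) \<phi> J. local_chart W 0 S \<phi> J \<and>
        range ((*v) (J 0)) = unstable_subspace A) \<and>
     (\<exists>V. open V \<and> 0 \<in> V \<and> V \<subseteq> U \<and> W = local_unstable_set f V)"

end

theory Submission
  imports Defs "HOL-Complex_Analysis.Complex_Analysis" "HOL-Real_Asymp.Real_Asymp"
begin

text \<open>
  With \<open>c\<^sub>\<beta> = p\<^sub>\<beta> (1, (D - \<langle>\<lambda>,\<beta>\<rangle>)\<^sup>-\<^sup>1 D 1)\<close> one has \<open>A c\<^sub>\<beta> = \<langle>\<lambda>,\<beta>\<rangle> c\<^sub>\<beta> - \<Delta>(\<langle>\<lambda>,\<beta>\<rangle>) p\<^sub>\<beta> e\<^sub>0\<close>, so the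
  coefficient equations say that \<open>P(\<sigma>) = \<Sum> c\<^sub>\<beta> \<sigma>\<^sup>\<beta>\<close> satisfies \<open>DP(\<sigma>) \<Lambda> \<sigma> = f(P(\<sigma>))\<close> to every order at
  \<open>0\<close>. The complexified Taylor terms are polynomials (by symmetry of iterated derivatives), both
  sides are therefore holomorphic along rays, and the identity holds on the unit ball: \<open>P\<close> maps
  the linear flow \<open>e\<^sup>\<Lambda>\<^sup>t \<sigma>\<close> to solutions.

  Near \<open>0\<close> the map \<open>P\<close> is an immersion. Flowing two points backward into that neighbourhood and
  comparing them by a Gronwall estimate shows that \<open>P\<close> is bi-Lipschitz on smaller balls and that
  no point of the unit sphere has the same image as a point of the open ball; hence \<open>P\<close> is a
  homeomorphic immersion onto its image \<open>W\<close>. With \<open>V = U - P(sphere)\<close>, a backward orbit in \<open>V\<close>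
  that converges exponentially to \<open>0\<close> lies on \<open>W\<close> for large negative times, by means of a
  Lyapunov form for the hyperbolic matrix \<open>A - \<kappa>\<close>, and it cannot leave \<open>W\<close> without meeting
  \<open>P(sphere)\<close>.
\<close>

no_notation fps_nth (infixl "$" 75)

lemmas norm_component_le = Finite_Cartesian_Product.norm_nth_le

section \<open>Iterated derivatives and Taylor polynomials\<close>

text \<open>Two obstacles shape the proof. First, \<open>G\<close> is merely smooth, and away from
  real arguments \<open>nonlin_complex G\<close> is the sum of a Taylor series.
  \<open>taylor_valid\<close> makes it a locally uniform limit of polynomials in the nodal values,
  so tools of one complex variable suffice on complex lines: Lipschitz bounds come from the Schwarz
  lemma, equality from flatness at \<open>0\<close>. Second, \<open>p\<close> is only absolutely
  summable: \<open>P\<close> is continuous on the closed ball and differentiable inside it, but on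
  the sphere it may leave \<open>U\<close>, where nothing is known about \<open>f\<close>. Gronwall
  estimates are therefore run on closed balls of radius below \<open>1\<close>, or up to the moment
  an orbit reaches the sphere. The shift \<kappa> is forced by possible eigenvalues on the imaginary
  axis: a rate strictly between \<open>0\<close> and all \<open>Re (lam $ i)\<close> separates the
  unstable directions from all others, and the exponential decay in
  \<open>local_unstable_set\<close> is what can be played against it.\<close>

lemma has_real_derivative_along_line:
  fixes g :: "'a::real_normed_vector \<Rightarrow> real"
  assumes "g differentiable (at (x + s *\<^sub>R u))"
  shows "((\<lambda>s. g (x + s *\<^sub>R u)) has_real_derivative frechet_derivative g (at (x + s *\<^sub>R u)) u) (at s)"
proof -
  let ?D = "frechet_derivative g (at (x + s *\<^sub>R u))"
  have D: "(g has_derivative ?D) (at (x + s *\<^sub>R u))"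
    using assms by (simp add: frechet_derivative_works)
  have "((\<lambda>s. x + s *\<^sub>R u) has_derivative (\<lambda>h. h *\<^sub>R u)) (at s)"
    by (auto intro!: derivative_eq_intros)
  from diff_chain_at[OF this D]
  have "((\<lambda>s. g (x + s *\<^sub>R u)) has_derivative (\<lambda>h. ?D (h *\<^sub>R u))) (at s)"
    by (simp add: o_def)
  moreover have "?D (h *\<^sub>R u) = ?D u * h" for h
    using linear_frechet_derivative[OF assms] by (simp add: linear_cmul)
  ultimately show ?thesis
    by (simp add: has_field_derivative_def)
qed

text \<open>The mean value theorem is applied along \<open>u\<close> and then along
  \<open>v\<close>. The left side is symmetric in \<open>u\<close> and \<open>v\<close>, so either
  mixed derivative can represent it.\<close>

lemma second_difference_eq:
  fixes g :: "'a::real_normed_vector \<Rightarrow> real"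
  assumes g: "\<And>x. g differentiable (at x)"
    and gu: "\<And>x. (\<lambda>y. frechet_derivative g (at y) u) differentiable (at x)"
    and "h > 0"
  obtains s t where "0 < s" "s < h" "0 < t" "t < h"
    "g (x + h *\<^sub>R u + h *\<^sub>R v) - g (x + h *\<^sub>R v) - g (x + h *\<^sub>R u) + g x
     = h\<^sup>2 * frechet_derivative (\<lambda>y. frechet_derivative g (at y) u) (at (x + s *\<^sub>R u + t *\<^sub>R v)) v"
proof -
  let ?gu = "\<lambda>y. frechet_derivative g (at y) u"
  let ?F = "\<lambda>s. g ((x + h *\<^sub>R v) + s *\<^sub>R u) - g (x + s *\<^sub>R u)"
  have "DERIV ?F s :> ?gu ((x + h *\<^sub>R v) + s *\<^sub>R u) - ?gu (x + s *\<^sub>R u)" for s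
    by (intro DERIV_diff has_real_derivative_along_line g)
  from MVT2[OF \<open>h > 0\<close> this] obtain s where s: "0 < s" "s < h"
    "?F h - ?F 0 = h * (?gu ((x + h *\<^sub>R v) + s *\<^sub>R u) - ?gu (x + s *\<^sub>R u))" by auto
  have "DERIV (\<lambda>t. ?gu ((x + s *\<^sub>R u) + t *\<^sub>R v)) t :>
      frechet_derivative ?gu (at ((x + s *\<^sub>R u) + t *\<^sub>R v)) v" for t
    by (intro has_real_derivative_along_line gu)
  from MVT2[OF \<open>h > 0\<close> this] obtain t where t: "0 < t" "t < h"
    "?gu ((x + s *\<^sub>R u) + h *\<^sub>R v) - ?gu (x + s *\<^sub>R u)
      = h * frechet_derivative ?gu (at ((x + s *\<^sub>R u) + t *\<^sub>R v)) v" by auto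
  have eq: "(x + h *\<^sub>R v) + s *\<^sub>R u = (x + s *\<^sub>R u) + h *\<^sub>R v" by simp
  have "?F h - ?F 0 = h\<^sup>2 * frechet_derivative ?gu (at ((x + s *\<^sub>R u) + t *\<^sub>R v)) v"
    unfolding s(3) eq t(3) by (simp add: power2_eq_square)
  moreover have "?F h - ?F 0
      = g (x + h *\<^sub>R u + h *\<^sub>R v) - g (x + h *\<^sub>R v) - g (x + h *\<^sub>R u) + g x"
    by (simp add: algebra_simps)
  ultimately show ?thesis using s t that by metis
qed

text \<open>One second difference equals \<open>h\<^sup>2\<close> times either mixed derivative at
  points that approach \<open>x\<close> with \<open>h\<close>, so two mixed derivatives continuous
  at \<open>x\<close> cannot differ there.\<close>

lemma frechet_derivative_commute:
  fixes g :: "'a::real_normed_vector \<Rightarrow> real"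
  assumes g: "\<And>x. g differentiable (at x)"
    and gu: "\<And>x. (\<lambda>y. frechet_derivative g (at y) u) differentiable (at x)"
    and gv: "\<And>x. (\<lambda>y. frechet_derivative g (at y) v) differentiable (at x)"
    and cuv: "isCont (\<lambda>x. frechet_derivative (\<lambda>y. frechet_derivative g (at y) u) (at x) v) x"
    and cvu: "isCont (\<lambda>x. frechet_derivative (\<lambda>y. frechet_derivative g (at y) v) (at x) u) x"
  shows "frechet_derivative (\<lambda>y. frechet_derivative g (at y) u) (at x) v
       = frechet_derivative (\<lambda>y. frechet_derivative g (at y) v) (at x) u"
    (is "?A x = ?B x")
proof (rule ccontr)
  assume ne: "?A x \<noteq> ?B x"
  define e where "e = \<bar>?A x - ?B x\<bar> / 2"
  have e: "e > 0" using ne by (simp add: e_def)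
  obtain d1 where d1: "d1 > 0" "\<And>y. dist y x < d1 \<Longrightarrow> \<bar>?A y - ?A x\<bar> < e"
    using cuv e unfolding continuous_at_eps_delta dist_real_def by blast
  obtain d2 where d2: "d2 > 0" "\<And>y. dist y x < d2 \<Longrightarrow> \<bar>?B y - ?B x\<bar> < e"
    using cvu e unfolding continuous_at_eps_delta dist_real_def by blast
  define d where "d = min d1 d2"
  \<comment> \<open>All points \<open>x + s *\<^sub>R u + t *\<^sub>R v\<close> with
    \<open>s\<close> and \<open>t\<close> between \<open>0\<close> and \<open>h\<close> then stay
    within \<open>d\<close> of \<open>x\<close>; the summand \<open>1\<close> covers the case that
    both directions vanish.\<close>
  define h where "h = d / (norm u + norm v + 1)"
  have pos: "norm u + norm v + 1 > 0"
    by (simp add: add_nonneg_pos)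
  have d: "d > 0" using d1 d2 by (simp add: d_def)
  have h: "h > 0" using d pos by (simp add: h_def)
  have near: "dist (x + s *\<^sub>R u + t *\<^sub>R v) x < d" if "0 < s" "s < h" "0 < t" "t < h" for s t
  proof -
    have "dist (x + s *\<^sub>R u + t *\<^sub>R v) x \<le> norm (s *\<^sub>R u) + norm (t *\<^sub>R v)"
      unfolding dist_norm by (metis (no_types) add.assoc add_diff_cancel_left' norm_triangle_ineq)
    also have "\<dots> \<le> h * norm u + h * norm v"
      using that by (intro add_mono) (auto intro: mult_right_mono)
    also have "\<dots> < h * (norm u + norm v + 1)" using h by (simp add: algebra_simps)
    also have "\<dots> = d" using pos by (simp add: h_def)
    finally show ?thesis .
  qed
  obtain s t where st: "0 < s" "s < h" "0 < t" "t < h"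
    "g (x + h *\<^sub>R u + h *\<^sub>R v) - g (x + h *\<^sub>R v) - g (x + h *\<^sub>R u) + g x
     = h\<^sup>2 * ?A (x + s *\<^sub>R u + t *\<^sub>R v)"
    using second_difference_eq[OF g gu h, of x v] by metis
  obtain s' t' where st': "0 < s'" "s' < h" "0 < t'" "t' < h"
    "g (x + h *\<^sub>R v + h *\<^sub>R u) - g (x + h *\<^sub>R u) - g (x + h *\<^sub>R v) + g x
     = h\<^sup>2 * ?B (x + s' *\<^sub>R v + t' *\<^sub>R u)"
    using second_difference_eq[OF g gv h, of x u] by metis
  have "h\<^sup>2 * ?A (x + s *\<^sub>R u + t *\<^sub>R v) = h\<^sup>2 * ?B (x + t' *\<^sub>R u + s' *\<^sub>R v)"
    using st(5) st'(5) by (simp add: algebra_simps)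
  then have eq: "?A (x + s *\<^sub>R u + t *\<^sub>R v) = ?B (x + t' *\<^sub>R u + s' *\<^sub>R v)"
    using h by simp
  have "\<bar>?A (x + s *\<^sub>R u + t *\<^sub>R v) - ?A x\<bar> < e"
    using near[OF st(1-4)] by (intro d1) (simp add: d_def)
  moreover have "\<bar>?B (x + t' *\<^sub>R u + s' *\<^sub>R v) - ?B x\<bar> < e"
    using near[OF st'(3,4,1,2)] by (intro d2) (simp add: d_def)
  moreover have "\<bar>?A x - ?B x\<bar> = 2 * e" by (simp add: e_def)
  ultimately show False unfolding eq by linarith
qed

text \<open>Since the condition ranges over all lists, it also yields continuity of every iterated
  derivative, which the exchange of directions needs.\<close>

definition smooth :: "('a::real_normed_vector \<Rightarrow> real) \<Rightarrow> bool" where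
  "smooth G \<longleftrightarrow> (\<forall>vs x. iter_deriv G vs differentiable (at x))"

lemma smooth_if_Ck: "(\<And>k. Ck k G) \<Longrightarrow> smooth G"
  unfolding smooth_def Ck_def by (meson lessI)

lemma smoothD: "smooth G \<Longrightarrow> iter_deriv G vs differentiable (at x)"
  by (simp add: smooth_def)

lemma iter_deriv_swap:
  assumes "smooth G"
  shows "iter_deriv G (u # v # vs) = iter_deriv G (v # u # vs)"
proof
  fix x
  have D: "iter_deriv G ws differentiable (at y)" for ws y using assms by (rule smoothD)
  have C: "isCont (iter_deriv G ws) y" for ws y
    by (rule differentiable_imp_continuous_within[OF D])
  from C[of x "u # v # vs"] C[of x "v # u # vs"] D[of "u # vs"] D[of "v # vs"] D[of vs]
  show "iter_deriv G (u # v # vs) x = iter_deriv G (v # u # vs) x"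
    by (simp add: frechet_derivative_commute)
qed

lemma iter_deriv_move_front:
  assumes "smooth G"
  shows "iter_deriv G (us @ v # vs) = iter_deriv G (v # us @ vs)"
proof (induction us)
  case (Cons a us)
  have "iter_deriv G ((a # us) @ v # vs) = iter_deriv G (a # v # us @ vs)"
    using Cons.IH by simp
  also have "\<dots> = iter_deriv G (v # a # us @ vs)" by (rule iter_deriv_swap[OF assms])
  finally show ?case by simp
qed simp

lemma iter_deriv_perm:
  assumes "smooth G" and "mset us = mset vs"
  shows "iter_deriv G us = iter_deriv G vs"
  using assms(2)
proof (induction us arbitrary: vs)
  case (Cons a us)
  then have "a \<in> set vs" by (metis list.set_intros(1) mset_eq_setD)
  then obtain ws ws' where vs: "vs = ws @ a # ws'" by (metis split_list)
  with Cons.prems have "mset us = mset (ws @ ws')" by simp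
  from Cons.IH[OF this] have "iter_deriv G (a # us) = iter_deriv G (a # ws @ ws')" by simp
  then show ?case using iter_deriv_move_front[OF assms(1)] vs by metis
qed simp

lemma iter_deriv_sum_front:
  assumes "smooth G" "finite K"
  shows "iter_deriv G ((\<Sum>k\<in>K. a k *\<^sub>R l k) # vs) x = (\<Sum>k\<in>K. a k * iter_deriv G (l k # vs) x)"
  using linear_frechet_derivative[OF smoothD[OF assms(1)], of vs x]
  by (simp add: linear_sum linear_cmul)

section \<open>Complex multilinear extension of the iterated derivatives\<close>

lemma sum_binomial_Suc:
  fixes x :: "nat \<Rightarrow> 'a::comm_semiring_1"
  shows "(\<Sum>j\<le>Suc m. of_nat (Suc m choose j) * x j)
    = (\<Sum>j\<le>m. of_nat (m choose j) * x j) + (\<Sum>j\<le>m. of_nat (m choose j) * x (Suc j))"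
proof -
  have "(\<Sum>j\<le>Suc m. of_nat (Suc m choose j) * x j)
      = x 0 + (\<Sum>j\<le>m. of_nat (Suc m choose Suc j) * x (Suc j))"
    by (subst sum.atMost_Suc_shift) simp
  also have "\<dots> = x 0 + (\<Sum>j\<le>m. of_nat (m choose Suc j) * x (Suc j))
      + (\<Sum>j\<le>m. of_nat (m choose j) * x (Suc j))"
    by (simp add: algebra_simps sum.distrib)
  also have "x 0 + (\<Sum>j\<le>m. of_nat (m choose Suc j) * x (Suc j))
      = (\<Sum>j\<le>Suc m. of_nat (m choose j) * x j)"
    by (subst sum.atMost_Suc_shift) simp
  also have "\<dots> = (\<Sum>j\<le>m. of_nat (m choose j) * x j)"
    by (simp add: binomial_eq_0)
  finally show ?thesis .
qed

text \<open>The complex-multilinear extension of \<open>B\<close> at \<open>m\<close> copies of the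
  combination of the \<open>l k\<close> with coefficients \<open>w $ k\<close>, followed by
  \<open>us\<close>. The list \<open>us\<close> accumulates the real vectors already selected, so
  \<open>B\<close> itself is evaluated at real arguments; unfolding exhibits a polynomial in
  \<open>w\<close>.\<close>

primrec multilin_poly :: "('a list \<Rightarrow> real) \<Rightarrow> ('i \<Rightarrow> 'a) \<Rightarrow> nat \<Rightarrow> 'a list \<Rightarrow> complex^'i::finite \<Rightarrow> complex" where
  "multilin_poly B l 0 us w = of_real (B us)"
| "multilin_poly B l (Suc m) us w = (\<Sum>k\<in>UNIV. w $ k * multilin_poly B l m (l k # us) w)"

text \<open>Induction on the number of arguments, general in \<open>us\<close>: Pascal's rule splits
  off one argument \<open>a + \<i> b\<close>, symmetry moves it into \<open>us\<close>, and
  linearity in this slot expands it in the \<open>l k\<close>.\<close>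

lemma complexified_form_eq_multilin_poly:
  fixes G :: "'a::real_normed_vector \<Rightarrow> real" and w :: "complex^'i::finite"
  assumes G: "smooth G"
    and a: "a = (\<Sum>k\<in>UNIV. Re (w $ k) *\<^sub>R l k)" and b: "b = (\<Sum>k\<in>UNIV. Im (w $ k) *\<^sub>R l k)"
  shows "(\<Sum>j\<le>m. of_nat (m choose j) * (\<i> ^ j *
      of_real (iter_deriv G (replicate (m - j) a @ replicate j b @ us) x)))
    = multilin_poly (\<lambda>vs. iter_deriv G vs x) l m us w"
proof (induction m arbitrary: us)
  case (Suc m)
  define X where "X m us j = \<i> ^ j * of_real (iter_deriv G (replicate (m - j) a @ replicate j b @ us) x)"
    for m us j
  define S where "S m us = (\<Sum>j\<le>m. of_nat (m choose j) * X m us j)" for m us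
  \<comment> \<open>Linearity is available for the first entry of a list; symmetry brings the head
    of \<open>us\<close> to the front of the whole list.\<close>
  have lin: "S m ((\<Sum>k\<in>UNIV. c k *\<^sub>R l k) # us) = (\<Sum>k\<in>UNIV. of_real (c k) * S m (l k # us))" for c
  proof -
    have "X m ((\<Sum>k\<in>UNIV. c k *\<^sub>R l k) # us) j = (\<Sum>k\<in>UNIV. of_real (c k) * X m (l k # us) j)" for j
      using iter_deriv_move_front[OF G, of "replicate (m - j) a @ replicate j b"]
      by (simp add: iter_deriv_sum_front[OF G] X_def sum_distrib_left mult_ac del: iter_deriv.simps)
    then show ?thesis
      unfolding S_def sum_distrib_left by (subst sum.swap) (simp add: mult_ac sum_distrib_left)
  qed
  have X1: "X (Suc m) us j = X m (a # us) j" if "j \<le> m" for j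
    using that unfolding X_def
    by (subst iter_deriv_perm[OF G, of _ "replicate (m - j) a @ replicate j b @ a # us"])
       (auto simp: Suc_diff_le)
  have X2: "X (Suc m) us (Suc j) = \<i> * X m (b # us) j" if "j \<le> m" for j
    using that unfolding X_def
    by (subst iter_deriv_perm[OF G, of _ "replicate (m - j) a @ replicate j b @ b # us"])
       (auto)
  have "S (Suc m) us = S m (a # us) + \<i> * S m (b # us)"
    unfolding S_def sum_binomial_Suc
    by (simp add: X1 X2 sum_distrib_left mult_ac del: sum.atMost_Suc)
  also have "\<dots> = (\<Sum>k\<in>UNIV. (of_real (Re (w $ k)) + \<i> * of_real (Im (w $ k))) * S m (l k # us))"
    unfolding a b lin by (simp add: sum_distrib_left sum.distrib algebra_simps)
  also have "\<dots> = (\<Sum>k\<in>UNIV. w $ k * S m (l k # us))"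
    by (simp add: complex_eq[symmetric])
  also have "\<dots> = multilin_poly (\<lambda>vs. iter_deriv G vs x) l (Suc m) us w"
    using Suc.IH by (simp add: S_def X_def)
  finally show ?case by (simp add: S_def X_def)
qed simp

lemma multilin_poly_scale:
  "multilin_poly B l m us (c *s w) = c ^ m * multilin_poly B l m us w"
  by (induction m arbitrary: us) (auto simp: sum_distrib_left mult_ac)

lemma continuous_on_multilin_poly: "continuous_on S (multilin_poly B l m us)"
  by (induction m arbitrary: us) (auto intro!: continuous_intros)

lemma holomorphic_on_multilin_poly:
  assumes "\<And>k. (\<lambda>z. g z $ k) holomorphic_on S"
  shows "(\<lambda>z. multilin_poly B l m us (g z)) holomorphic_on S"
  by (induction m arbitrary: us) (auto intro!: holomorphic_intros assms)

lemma multilin_poly_lipschitz: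
  "\<exists>C. \<forall>v\<in>cball 0 R. \<forall>w\<in>cball 0 R.
    norm (multilin_poly B l m us v - multilin_poly B l m us w) \<le> C * norm (v - w)"
proof (induction m arbitrary: us)
  case 0
  show ?case by (auto intro!: exI[of _ 0])
next
  case (Suc m)
  have "\<exists>C. \<forall>v\<in>cball 0 R. \<forall>w\<in>cball 0 R. norm (v $ k * multilin_poly B l m (l k # us) v
     - w $ k * multilin_poly B l m (l k # us) w) \<le> C * norm (v - w)" for k
  proof -
    let ?p = "multilin_poly B l m (l k # us)"
    obtain C where C: "\<And>v w. v \<in> cball 0 R \<Longrightarrow> w \<in> cball 0 R \<Longrightarrow> norm (?p v - ?p w) \<le> C * norm (v - w)"
      using Suc.IH[of "l k # us"] by blast
    have "compact (?p ` cball 0 R)"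
      by (intro compact_continuous_image continuous_on_multilin_poly) simp
    then obtain M where M: "\<And>v. v \<in> cball 0 R \<Longrightarrow> norm (?p v) \<le> M"
      using compact_imp_bounded bounded_iff by (metis imageI)
    have "norm (v $ k * ?p v - w $ k * ?p w) \<le> (R * C + M) * norm (v - w)"
      if v: "v \<in> cball 0 R" and w: "w \<in> cball 0 R" for v w
    proof -
      have "norm (v $ k) \<le> R" using v norm_component_le[of v k] by simp
      then have R: "R \<ge> 0" and vk: "norm (v $ k) \<le> R" using norm_ge_zero order_trans by blast+
      have "v $ k * ?p v - w $ k * ?p w = v $ k * (?p v - ?p w) + (v - w) $ k * ?p w"
        by (simp add: algebra_simps)
      also have "norm \<dots> \<le> norm (v $ k) * norm (?p v - ?p w) + norm ((v - w) $ k) * norm (?p w)"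
        by (metis norm_mult norm_triangle_ineq)
      also have "\<dots> \<le> R * (C * norm (v - w)) + norm (v - w) * M"
        using vk C[OF v w] M[OF w] R norm_component_le[of "v - w" k]
        by (intro add_mono mult_mono) auto
      finally show ?thesis by (simp add: algebra_simps)
    qed
    then show ?thesis by blast
  qed
  then obtain C where C: "\<And>k v w. v \<in> cball 0 R \<Longrightarrow> w \<in> cball 0 R \<Longrightarrow>
    norm (v $ k * multilin_poly B l m (l k # us) v - w $ k * multilin_poly B l m (l k # us) w)
      \<le> C k * norm (v - w)"
    by metis
  show ?case
    by (rule exI[of _ "\<Sum>k\<in>UNIV. C k"])
       (auto simp: sum_subtractf[symmetric] sum_distrib_right intro!: sum_norm_le C)
qed

section \<open>Taylor terms as polynomials in the nodal values\<close>

definition lag_node :: "'n::{finite,linorder} option \<Rightarrow> real \<Rightarrow> real" where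
  "lag_node k = lagrange CARD('n) (case k of None \<Rightarrow> 0 | Some j \<Rightarrow> pos j)"

lemma sum_option_UNIV:
  fixes f :: "'n::finite option \<Rightarrow> 'b::comm_monoid_add"
  shows "(\<Sum>k\<in>UNIV. f k) = f None + (\<Sum>j\<in>UNIV. f (Some j))"
  by (simp add: UNIV_option_conv sum.reindex)

lemma interp_eq_sum: "interp w \<theta> = (\<Sum>k\<in>UNIV. w $ k * of_real (lag_node k \<theta>))"
  by (simp add: interp_def sum_option_UNIV lag_node_def)

lemma continuous_on_lag_node: "continuous_on S (lag_node k)"
proof -
  have "lag_node k = (\<lambda>\<theta>. \<Prod>m\<in>{0..CARD('a)} - {case k of None \<Rightarrow> 0 | Some j \<Rightarrow> pos j}.
    (\<theta> - mesh CARD('a) m) / (mesh CARD('a) (case k of None \<Rightarrow> 0 | Some j \<Rightarrow> pos j) - mesh CARD('a) m))"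
    by (auto simp: lag_node_def lagrange_def)
  then show ?thesis unfolding divide_inverse by (auto intro!: continuous_intros)
qed

lemma hist_sum_lag_node:
  "hist (\<lambda>\<theta>. \<Sum>k\<in>UNIV. c k * lag_node k \<theta>) = (\<Sum>k\<in>UNIV. c k *\<^sub>R hist (lag_node k))"
proof (rule bcontfun_eqI)
  fix x
  have "apply_bcontfun (\<Sum>k\<in>K. c k *\<^sub>R hist (lag_node k)) x = (\<Sum>k\<in>K. c k * lag_node k (Rep_delay x))"
    if "finite K" for K
    using that by (induction K) (auto simp: hist_apply continuous_on_lag_node)
  then show "apply_bcontfun (hist (\<lambda>\<theta>. \<Sum>k\<in>UNIV. c k * lag_node k \<theta>)) x =
         apply_bcontfun (\<Sum>k\<in>UNIV. c k *\<^sub>R hist (lag_node k)) x"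
    by (subst hist_apply) (auto intro!: continuous_intros continuous_on_lag_node)
qed

lemma hist_Re_interp: "hist (\<lambda>\<theta>. Re (interp w \<theta>)) = (\<Sum>k\<in>UNIV. Re (w $ k) *\<^sub>R hist (lag_node k))"
  and hist_Im_interp: "hist (\<lambda>\<theta>. Im (interp w \<theta>)) = (\<Sum>k\<in>UNIV. Im (w $ k) *\<^sub>R hist (lag_node k))"
  by (simp_all add: interp_eq_sum flip: hist_sum_lag_node)

definition taylor_poly :: "(hist \<Rightarrow> real) \<Rightarrow> nat \<Rightarrow> complex^'n::{finite,linorder} option \<Rightarrow> complex" where
  "taylor_poly G m w = multilin_poly (\<lambda>vs. iter_deriv G vs 0) (\<lambda>k. hist (lag_node k)) m [] w / fact m"

text \<open>The Taylor term is defined through real and imaginary parts; in nodal values it is a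
  polynomial in the complex vector \<open>w\<close>, from which homogeneity, continuity and
  holomorphy are read off.\<close>

lemma taylor_term_interp:
  assumes "smooth G"
  shows "taylor_term G m (interp w) = taylor_poly G m w"
  unfolding taylor_term_def taylor_poly_def
  by (subst complexified_form_eq_multilin_poly[OF assms hist_Re_interp hist_Im_interp, of _ _ "[]", symmetric])
     (simp add: mult_ac)

lemma taylor_poly_scale: "taylor_poly G m (c *s w) = c ^ m * taylor_poly G m w"
  by (simp add: taylor_poly_def multilin_poly_scale)

lemma continuous_on_taylor_poly: "continuous_on S (taylor_poly G m)"
  unfolding taylor_poly_def by (intro continuous_intros continuous_on_multilin_poly) simp

lemma holomorphic_on_taylor_poly:
  "(\<And>k. (\<lambda>z. g z $ k) holomorphic_on S) \<Longrightarrow> (\<lambda>z. taylor_poly G m (g z)) holomorphic_on S"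
  unfolding taylor_poly_def by (intro holomorphic_intros holomorphic_on_multilin_poly) auto

lemma taylor_poly_lipschitz:
  fixes G :: "hist \<Rightarrow> real"
  shows "\<exists>C. \<forall>v\<in>cball 0 R. \<forall>w\<in>cball (0 :: complex^'n::{finite,linorder} option) R.
    norm (taylor_poly G m v - taylor_poly G m w) \<le> C * norm (v - w)"
proof -
  obtain C where C: "\<And>v w :: complex^'n::{finite,linorder} option.
      v \<in> cball 0 R \<Longrightarrow> w \<in> cball 0 R \<Longrightarrow> norm (multilin_poly (\<lambda>vs. iter_deriv G vs 0) (\<lambda>k. hist (lag_node k)) m [] v
       - multilin_poly (\<lambda>vs. iter_deriv G vs 0) (\<lambda>k. hist (lag_node k)) m [] w) \<le> C * norm (v - w)"
    using multilin_poly_lipschitz by metis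
  show ?thesis
    by (rule exI[of _ "C / fact m"])
       (use C in \<open>auto simp: taylor_poly_def norm_divide intro!: divide_right_mono
          simp flip: diff_divide_distrib\<close>)
qed

lemma taylor_poly_0: "G 0 = 0 \<Longrightarrow> taylor_poly G 0 w = 0"
  by (simp add: taylor_poly_def)

lemma taylor_poly_1: "(G has_derivative (\<lambda>_. 0)) (at 0) \<Longrightarrow> taylor_poly G (Suc 0) w = 0"
  using frechet_derivative_at[of G "\<lambda>_. 0" 0]
  by (simp add: taylor_poly_def flip: frechet_derivative_at)

section \<open>The complexified nonlinearity\<close>

lemma norm_vector_smult [simp]: "norm (c *s x) = norm c * norm (x :: complex^'m)"
  by (simp add: norm_vec_def vector_scalar_mult_def norm_mult L2_set_right_distrib)

abbreviation nonlin :: "(hist \<Rightarrow> real) \<Rightarrow> complex^'n::{finite,linorder} option \<Rightarrow> complex" where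
  "nonlin G w \<equiv> nonlin_complex G (interp w)"

lemma taylor_validD:
  assumes "smooth G" "taylor_valid G U" "v \<in> U"
  obtains r where "r > 0"
    "uniform_limit (ball v r) (\<lambda>M w. \<Sum>m<M. taylor_poly G m w) (\<lambda>w. nonlin G w) sequentially"
  using assms by (auto simp: taylor_valid_def taylor_term_interp)

text \<open>Locally uniform limits of holomorphic functions are holomorphic; continuity of
  \<open>g\<close> pulls the balls of \<open>taylor_valid\<close> back to discs.\<close>

lemma holomorphic_on_nonlin:
  fixes g :: "complex \<Rightarrow> complex^'n::{finite,linorder} option"
  assumes G: "smooth G" and U: "taylor_valid G U" and S: "open S"
    and g: "\<And>k. (\<lambda>z. g z $ k) holomorphic_on S" and gU: "g ` S \<subseteq> U"
  shows "(\<lambda>z. nonlin G (g z)) holomorphic_on S"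
proof (rule holomorphic_uniform_sequence[OF S])
  show "(\<lambda>z. \<Sum>m<M. taylor_poly G m (g z)) holomorphic_on S" for M
    by (intro holomorphic_intros holomorphic_on_taylor_poly g)
  have "continuous_on S (\<lambda>z. \<chi> k. g z $ k)"
    by (intro continuous_on_vec_lambda holomorphic_on_imp_continuous_on g)
  then have cont: "continuous_on S g" by simp
  show "\<exists>d>0. cball z d \<subseteq> S \<and>
      uniform_limit (cball z d) (\<lambda>M z. \<Sum>m<M. taylor_poly G m (g z))
        (\<lambda>z. nonlin G (g z)) sequentially" if z: "z \<in> S" for z
  proof -
    obtain r where r: "r > 0"
      "uniform_limit (ball (g z) r) (\<lambda>M w. \<Sum>m<M. taylor_poly G m w) (\<lambda>w. nonlin G w) sequentially"
      using taylor_validD[OF G U, of "g z"] gU z by blast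
    have "open (S \<inter> g -` ball (g z) r)" using cont S by (intro continuous_open_preimage) auto
    moreover have "z \<in> S \<inter> g -` ball (g z) r" using z r by simp
    ultimately obtain d where d: "d > 0" "cball z d \<subseteq> S \<inter> g -` ball (g z) r"
      using open_contains_cball by metis
    have "uniform_limit (cball z d) (\<lambda>M z. \<Sum>m<M. taylor_poly G m (g z))
        (\<lambda>z. nonlin G (g z)) sequentially"
      using uniform_limit_compose'[OF r(2), of g "cball z d"] d(2) by auto
    then show ?thesis using d by blast
  qed
qed

lemma isCont_nonlin:
  fixes v :: "complex^'n::{finite,linorder} option"
  assumes "smooth G" "taylor_valid G U" "v \<in> U"
  shows "isCont (\<lambda>w. nonlin G w) v"
proof -
  obtain r where r: "r > 0"
    "uniform_limit (ball v r) (\<lambda>M w. \<Sum>m<M. taylor_poly G m w) (\<lambda>w. nonlin G w) sequentially"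
    using taylor_validD[OF assms] .
  have "continuous_on (ball v r) (\<lambda>w. nonlin G w)"
    by (rule uniform_limit_theorem[OF _ r(2)])
       (auto intro!: always_eventually continuous_on_sum continuous_on_taylor_poly)
  then show ?thesis using r(1) by (simp add: continuous_on_eq_continuous_at)
qed

section \<open>Lipschitz estimates from the Schwarz lemma\<close>

lemma holomorphic_Schwarz_bound:
  assumes f: "f holomorphic_on ball 0 s" and M: "\<And>z. z \<in> ball 0 s \<Longrightarrow> norm (f z) < M"
    and z: "z \<in> ball 0 s"
  shows "norm (f z - f 0) \<le> 2 * M / s * norm z"
proof -
  have s: "s > 0" using z by (metis mem_ball_0 norm_ge_zero le_less_trans)
  have M0: "M > 0" using M[OF z] by (metis norm_ge_zero le_less_trans)
  \<comment> \<open>\<open>f - f 0\<close> is bounded by \<open>2 * M\<close> on the disc.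
    Normalised to the unit disc it meets the Schwarz lemma, whose bound scales back to the slope
    \<open>2 * M / s\<close>.\<close>
  define g where "g w = (f (of_real s * w) - f 0) / of_real (2 * M)" for w
  have "(f \<circ> (\<lambda>w. of_real s * w)) holomorphic_on ball 0 1"
    using s by (intro holomorphic_on_compose_gen[OF _ f] holomorphic_intros) (auto simp: norm_mult)
  then have "g holomorphic_on ball 0 1"
    unfolding g_def o_def using M0 by (intro holomorphic_intros) auto
  moreover have "norm (g w) < 1"  if "norm w < 1" for w
  proof -
    have "norm (f (of_real s * w) - f 0) \<le> norm (f (of_real s * w)) + norm (f 0)"
      by (rule norm_triangle_ineq4)
    also have "\<dots> < 2 * M" using M[of "of_real s * w"] M[of 0] that s by (simp add: norm_mult)
    finally show ?thesis using M0 by (simp add: g_def norm_divide)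
  qed
  moreover have "g 0 = 0" by (simp add: g_def)
  moreover have "norm (z / of_real s) < 1" using z s by (simp add: norm_divide)
  ultimately have "norm (g (z / of_real s)) \<le> norm (z / of_real s)"
    by (intro Schwarz_Lemma(1))
  then show ?thesis using s M0 by (simp add: g_def norm_divide field_simps)
qed

text \<open>On the complex line through \<open>v\<close> and \<open>w\<close> the Schwarz lemma
  turns a bound on the values into a Lipschitz estimate, so the uniform limit never has to be
  differentiated in several variables.\<close>

lemma nonlin_lipschitz_step:
  fixes v w :: "complex^'n::{finite,linorder} option"
  assumes G: "smooth G" and U: "taylor_valid G U" and s: "ball v s \<subseteq> U"
    and M: "\<And>x. x \<in> ball v s \<Longrightarrow> norm (nonlin G x) < M" and w: "w \<in> ball v s"
  shows "norm (nonlin G w - nonlin G v) \<le> 2 * M / s * norm (w - v)"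
proof (cases "w = v")
  case False
  define u where "u = of_real (1 / norm (w - v)) *s (w - v)"
  have u: "norm u = 1" using False unfolding u_def norm_vector_smult by (simp add: norm_divide)
  define g where "g z = v + z *s u" for z
  have ball: "g z \<in> ball v s" if "z \<in> ball 0 s" for z
    using that u by (simp add: g_def dist_norm)
  have "(\<lambda>z. nonlin G (g z)) holomorphic_on ball 0 s"
    using ball s by (intro holomorphic_on_nonlin[OF G U]) (auto simp: g_def intro!: holomorphic_intros)
  then have "norm (nonlin G (g (of_real (norm (w - v)))) - nonlin G (g 0))
      \<le> 2 * M / s * norm (complex_of_real (norm (w - v)))"
    using w by (intro holomorphic_Schwarz_bound M ball) (auto simp: dist_norm norm_minus_commute)
  then show ?thesis using False by (simp add: g_def u_def)
qed simp

lemma nonlin_locally_lipschitz: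
  fixes v :: "complex^'n::{finite,linorder} option"
  assumes G: "smooth G" and U: "taylor_valid G U" "open U" and v: "v \<in> U"
  obtains r L where "r > 0" "L-lipschitz_on (ball v r) (\<lambda>w. nonlin G w)"
proof -
  let ?N = "\<lambda>w. nonlin G w"
  obtain d where d: "d > 0" "\<And>w. dist w v < d \<Longrightarrow> dist (?N w) (?N v) < 1"
    using isCont_nonlin[OF G U(1) v] unfolding continuous_at_eps_delta by (metis zero_less_one)
  obtain e where e: "e > 0" "ball v e \<subseteq> U" using U(2) v open_contains_ball by blast
  define s where "s = min d e / 2"
  have s: "s > 0" using d e by (simp add: s_def)
  define M where "M = norm (?N v) + 1"
  have M: "norm (?N w) < M" if "w \<in> ball v (2 * s)" for w
  proof -
    have "dist (?N w) (?N v) < 1" using that by (intro d) (auto simp: s_def dist_commute)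
    moreover have "norm (?N w) \<le> norm (?N v) + norm (?N w - ?N v)" by (metis add.commute norm_diff_ineq norm_triangle_sub)
    ultimately show ?thesis by (simp add: M_def dist_norm)
  qed
  have "(2 * M / s)-lipschitz_on (ball v (s/2)) ?N"
  proof (rule lipschitz_onI)
    show "0 \<le> 2 * M / s" using s by (simp add: M_def)
    fix x y assume xy: "x \<in> ball v (s/2)" "y \<in> ball v (s/2)"
    \<comment> \<open>The estimate is centred at \<open>y\<close>, so the ball of radius
      \<open>s\<close> around \<open>y\<close> must stay where the nonlinearity is bounded by
      \<open>M\<close>.\<close>
    have sub: "ball y s \<subseteq> ball v (2 * s)"
    proof
      fix z assume "z \<in> ball y s"
      then show "z \<in> ball v (2 * s)" using xy(2) s dist_triangle[of v z y] by auto
    qed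
    have "x \<in> ball y s" using xy dist_triangle[of y x v] by (auto simp: dist_commute)
    moreover have "ball v (2 * s) \<subseteq> U" using e(2) by (auto simp: s_def)
    ultimately show "dist (?N x) (?N y) \<le> 2 * M / s * dist x y"
      unfolding dist_norm using sub
      by (intro nonlin_lipschitz_step[OF G U(1)] M) auto
  qed
  then show ?thesis using that s by (meson half_gt_zero)
qed

section \<open>Taylor remainders near 0\<close>

lemma norm_geometric_tail_le:
  fixes X :: "nat \<Rightarrow> 'a::banach"
  assumes X: "\<And>j. norm (X j) \<le> M * t ^ j" and t: "0 \<le> t" "t \<le> 1/2" and S: "X sums S"
  shows "norm (S - (\<Sum>j\<le>k. X j)) \<le> 2 * M * t ^ Suc k"
proof -
  have M: "M \<ge> 0" using order_trans[OF norm_ge_zero X[of 0]] by simp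
  have "(\<lambda>j. X (j + Suc k)) sums (S - (\<Sum>j<Suc k. X j))"
    by (rule sums_split_initial_segment[OF S])
  then have eq: "S - (\<Sum>j\<le>k. X j) = (\<Sum>j. X (j + Suc k))"
    by (metis lessThan_Suc_atMost sums_unique)
  have geo: "(\<lambda>j. M * t ^ (j + Suc k)) sums (M * t ^ Suc k * (1 / (1 - t)))"
    using t sums_mult[OF geometric_sums[of t], of "M * t ^ Suc k"]
    by (simp add: power_add mult_ac)
  have "norm (\<Sum>j. X (j + Suc k)) \<le> (\<Sum>j. M * t ^ (j + Suc k))"
    by (intro norm_suminf_le X sums_summable[OF geo])
  also have "\<dots> = M * t ^ Suc k * (1 / (1 - t))" using geo by (simp add: sums_iff)
  also have "\<dots> \<le> M * t ^ Suc k * 2"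
    using t M by (intro mult_left_mono) (auto simp: field_simps)
  finally show ?thesis unfolding eq by (simp add: mult_ac)
qed

text \<open>A bound common to all Taylor terms on one ball becomes geometric decay after scaling,
  because the term of index \<open>m\<close> is homogeneous of degree \<open>m\<close>. One radius
  serves every order \<open>k\<close>.\<close>

lemma nonlin_Taylor_remainder:
  fixes U :: "(complex^'n::{finite,linorder} option) set"
  assumes G: "smooth G" and U: "taylor_valid G U" "0 \<in> U"
  obtains r where "r > 0" "\<And>k. \<exists>C\<ge>0. \<forall>w :: complex^'n option. norm w \<le> r \<longrightarrow>
    norm (nonlin G w - (\<Sum>m\<le>k. taylor_poly G m w)) \<le> C * norm w ^ Suc k"
proof -
  let ?N = "\<lambda>w :: complex^'n option. nonlin G w" and ?T = "taylor_poly G :: nat \<Rightarrow> complex^'n option \<Rightarrow> complex"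
  obtain r0 where r0: "r0 > 0" and lim: "uniform_limit (ball 0 r0) (\<lambda>M w. \<Sum>m<M. ?T m w) ?N sequentially"
    using taylor_validD[OF G U] by blast
  define r1 where "r1 = r0 / 2"
  have r1: "r1 > 0" "r1 < r0" using r0 by (auto simp: r1_def)
  obtain M where M: "\<And>m w. m \<ge> M \<Longrightarrow> w \<in> ball 0 r0 \<Longrightarrow> dist (\<Sum>j<m. ?T j w) (?N w) < 1"
    using uniform_limitD[OF lim, of 1] unfolding eventually_sequentially by (auto simp: Ball_def)
  have "\<exists>B. \<forall>w\<in>cball 0 r1. norm (?T m w) \<le> B" for m
  proof -
    have "compact (?T m ` cball 0 r1)"
      by (intro compact_continuous_image continuous_on_taylor_poly) simp
    then show ?thesis using compact_imp_bounded bounded_iff by (metis imageI)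
  qed
  then obtain B where B: "\<And>m w. w \<in> cball 0 r1 \<Longrightarrow> norm (?T m w) \<le> B m" by metis
  \<comment> \<open>Terms with index at least \<open>M\<close> are differences of two partial sums
    that are within \<open>1\<close> of the limit, hence at most \<open>2\<close>; the finitely many
    others are bounded by compactness.\<close>
  define C where "C = 2 + (\<Sum>m<M. \<bar>B m\<bar>)"
  have C: "norm (?T m w) \<le> C" if w: "w \<in> cball 0 r1" for m w
  proof (cases "m < M")
    case True
    have "norm (?T m w) \<le> \<bar>B m\<bar>" using B[OF w, of m] by linarith
    also have "\<dots> \<le> (\<Sum>m<M. \<bar>B m\<bar>)" using True by (intro member_le_sum) auto
    finally show ?thesis by (simp add: C_def)
  next
    case False
    have "w \<in> ball 0 r0" using w r1 by simp
    then have "dist (\<Sum>j<Suc m. ?T j w) (?N w) < 1" "dist (\<Sum>j<m. ?T j w) (?N w) < 1"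
      using False M[of m w] M[of "Suc m" w] by (simp_all del: sum.lessThan_Suc)
    then have "dist (\<Sum>j<Suc m. ?T j w) (\<Sum>j<m. ?T j w) < 2"
      using dist_triangle2[of "\<Sum>j<Suc m. ?T j w" "\<Sum>j<m. ?T j w" "?N w"] by linarith
    then have "norm (?T m w) \<le> 2" by (simp add: dist_norm)
    also have "2 \<le> C" unfolding C_def by (simp add: sum_nonneg)
    finally show ?thesis .
  qed
  have C0: "C \<ge> 0" unfolding C_def by (simp add: sum_nonneg add_nonneg_nonneg)
  have "norm (?N w - (\<Sum>m\<le>k. ?T m w)) \<le> 2 * C * (1 / r1) ^ Suc k * norm w ^ Suc k"
    if w: "norm w \<le> r1 / 2" for w k
  proof -
    define t where "t = norm w / r1"
    have t: "0 \<le> t" "t \<le> 1/2" using w r1 by (auto simp: t_def field_simps)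
    have T: "norm (?T m w) \<le> C * t ^ m" for m
    proof (cases "w = 0")
      case True
      have "norm (?T m (0 *s w)) \<le> C * t ^ m"
        unfolding taylor_poly_scale using C0 t C[of w 0] True r1
        by (cases m) (auto simp: norm_mult)
      then show ?thesis using True by simp
    next
      case False
      \<comment> \<open>The point of norm \<open>r1\<close> on the ray of \<open>w\<close>, where
        the common bound \<open>C\<close> applies.\<close>
      define w' where "w' = of_real (r1 / norm w) *s w"
      have "w = of_real t *s w'" using False r1 by (simp add: w'_def t_def)
      then have "norm (?T m w) = t ^ m * norm (?T m w')"
        using t by (metis abs_of_nonneg norm_mult norm_of_real norm_power taylor_poly_scale)
      moreover have "norm (?T m w') \<le> C" using False r1 by (intro C) (simp add: w'_def norm_divide)
      ultimately show ?thesis using t by (simp add: mult.commute[of C] mult_left_mono)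
    qed
    have "w \<in> ball 0 r0" using w r1 by simp
    from tendsto_uniform_limitI[OF lim this] have "(\<lambda>m. ?T m w) sums ?N w"
      by (simp add: sums_def)
    from norm_geometric_tail_le[OF T t this]
    show ?thesis by (simp add: t_def power_divide mult_ac)
  qed
  moreover have "2 * C * (1 / r1) ^ Suc k \<ge> 0" for k using C0 r1 by simp
  ultimately show ?thesis using that[of "r1 / 2"] r1 by (meson half_gt_zero)
qed

lemma nonlin_quadratic:
  fixes U :: "(complex^'n::{finite,linorder} option) set"
  assumes G: "smooth G" "G 0 = 0" "(G has_derivative (\<lambda>_. 0)) (at 0)"
    and U: "taylor_valid G U" "0 \<in> U"
  obtains r C where "r > 0" "C \<ge> 0"
    "\<And>w :: complex^'n option. norm w \<le> r \<Longrightarrow> norm (nonlin G w) \<le> C * (norm w)\<^sup>2"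
proof -
  obtain r where r: "r > 0" "\<And>k. \<exists>C\<ge>0. \<forall>w :: complex^'n option. norm w \<le> r \<longrightarrow>
    norm (nonlin G w - (\<Sum>m\<le>k. taylor_poly G m w)) \<le> C * norm w ^ Suc k"
    using nonlin_Taylor_remainder[OF G(1) U] by metis
  from r(2)[of 1] obtain C where "C \<ge> 0" "\<And>w :: complex^'n option. norm w \<le> r \<Longrightarrow>
    norm (nonlin G w - (\<Sum>m\<le>1. taylor_poly G m w)) \<le> C * norm w ^ Suc 1" by blast
  with r(1) that show ?thesis
    by (simp add: taylor_poly_0[where G = G, OF G(2)] taylor_poly_1[OF G(3)] numeral_2_eq_2)
qed

lemma nonlin_0:
  fixes U :: "(complex^'n::{finite,linorder} option) set"
  assumes "smooth G" "G 0 = 0" "(G has_derivative (\<lambda>_. 0)) (at 0)" "taylor_valid G U" "0 \<in> U"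
  shows "nonlin G (0 :: complex^'n option) = 0"
proof -
  obtain r C where "r > 0" "C \<ge> 0"
    "\<And>w :: complex^'n option. norm w \<le> r \<Longrightarrow> norm (nonlin G w) \<le> C * (norm w)\<^sup>2"
    using nonlin_quadratic[OF assms] by blast
  from this(3)[of 0] this(1) show ?thesis by simp
qed

lemma nonlin_small_lipschitz:
  fixes U :: "(complex^'n::{finite,linorder} option) set"
  assumes G: "smooth G" "G 0 = 0" "(G has_derivative (\<lambda>_. 0)) (at 0)"
    and U: "taylor_valid G U" "open U" "0 \<in> U" and \<rho>: "\<rho> > 0"
  obtains r where "r > 0"
    "\<And>v w :: complex^'n option. v \<in> ball 0 r \<Longrightarrow> w \<in> ball 0 r \<Longrightarrow>
      norm (nonlin G v - nonlin G w) \<le> \<rho> * norm (v - w)"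
proof -
  obtain r C where r: "r > 0" "C \<ge> 0" and C:
    "\<And>w :: complex^'n option. norm w \<le> r \<Longrightarrow> norm (nonlin G w) \<le> C * (norm w)\<^sup>2"
    using nonlin_quadratic[OF G U(1,3)] by metis
  obtain e where e: "e > 0" "ball 0 e \<subseteq> U" using U open_contains_ball by blast
  \<comment> \<open>The quadratic bound on the ball of radius \<open>2 * s\<close> yields the
    Lipschitz constant \<open>8 * (C + 1) * s\<close>, which the last entry keeps below \<rho>.
    \<open>C + 1\<close> in place of \<open>C\<close> makes the bound strict and the denominator
    positive.\<close>
  define s where "s = min (min (r/2) (e/2)) (\<rho> / (8 * (C + 1)))"
  have s: "s > 0" "2 * s \<le> r" "2 * s \<le> e" "s \<le> \<rho> / (8 * (C + 1))"
    using r e \<rho> by (auto simp: s_def)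
  have "norm (nonlin G v - nonlin G w) \<le> \<rho> * norm (v - w)"
    if v: "v \<in> ball 0 (s/2)" and w: "w \<in> ball 0 (s/2)" for v w :: "complex^'n option"
  proof -
    have sub: "ball w s \<subseteq> ball 0 (2 * s)"
    proof
      fix z assume "z \<in> ball w s"
      then show "z \<in> ball 0 (2 * s)" using w dist_triangle[of 0 z w] s by auto
    qed
    have "norm (nonlin G z) < (C + 1) * (2 * s)\<^sup>2" if "z \<in> ball w s" for z
    proof -
      have z: "norm z < 2 * s" using sub that by auto
      then have "norm (nonlin G z) \<le> C * (norm z)\<^sup>2" using s by (intro C) linarith
      also have "\<dots> \<le> C * (2 * s)\<^sup>2" using z r by (intro mult_left_mono power_mono) auto
      also have "\<dots> < (C + 1) * (2 * s)\<^sup>2" using s by (simp add: algebra_simps)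
      finally show ?thesis .
    qed
    moreover have "v \<in> ball w s" using v w dist_triangle[of w v 0] by auto
    moreover have "ball w s \<subseteq> U" using sub e s by (meson order_trans subset_ball)
    ultimately have "norm (nonlin G v - nonlin G w)
        \<le> 2 * ((C + 1) * (2 * s)\<^sup>2) / s * norm (v - w)"
      by (intro nonlin_lipschitz_step[OF G(1) U(1)]) auto
    also have "2 * ((C + 1) * (2 * s)\<^sup>2) / s = 8 * (C + 1) * s"
      using s by (simp add: power2_eq_square)
    also have "8 * (C + 1) * s \<le> \<rho>" using s(4) r by (simp add: field_simps)
    finally show ?thesis by (simp add: mult_right_mono)
  qed
  then show ?thesis using that[of "s/2"] s by simp
qed

section \<open>The discretised linear problem\<close>

lemma lin_complex_interp:
  fixes v :: "complex^'n::{finite,linorder} option"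
  assumes "bounded_linear L"
  shows "lin_complex L (interp v) = (\<Sum>k\<in>UNIV. v $ k * of_real (L (hist (lag_node k))))"
proof -
  have L: "linear L" using assms by (rule bounded_linear.linear)
  have "lin_complex L (interp v) = (\<Sum>k\<in>UNIV.
      (of_real (Re (v $ k)) + \<i> * of_real (Im (v $ k))) * of_real (L (hist (lag_node k))))"
    unfolding lin_complex_def hist_Re_interp hist_Im_interp
    by (simp add: linear_sum[OF L] linear_cmul[OF L] sum_distrib_left sum.distrib[symmetric] algebra_simps)
  then show ?thesis by (simp add: complex_eq[symmetric])
qed

lemma lin_mat_mult:
  fixes v :: "complex^'n::{finite,linorder} option"
  assumes "bounded_linear L"
  shows "lin_mat L *v v = lin_field L v"
proof -
  have "Vector_Spaces.linear (*s) (*s) (lin_field L :: complex^'n option \<Rightarrow> _)"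
    by unfold_locales
       (auto simp: lin_field_def vec_eq_iff lin_complex_interp[OF assms] matrix_vector_mult_def
          algebra_simps sum.distrib sum_distrib_left split: option.splits)
  then show ?thesis unfolding lin_mat_def by (rule matrix_works)
qed

lemma mat_mult_vec: "mat z *v x = z *s (x :: complex^'m)"
  by (simp add: vec_eq_iff matrix_vector_mult_def mat_def if_distrib if_distribR cong: if_cong)

lemma mat_spectrum_inverse:
  fixes M :: "complex^'m^'m"
  assumes "z \<notin> mat_spectrum M"
  shows "(M - mat z) *v (matrix_inv (M - mat z) *v x) = x" "matrix_inv (M - mat z) *v ((M - mat z) *v x) = x"
proof -
  have "v = 0" if "(M - mat z) *v v = 0" for v
    using assms that by (auto simp: mat_spectrum_def matrix_vector_mult_diff_rdistrib mat_mult_vec)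
  then have "invertible (M - mat z)"
    by (simp add: invertible_left_inverse matrix_left_invertible_ker)
  then have "(M - mat z) ** matrix_inv (M - mat z) = mat 1 \<and> matrix_inv (M - mat z) ** (M - mat z) = mat 1"
    unfolding invertible_def matrix_inv_def by (rule someI_ex)
  then show "(M - mat z) *v (matrix_inv (M - mat z) *v x) = x" "matrix_inv (M - mat z) *v ((M - mat z) *v x) = x"
    by (simp_all add: matrix_vector_mul_assoc matrix_vector_mul_lid)
qed

text \<open>By construction \<open>ps_exp z\<close> satisfies the rows of the eigenvalue equation
  that belong to \<open>D\<close>; the row \<open>None\<close> is missed by exactly the discrete
  characteristic function.\<close>

lemma lin_mat_ps_exp:
  fixes z :: complex
  assumes L: "bounded_linear L" and z: "z \<notin> mat_spectrum (cdiffmat :: ((complex, 'n::{finite,linorder}) vec, 'n) vec)"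
  shows "lin_mat L *v ps_exp z
    = z *s (ps_exp z :: (complex, 'n option) vec) - axis None (ps_char_fun TYPE('n) L z)"
proof -
  let ?y = "matrix_inv (cdiffmat - mat z) *v (cdiffmat *v 1) :: (complex, 'n) vec"
  have "(cdiffmat - mat z) *v ?y = cdiffmat *v 1" by (rule mat_spectrum_inverse(1)[OF z])
  then have y: "cdiffmat *v ?y = cdiffmat *v 1 + z *s ?y"
    by (simp add: matrix_vector_mult_diff_rdistrib mat_mult_vec algebra_simps)
  have "(\<chi> k. (ps_exp z :: (complex, 'n option) vec) $ Some k) = ?y" by (simp add: vec_eq_iff ps_exp_def)
  with y show ?thesis
    unfolding lin_mat_mult[OF L]
    by (auto simp: vec_eq_iff lin_field_def ps_char_fun_def axis_def ps_exp_def split: option.splits)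
qed

text \<open>Subtracting \<open>v $ None *s ps_exp z\<close> leaves a vector with entry
  \<open>0\<close> at \<open>None\<close>, whose other entries form an eigenvector of
  \<open>D\<close> or vanish. As \<open>z\<close> is no eigenvalue of \<open>D\<close>,
  \<open>v\<close> is a multiple of \<open>ps_exp z\<close>, and the defect in the row
  \<open>None\<close> must be zero.\<close>

lemma lin_mat_eigenvector:
  fixes v :: "complex^'n::{finite,linorder} option"
  assumes L: "bounded_linear L" and z: "z \<notin> mat_spectrum (cdiffmat :: ((complex, 'n) vec, 'n) vec)"
    and v: "v \<noteq> 0" "lin_mat L *v v = z *s v"
  shows "ps_char_fun TYPE('n) L z = 0"
proof -
  define y where "y = (\<chi> k. v $ Some k)"
  define w where "w = v - v $ None *s ps_exp z"
  define c where "c = (v $ None) * ps_char_fun TYPE('n) L z"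
  have "lin_mat L *v w = z *s w + axis None c"
    unfolding w_def matrix_vector_mult_diff_distrib v(2) vector_scalar_commute lin_mat_ps_exp[OF L z]
    by (auto simp: vec_eq_iff axis_def algebra_simps c_def)
  moreover have w0: "w $ None = 0" by (simp add: w_def ps_exp_def)
  ultimately have "(cdiffmat *v (\<chi> k. w $ Some k)) $ j = z * w $ Some j" for j
    unfolding lin_mat_mult[OF L]
    by (auto simp: vec_eq_iff lin_field_def axis_def dest: spec[of _ "Some j"])
  then have "cdiffmat *v (\<chi> k. w $ Some k) = z *s (\<chi> k. w $ Some k)" by (simp add: vec_eq_iff)
  then have "(\<chi> k. w $ Some k) = 0" using z by (auto simp: mat_spectrum_def)
  then have "w $ k = 0" for k using w0 by (cases k) (auto simp: vec_eq_iff)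
  then have w: "w = 0" by (simp add: vec_eq_iff)
  then have "v $ None \<noteq> 0" using v(1) by (auto simp: w_def)
  moreover have "axis None c = (0 :: complex^'n option)"
    using \<open>lin_mat L *v w = z *s w + axis None c\<close> w by simp
  then have "c = 0" by (simp add: axis_eq_0_iff)
  ultimately show ?thesis by (simp add: c_def)
qed

section \<open>Uniform bound for the discretised exponentials\<close>

lemma finite_deg_le: "finite {\<beta> :: 'd::finite multi_index. deg \<beta> \<le> k}"
proof (rule finite_subset)
  show "{\<beta> :: 'd multi_index. deg \<beta> \<le> k} \<subseteq> UNIV \<rightarrow>\<^sub>E {..k}"
  proof
    fix \<beta> :: "'d multi_index" assume "\<beta> \<in> {\<beta>. deg \<beta> \<le> k}"
    then have "\<beta> i \<le> k" for i using member_le_sum[of i UNIV \<beta>] by (simp add: deg_def)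
    then show "\<beta> \<in> UNIV \<rightarrow>\<^sub>E {..k}" by (auto simp: PiE_def)
  qed
qed (simp add: finite_PiE)

lemma finite_deg_eq: "finite {\<beta> :: 'd::finite multi_index. deg \<beta> = k}"
  by (rule finite_subset[OF _ finite_deg_le[of k]]) auto

lemma deg_eq_0_iff: "deg \<beta> = 0 \<longleftrightarrow> \<beta> = (\<lambda>_. 0)"
  by (auto simp: deg_def)

lemma ex_pos_lower_bound:
  fixes f :: "'d::finite \<Rightarrow> real"
  assumes "\<And>i. f i > 0"
  obtains a where "a > 0" "\<And>i. a \<le> f i"
  using that[of "Min (range f)"] assms by simp

lemma Re_pairing_ge:
  assumes "\<And>i. a \<le> Re (lam $ i)"
  shows "a * real (deg \<beta>) \<le> Re (pairing lam \<beta>)"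
  unfolding pairing_def deg_def of_nat_sum Re_sum sum_distrib_left
  by (intro sum_mono) (simp add: assms mult_right_mono)

text \<open>In high degree the spectral parameter exceeds the norm of \<open>D\<close>, so the
  resolvent is controlled; only finitely many multi-indices remain.\<close>

lemma ps_exp_bounded:
  fixes lam :: "complex^'d::finite"
  assumes lam: "\<And>i. Re (lam $ i) > 0"
    and D: "\<And>\<beta>. deg \<beta> \<ge> 1 \<Longrightarrow> pairing lam \<beta> \<notin> mat_spectrum (cdiffmat :: ((complex, 'n::{finite,linorder}) vec, 'n) vec)"
  obtains C where "\<And>\<beta>. deg \<beta> \<ge> 1 \<Longrightarrow> norm (ps_exp (pairing lam \<beta>) :: complex^'n option) \<le> C"
proof -
  let ?D = "cdiffmat :: ((complex, 'n) vec, 'n) vec"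
  let ?y = "\<lambda>z. matrix_inv (?D - mat z) *v (?D *v 1)"
  obtain a where a: "a > 0" "\<And>i. a \<le> Re (lam $ i)" using ex_pos_lower_bound[of "\<lambda>i. Re (lam $ i)"] lam by blast
  obtain B where B: "B > 0" "\<And>x. norm (?D *v x) \<le> norm x * B"
    using bounded_linear.pos_bounded[OF matrix_vector_mul_bounded_linear[of ?D]] by blast
  define b where "b = norm (?D *v 1)"
  \<comment> \<open>From this degree on \<open>norm z \<ge> B + 1\<close>, and the resolvent
    equation solved for \<open>z *s ?y z\<close> then gives
    \<open>norm (?y z) \<le> b\<close>.\<close>
  define N where "N = nat \<lceil>(B + 1) / a\<rceil>"
  have large: "norm (ps_exp (pairing lam \<beta>) :: complex^'n option) \<le> 1 + real CARD('n) * b"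
    if \<beta>: "deg \<beta> \<ge> 1" "deg \<beta> \<ge> N" for \<beta>
  proof -
    define z where "z = pairing lam \<beta>"
    have "(B + 1) / a \<le> real (deg \<beta>)" using \<beta>(2) by (simp add: N_def)
    then have "B + 1 \<le> a * real (deg \<beta>)" using a(1) by (simp add: field_simps)
    also have "\<dots> \<le> Re z" unfolding z_def by (rule Re_pairing_ge[OF a(2)])
    also have "\<dots> \<le> norm z" by (rule complex_Re_le_cmod)
    finally have z: "B + 1 \<le> norm z" .
    have "(?D - mat z) *v ?y z = ?D *v 1"
      unfolding z_def by (rule mat_spectrum_inverse(1)[OF D[OF \<beta>(1)]])
    then have "z *s ?y z = ?D *v ?y z - ?D *v 1"
      by (simp add: matrix_vector_mult_diff_rdistrib mat_mult_vec algebra_simps)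
    then have "norm z * norm (?y z) = norm (?D *v ?y z - ?D *v 1)"
      by (metis norm_vector_smult)
    also have "\<dots> \<le> norm (?y z) * B + b"
      unfolding b_def by (intro norm_triangle_le_diff add_mono B order_refl)
    finally have "(norm z - B) * norm (?y z) \<le> b" by (simp add: algebra_simps)
    moreover have "1 * norm (?y z) \<le> (norm z - B) * norm (?y z)"
      using z by (intro mult_right_mono) auto
    ultimately have y: "norm (?y z) \<le> b" by linarith
    have "norm (ps_exp z :: complex^'n option) \<le> (\<Sum>k\<in>UNIV. norm ((ps_exp z :: complex^'n option) $ k))"
      unfolding norm_vec_def by (rule L2_set_le_sum) simp
    also have "\<dots> = 1 + (\<Sum>j\<in>UNIV. norm (?y z $ j))" by (simp add: sum_option_UNIV ps_exp_def)
    also have "\<dots> \<le> 1 + (\<Sum>j\<in>(UNIV :: 'n set). b)"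
      using y norm_component_le[of "?y z"] order_trans
      by (intro add_left_mono sum_mono) blast
    finally show ?thesis by (simp add: z_def)
  qed
  define M where "M = Max (insert 0 ((\<lambda>\<beta>. norm (ps_exp (pairing lam \<beta>) :: complex^'n option)) ` {\<beta>. deg \<beta> \<le> N}))"
  have "norm (ps_exp (pairing lam \<beta>) :: complex^'n option) \<le> max M (1 + real CARD('n) * b)"
    if "deg \<beta> \<ge> 1" for \<beta>
  proof (cases "deg \<beta> \<le> N")
    case True
    then have "norm (ps_exp (pairing lam \<beta>) :: complex^'n option) \<le> M"
      unfolding M_def by (intro Max_ge) (auto simp: finite_deg_le)
    then show ?thesis by simp
  next
    case False
    then show ?thesis using large[OF that] by simp
  qed
  then show ?thesis using that by blast
qed

section \<open>Power series in several variables\<close>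

lemma norm_monomial_le: "norm (monomial \<sigma> \<beta>) \<le> norm \<sigma> ^ deg \<beta>"
  unfolding monomial_def deg_def power_sum prod_norm[symmetric] norm_power
  by (intro prod_mono) (auto intro: power_mono norm_component_le)

lemma monomial_scale: "monomial (c *s \<sigma>) \<beta> = c ^ deg \<beta> * monomial \<sigma> \<beta>"
  by (simp add: monomial_def deg_def power_sum power_mult_distrib prod.distrib)

text \<open>The exponent \<open>\<beta> i - 1\<close> is truncated at \<open>\<beta> i = 0\<close>,
  where the factor \<open>of_nat (\<beta> i)\<close> vanishes.\<close>

definition mon_grad :: "complex^'d \<Rightarrow> 'd::finite multi_index \<Rightarrow> complex^'d" where
  "mon_grad \<sigma> \<beta> = (\<chi> i. of_nat (\<beta> i) * (\<sigma> $ i) ^ (\<beta> i - 1) * (\<Prod>j\<in>UNIV - {i}. (\<sigma> $ j) ^ \<beta> j))"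

lemma has_derivative_monomial:
  "((\<lambda>\<sigma>. monomial \<sigma> \<beta>) has_derivative (\<lambda>h. \<Sum>i\<in>UNIV. mon_grad \<sigma> \<beta> $ i * h $ i)) (at \<sigma> within S)"
proof -
  have "((\<lambda>\<sigma>. \<sigma> $ i ^ \<beta> i) has_derivative (\<lambda>h. h $ i * (of_nat (\<beta> i) * \<sigma> $ i ^ (\<beta> i - 1)))) (at \<sigma> within S)" for i
    by (rule has_derivative_eq_rhs[OF has_derivative_power[OF bounded_linear_imp_has_derivative[OF bounded_linear_vec_nth]]])
       (auto simp: mult_ac)
  then have "((\<lambda>\<sigma>. \<Prod>i\<in>UNIV. \<sigma> $ i ^ \<beta> i) has_derivative
     (\<lambda>h. \<Sum>i\<in>UNIV. (h $ i * (of_nat (\<beta> i) * \<sigma> $ i ^ (\<beta> i - 1))) * (\<Prod>j\<in>UNIV - {i}. \<sigma> $ j ^ \<beta> j))) (at \<sigma> within S)"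
    by (intro has_derivative_prod) auto
  then show ?thesis by (simp add: monomial_def[abs_def] mon_grad_def mult_ac)
qed

lemma norm_mon_grad_le: "norm (mon_grad \<sigma> \<beta> $ i) \<le> real (deg \<beta>) * norm \<sigma> ^ (deg \<beta> - 1)"
proof (cases "\<beta> i = 0")
  case False
  have deg: "deg \<beta> = \<beta> i + (\<Sum>j\<in>UNIV - {i}. \<beta> j)"
    unfolding deg_def by (subst sum.remove[of _ i]) auto
  have "norm (mon_grad \<sigma> \<beta> $ i)
      = real (\<beta> i) * (norm (\<sigma> $ i) ^ (\<beta> i - 1) * (\<Prod>j\<in>UNIV - {i}. norm (\<sigma> $ j) ^ \<beta> j))"
    by (simp add: mon_grad_def norm_mult norm_power prod_norm[symmetric])
  also have "\<dots> \<le> real (deg \<beta>) * (norm \<sigma> ^ (\<beta> i - 1) * (\<Prod>j\<in>UNIV - {i}. norm \<sigma> ^ \<beta> j))"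
    using deg
    by (intro mult_mono prod_mono power_mono norm_component_le)
       (auto intro!: prod_nonneg power_mono norm_component_le mult_nonneg_nonneg
          add_nonneg_nonneg sum_nonneg)
  also have "norm \<sigma> ^ (\<beta> i - 1) * (\<Prod>j\<in>UNIV - {i}. norm \<sigma> ^ \<beta> j) = norm \<sigma> ^ (deg \<beta> - 1)"
    using False by (simp add: deg power_sum[symmetric] power_add[symmetric])
  finally show ?thesis .
qed (simp add: mon_grad_def)

lemma continuous_on_mon_grad: "continuous_on S (\<lambda>\<sigma>. mon_grad \<sigma> \<beta> $ i)"
  unfolding mon_grad_def by (auto intro!: continuous_intros)

text \<open>Multiplying the partial derivative in direction \<open>i\<close> by
  \<open>\<sigma> $ i\<close> restores the monomial with the factor \<open>\<beta> i\<close>;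
  monomials are thus eigenfunctions of the linear field, which is where
  \<open>pairing lam \<beta>\<close> comes from.\<close>

lemma mon_grad_Euler: "(\<Sum>i\<in>UNIV. mon_grad \<sigma> \<beta> $ i * (lam $ i * \<sigma> $ i)) = pairing lam \<beta> * monomial \<sigma> \<beta>"
proof -
  have eq: "mon_grad \<sigma> \<beta> $ i * (lam $ i * \<sigma> $ i) = lam $ i * of_nat (\<beta> i) * monomial \<sigma> \<beta>" for i
  proof (cases "\<beta> i")
    case (Suc k)
    have "monomial \<sigma> \<beta> = \<sigma> $ i ^ \<beta> i * (\<Prod>j\<in>UNIV - {i}. (\<sigma> $ j) ^ \<beta> j)"
      unfolding monomial_def by (subst prod.remove[of _ i]) auto
    then show ?thesis using Suc by (simp add: mon_grad_def)
  qed (simp add: mon_grad_def)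
  show ?thesis by (simp only: eq pairing_def sum_distrib_right)
qed

section \<open>Multi-index series summed by degree\<close>

definition hom_part :: "('d::finite multi_index \<Rightarrow> complex^'m::finite) \<Rightarrow> nat \<Rightarrow> complex^'d \<Rightarrow> complex^'m" where
  "hom_part c k \<sigma> = (\<Sum>\<beta> | deg \<beta> = k. monomial \<sigma> \<beta> *s c \<beta>)"

definition hom_jac :: "('d::finite multi_index \<Rightarrow> complex^'m::finite) \<Rightarrow> nat \<Rightarrow> complex^'d \<Rightarrow> complex^'d^'m" where
  "hom_jac c k \<sigma> = (\<chi> r i. \<Sum>\<beta> | deg \<beta> = k. c \<beta> $ r * mon_grad \<sigma> \<beta> $ i)"

definition hom_norm :: "('d::finite multi_index \<Rightarrow> complex^'m::finite) \<Rightarrow> nat \<Rightarrow> real" where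
  "hom_norm c k = (\<Sum>\<beta> | deg \<beta> = k. norm (c \<beta>))"

lemma hom_norm_nonneg: "hom_norm c k \<ge> 0"
  by (simp add: hom_norm_def sum_nonneg)

lemma has_sum_by_degree:
  fixes f :: "'d::finite multi_index \<Rightarrow> 'a::banach"
  assumes "(f has_sum s) UNIV"
  shows "(\<lambda>k. \<Sum>\<beta> | deg \<beta> = k. f \<beta>) sums s"
proof -
  let ?S = "Sigma UNIV (\<lambda>k. {\<beta> :: 'd multi_index. deg \<beta> = k})"
  have "snd ` ?S = UNIV" "inj_on snd ?S" by (auto simp: inj_on_def image_iff)
  then have "((\<lambda>(k, \<beta>). f \<beta>) has_sum s) ?S"
    using has_sum_reindex[of snd ?S f s] assms by (simp add: o_def case_prod_beta')
  then have "((\<lambda>k. \<Sum>\<beta> | deg \<beta> = k. f \<beta>) has_sum s) UNIV"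
    by (rule has_sum_Sigma[rotated]) (auto intro!: has_sum_finite finite_deg_eq isUCont_plus)
  then show ?thesis by (rule has_sum_imp_sums)
qed

lemma summable_hom_norm:
  assumes "(\<lambda>\<beta>. norm (c \<beta>)) summable_on UNIV"
  shows "summable (hom_norm c)"
  using has_sum_by_degree[OF has_sum_infsum[OF assms]] sums_summable
  unfolding hom_norm_def by blast

lemma hom_part_scale: "hom_part c k (z *s \<sigma>) = z ^ k *s hom_part c k \<sigma>"
  unfolding hom_part_def monomial_scale vec.scale_sum_right
  by (intro sum.cong) (auto simp: vec.scale_scale)

lemma norm_hom_part_le:
  fixes c :: "'d::finite multi_index \<Rightarrow> complex^'m::finite"
  shows "norm (hom_part c k \<sigma>) \<le> hom_norm c k * norm \<sigma> ^ k"
  unfolding hom_part_def hom_norm_def sum_distrib_right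
proof (intro sum_norm_le)
  fix \<beta> :: "'d multi_index" assume "\<beta> \<in> {\<beta>. deg \<beta> = k}"
  then have "norm (monomial \<sigma> \<beta>) \<le> norm \<sigma> ^ k" using norm_monomial_le by blast
  then show "norm (monomial \<sigma> \<beta> *s c \<beta>) \<le> norm (c \<beta>) * norm \<sigma> ^ k"
    by (simp add: mult.commute mult_left_mono)
qed

lemma sums_hom_part:
  assumes c: "(\<lambda>\<beta>. norm (c \<beta>)) summable_on UNIV" and \<sigma>: "norm \<sigma> \<le> 1"
  shows "(\<lambda>k. hom_part c k \<sigma>) sums (\<Sum>\<^sub>\<infinity>\<beta>. monomial \<sigma> \<beta> *s c \<beta>)"
proof -
  have "norm (monomial \<sigma> \<beta> *s c \<beta>) \<le> norm (c \<beta>)" for \<beta>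
  proof -
    have "norm (monomial \<sigma> \<beta>) \<le> 1" using norm_monomial_le[of \<sigma> \<beta>] power_le_one[OF norm_ge_zero \<sigma>] order_trans by blast
    then show ?thesis using mult_right_mono[of "norm (monomial \<sigma> \<beta>)" 1 "norm (c \<beta>)"] by simp
  qed
  then have "(\<lambda>\<beta>. norm (monomial \<sigma> \<beta> *s c \<beta>)) summable_on UNIV"
    by (rule summable_on_comparison_test[OF c]) (rule norm_ge_zero)
  then have "(\<lambda>\<beta>. monomial \<sigma> \<beta> *s c \<beta>) summable_on UNIV" by (rule abs_summable_summable)
  from has_sum_by_degree[OF has_sum_infsum[OF this]] show ?thesis by (simp add: hom_part_def)
qed

lemma has_derivative_hom_part:
  "(hom_part c k has_derivative (\<lambda>h. hom_jac c k \<sigma> *v h)) (at \<sigma> within S)"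
proof -
  have "((\<lambda>\<sigma>. hom_part c k \<sigma> $ r) has_derivative (\<lambda>h. (hom_jac c k \<sigma> *v h) $ r)) (at \<sigma> within S)" for r
  proof -
    have "((\<lambda>\<sigma>. \<Sum>\<beta> | deg \<beta> = k. monomial \<sigma> \<beta> * c \<beta> $ r) has_derivative
        (\<lambda>h. \<Sum>\<beta> | deg \<beta> = k. (\<Sum>i\<in>UNIV. mon_grad \<sigma> \<beta> $ i * h $ i) * c \<beta> $ r)) (at \<sigma> within S)"
      by (intro has_derivative_sum has_derivative_mult_left has_derivative_monomial)
    also have "(\<lambda>h. \<Sum>\<beta> | deg \<beta> = k. (\<Sum>i\<in>UNIV. mon_grad \<sigma> \<beta> $ i * h $ i) * c \<beta> $ r)
        = (\<lambda>h. (hom_jac c k \<sigma> *v h) $ r)"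
      unfolding hom_jac_def matrix_vector_mult_def
      by (rule ext, simp add: sum_distrib_right, subst sum.swap, simp add: mult_ac)
    finally show ?thesis by (simp add: hom_part_def)
  qed
  then show ?thesis
    by (subst has_derivative_componentwise_within)
       (auto simp: Basis_vec_def inner_axis intro!: has_derivative_inner_left)
qed

abbreviation diag_mult :: "complex^'d \<Rightarrow> complex^'d \<Rightarrow> complex^'d" where
  "diag_mult lam \<sigma> \<equiv> (\<chi> i. lam $ i * \<sigma> $ i)"

lemma hom_jac_Euler:
  "hom_jac c k \<sigma> *v diag_mult lam \<sigma> = hom_part (\<lambda>\<beta>. pairing lam \<beta> *s c \<beta>) k \<sigma>"
proof -
  have "(hom_jac c k \<sigma> *v diag_mult lam \<sigma>) $ r
      = (\<Sum>\<beta> | deg \<beta> = k. c \<beta> $ r * (\<Sum>i\<in>UNIV. mon_grad \<sigma> \<beta> $ i * (lam $ i * \<sigma> $ i)))" for r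
    unfolding hom_jac_def matrix_vector_mult_def
    by (simp add: sum_distrib_left sum_distrib_right, subst sum.swap, simp add: mult_ac)
  then show ?thesis
    unfolding mon_grad_Euler by (simp add: vec_eq_iff hom_part_def mult_ac)
qed

lemma norm_vec_le_sum: "norm (x :: 'a::real_normed_vector^'m) \<le> (\<Sum>i\<in>UNIV. norm (x $ i))"
  unfolding norm_vec_def by (rule L2_set_le_sum) simp

lemma norm_hom_jac_le:
  fixes c :: "'d::finite multi_index \<Rightarrow> complex^'m::finite"
  shows "norm (hom_jac c k \<sigma>) \<le> real CARD('m) * real CARD('d) * (hom_norm c k * (real k * norm \<sigma> ^ (k - 1)))"
proof -
  have "norm (hom_jac c k \<sigma> $ r $ i) \<le> hom_norm c k * (real k * norm \<sigma> ^ (k - 1))" for r i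
    unfolding hom_jac_def hom_norm_def sum_distrib_right vec_lambda_beta
  proof (intro sum_norm_le)
    fix \<beta> :: "'d multi_index" assume "\<beta> \<in> {\<beta>. deg \<beta> = k}"
    then have "norm (mon_grad \<sigma> \<beta> $ i) \<le> real k * norm \<sigma> ^ (k - 1)" using norm_mon_grad_le by blast
    then show "norm (c \<beta> $ r * mon_grad \<sigma> \<beta> $ i) \<le> norm (c \<beta>) * (real k * norm \<sigma> ^ (k - 1))"
      unfolding norm_mult by (intro mult_mono norm_component_le) auto
  qed
  then have "(\<Sum>r\<in>UNIV. \<Sum>i\<in>UNIV. norm (hom_jac c k \<sigma> $ r $ i))
      \<le> (\<Sum>r\<in>(UNIV :: 'm set). \<Sum>i\<in>(UNIV :: 'd set). hom_norm c k * (real k * norm \<sigma> ^ (k - 1)))"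
    by (intro sum_mono)
  moreover have "norm (hom_jac c k \<sigma>) \<le> (\<Sum>r\<in>UNIV. \<Sum>i\<in>UNIV. norm (hom_jac c k \<sigma> $ r $ i))"
    by (rule order_trans[OF norm_vec_le_sum]) (intro sum_mono norm_vec_le_sum)
  ultimately show ?thesis by simp
qed

lemma norm_matrix_vector_le:
  fixes A :: "complex^'d^'m"
  shows "norm (A *v h) \<le> real CARD('m) * real CARD('d) * norm A * norm h"
proof -
  have "norm (A $ r $ i * h $ i) \<le> norm A * norm h" for r i
    unfolding norm_mult
    using norm_component_le[of "A $ r" i] norm_component_le[of A r]
    by (intro mult_mono norm_component_le) auto
  then have "norm ((A *v h) $ r) \<le> (\<Sum>i\<in>(UNIV :: 'd set). norm A * norm h)" for r
    unfolding matrix_vector_mult_def vec_lambda_beta by (intro sum_norm_le) auto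
  then have "norm (A *v h) \<le> (\<Sum>r\<in>(UNIV :: 'm set). \<Sum>i\<in>(UNIV :: 'd set). norm A * norm h)"
    by (intro order_trans[OF norm_vec_le_sum] sum_mono) auto
  then show ?thesis by (simp add: mult_ac)
qed

lemma nat_times_power_bounded:
  assumes "0 \<le> (\<rho>::real)" "\<rho> < 1"
  obtains B where "B \<ge> 0" "\<And>k. real k * \<rho> ^ (k - 1) \<le> B"
proof -
  have "real k * \<rho> ^ (k - 1) \<le> 1 / (1 - \<rho>)" for k
  proof (cases k)
    case (Suc n)
    have "real (Suc n) * \<rho> ^ n = (\<Sum>j<Suc n. \<rho> ^ n)" by simp
    also have "\<dots> \<le> (\<Sum>j<Suc n. \<rho> ^ j)" using assms by (intro sum_mono power_decreasing) auto
    also have "\<dots> = (1 - \<rho> ^ Suc n) / (1 - \<rho>)" using assms by (simp add: sum_gp_strict del: sum.lessThan_Suc power_Suc)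
    also have "\<dots> \<le> 1 / (1 - \<rho>)" using assms by (intro divide_right_mono) auto
    finally show ?thesis using Suc by simp
  qed (use assms in simp)
  with assms show ?thesis by (intro that[of "1 / (1 - \<rho>)"]) auto
qed

text \<open>On a ball of radius \<rho> < 1 the numbers \<open>k * \<rho> ^ (k - 1)\<close> are
  bounded, so summability of \<open>hom_norm c\<close> already dominates the Jacobians and permits
  differentiation term by term.\<close>

lemma hom_series_derivative:
  fixes c :: "'d::finite multi_index \<Rightarrow> complex^'m::finite"
  assumes c: "(\<lambda>\<beta>. norm (c \<beta>)) summable_on UNIV"
  defines "P \<equiv> \<lambda>\<sigma>. \<Sum>\<^sub>\<infinity>\<beta>. monomial \<sigma> \<beta> *s c \<beta>"
    and "J \<equiv> \<lambda>\<sigma>. \<Sum>k. hom_jac c k \<sigma>"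
  assumes \<sigma>: "\<sigma> \<in> ball 0 1"
  shows "(P has_derivative (\<lambda>h. J \<sigma> *v h)) (at \<sigma>)"
    and "isCont J \<sigma>"
    and "(\<lambda>k. hom_jac c k \<sigma>) sums J \<sigma>"
proof -
  define \<rho> where "\<rho> = (1 + norm \<sigma>) / 2"
  have \<rho>: "0 < \<rho>" "\<rho> < 1" "norm \<sigma> < \<rho>" using \<sigma> by (auto simp: \<rho>_def add_pos_nonneg)
  obtain B where B: "B \<ge> 0" "\<And>k. real k * \<rho> ^ (k - 1) \<le> B" using nat_times_power_bounded[of \<rho>] \<rho> by auto
  define K where "K = real CARD('m) * real CARD('d)"
  have bound: "norm (hom_jac c k x) \<le> K * B * hom_norm c k" if "x \<in> ball 0 \<rho>" for k x
  proof -
    have "real k * norm x ^ (k - 1) \<le> real k * \<rho> ^ (k - 1)"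
      using that by (intro mult_left_mono power_mono) auto
    also have "\<dots> \<le> B" by (rule B)
    finally have le: "real k * norm x ^ (k - 1) \<le> B" .
    have "norm (hom_jac c k x) \<le> K * (hom_norm c k * (real k * norm x ^ (k - 1)))"
      unfolding K_def by (rule norm_hom_jac_le)
    also have "\<dots> \<le> K * (hom_norm c k * B)"
      using le by (intro mult_left_mono hom_norm_nonneg) (auto simp: K_def)
    finally show ?thesis by (simp add: mult_ac)
  qed
  have sm: "summable (\<lambda>k. K * B * hom_norm c k)" by (intro summable_mult summable_hom_norm c)
  have ul: "uniform_limit (ball 0 \<rho>) (\<lambda>n x. \<Sum>k<n. hom_jac c k x) J sequentially"
    unfolding J_def by (rule Weierstrass_m_test[OF bound sm])
  have "continuous_on (ball 0 \<rho>) (hom_jac c k)" for k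
    unfolding hom_jac_def by (intro continuous_on_vec_lambda continuous_on_sum continuous_intros continuous_on_mon_grad)
  then have "continuous_on (ball 0 \<rho>) J"
    by (intro uniform_limit_theorem[OF _ ul] always_eventually allI continuous_on_sum) auto
  then show "isCont J \<sigma>" using \<rho> by (simp add: continuous_on_eq_continuous_at)
  show "(\<lambda>k. hom_jac c k \<sigma>) sums J \<sigma>"
    using tendsto_uniform_limitI[OF ul, of \<sigma>] \<rho> by (simp add: sums_def)
  have "\<exists>g. \<forall>x\<in>ball 0 \<rho>. (\<lambda>n. hom_part c n x) sums (g x) \<and>
      (g has_derivative (\<lambda>h. J x *v h)) (at x within ball 0 \<rho>)"
  proof (rule has_derivative_series)
    show "(hom_part c n has_derivative (\<lambda>h. hom_jac c n x *v h)) (at x within ball 0 \<rho>)" for n x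
      by (rule has_derivative_hom_part)
    show "(0 :: complex^'d) \<in> ball 0 \<rho>" using \<rho> by simp
    show "(\<lambda>n. hom_part c n 0) sums P 0" unfolding P_def by (rule sums_hom_part[OF c]) simp
    fix e :: real assume e: "e > 0"
    have "K > 0" by (simp add: K_def)
    from uniform_limitD[OF ul, of "e / K"] e this
    have "\<forall>\<^sub>F n in sequentially. \<forall>x\<in>ball 0 \<rho>. norm ((\<Sum>k<n. hom_jac c k x) - J x) < e / K"
      by (simp add: dist_norm)
    then show "\<forall>\<^sub>F n in sequentially. \<forall>x\<in>ball 0 \<rho>. \<forall>h.
        norm ((\<Sum>i<n. hom_jac c i x *v h) - J x *v h) \<le> e * norm h"
    proof eventually_elim
      case (elim n)
      show ?case
      proof (intro ballI allI)
        fix x h assume x: "x \<in> ball (0 :: complex^'d) \<rho>"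
        have "(\<Sum>i<n. hom_jac c i x *v h) = (\<Sum>i<n. hom_jac c i x) *v h"
          by (induction n) (auto simp: matrix_vector_mult_add_rdistrib)
        then have "norm ((\<Sum>i<n. hom_jac c i x *v h) - J x *v h)
            = norm (((\<Sum>i<n. hom_jac c i x) - J x) *v h)"
          by (simp add: matrix_vector_mult_diff_rdistrib)
        also have "\<dots> \<le> K * norm ((\<Sum>i<n. hom_jac c i x) - J x) * norm h"
          unfolding K_def by (rule norm_matrix_vector_le)
        also have "\<dots> \<le> K * (e / K) * norm h"
          using elim x \<open>K > 0\<close> by (intro mult_right_mono mult_left_mono) (auto intro: less_imp_le)
        finally show "norm ((\<Sum>i<n. hom_jac c i x *v h) - J x *v h) \<le> e * norm h"
          using \<open>K > 0\<close> by simp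
      qed
    qed
  qed auto
  then obtain g where g: "\<And>x. x \<in> ball 0 \<rho> \<Longrightarrow> (\<lambda>n. hom_part c n x) sums (g x)"
    "\<And>x. x \<in> ball 0 \<rho> \<Longrightarrow> (g has_derivative (\<lambda>h. J x *v h)) (at x within ball 0 \<rho>)" by blast
  have "g x = P x" if "x \<in> ball 0 \<rho>" for x
    using g(1)[OF that] sums_hom_part[OF c, of x] that \<rho> sums_unique2 by (fastforce simp: P_def)
  then show "(P has_derivative (\<lambda>h. J \<sigma> *v h)) (at \<sigma>)"
    using g(2)[of \<sigma>] \<rho> has_derivative_transform_within_open[of g _ \<sigma> UNIV "ball 0 \<rho>" P]
    by (simp add: at_within_open[of \<sigma> "ball 0 \<rho>"])
qed

text \<open>Absolute summability makes the M-test uniform up to the boundary. Continuity there makes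
  the image of the sphere compact, hence removable from the phase space.\<close>

lemma continuous_on_hom_series:
  fixes c :: "'d::finite multi_index \<Rightarrow> complex^'m::finite"
  assumes c: "(\<lambda>\<beta>. norm (c \<beta>)) summable_on UNIV"
  shows "continuous_on (cball 0 1) (\<lambda>\<sigma>. \<Sum>\<^sub>\<infinity>\<beta>. monomial \<sigma> \<beta> *s c \<beta>)"
proof -
  have "norm (hom_part c k x) \<le> hom_norm c k" if "x \<in> cball 0 1" for k x
    using norm_hom_part_le[of c k x] mult_left_mono[OF power_le_one[of "norm x" k] hom_norm_nonneg[of c k]] that
    by auto
  from Weierstrass_m_test[OF this summable_hom_norm[OF c]]
  have "continuous_on (cball 0 1) (\<lambda>x. \<Sum>k. hom_part c k x)"
    by (rule uniform_limit_theorem[rotated])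
       (auto intro!: always_eventually continuous_on_sum
          has_derivative_continuous_on[OF has_derivative_hom_part])
  then show ?thesis
    by (rule continuous_on_eq) (use sums_hom_part[OF c] in \<open>auto simp: sums_iff\<close>)
qed

lemma norm_hom_series_le:
  fixes c :: "'d::finite multi_index \<Rightarrow> complex^'m::finite"
  assumes c: "(\<lambda>\<beta>. norm (c \<beta>)) summable_on UNIV" and c0: "c (\<lambda>_. 0) = 0"
  obtains C where "C \<ge> 0" "\<And>\<sigma>. norm \<sigma> \<le> 1 \<Longrightarrow> norm (\<Sum>\<^sub>\<infinity>\<beta>. monomial \<sigma> \<beta> *s c \<beta>) \<le> C * norm \<sigma>"
proof -
  have sm: "summable (hom_norm c)" by (rule summable_hom_norm[OF c])
  have "norm (\<Sum>\<^sub>\<infinity>\<beta>. monomial \<sigma> \<beta> *s c \<beta>) \<le> (\<Sum>k. hom_norm c k) * norm \<sigma>" if \<sigma>: "norm \<sigma> \<le> 1" for \<sigma>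
  proof -
    have "norm (hom_part c k \<sigma>) \<le> hom_norm c k * norm \<sigma>" for k
    proof (cases k)
      case 0
      then show ?thesis by (simp add: hom_part_def hom_norm_def deg_eq_0_iff c0)
    next
      case (Suc n)
      have "norm \<sigma> ^ Suc n \<le> norm \<sigma> * 1" using \<sigma> by (simp add: mult_left_le power_le_one)
      then show ?thesis
        using norm_hom_part_le[of c k \<sigma>] mult_left_mono[OF _ hom_norm_nonneg[of c k]] Suc order_trans by fastforce
    qed
    then have "norm (\<Sum>k. hom_part c k \<sigma>) \<le> (\<Sum>k. hom_norm c k * norm \<sigma>)"
      by (intro norm_suminf_le summable_mult2 sm)
    then show ?thesis using sums_hom_part[OF c \<sigma>] suminf_mult2[OF sm, of "norm \<sigma>"] by (simp add: sums_iff)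
  qed
  then show ?thesis using that[of "\<Sum>k. hom_norm c k"] suminf_nonneg[OF sm hom_norm_nonneg] by blast
qed

section \<open>Lyapunov forms and the unstable subspace\<close>

text \<open>Bilinear rather than Hermitian: vectors serve as linear functionals and
  \<open>transpose M\<close> as the dual map, without conjugation.\<close>

definition cdot :: "complex^'m \<Rightarrow> complex^'m \<Rightarrow> complex" where
  "cdot f x = (\<Sum>i\<in>UNIV. f $ i * x $ i)"

lemma cdot_simps:
  "cdot 0 x = 0" "cdot (f + g) x = cdot f x + cdot g x" "cdot (c *s f) x = c * cdot f x"
  "cdot f 0 = 0" "cdot f (x + y) = cdot f x + cdot f y" "cdot f (c *s x) = c * cdot f x"
  "cdot f (r *\<^sub>R x) = r *\<^sub>R cdot f x"
  by (simp_all add: cdot_def algebra_simps sum.distrib sum_distrib_left scaleR_sum_right)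

lemma cdot_axis: "cdot (axis i 1) x = x $ i"
  by (simp add: cdot_def axis_def if_distrib if_distribR cong: if_cong)

lemma cdot_transpose: "cdot (transpose M *v f) x = cdot f (M *v x)"
  unfolding cdot_def matrix_vector_mult_def transpose_def vec_lambda_beta sum_distrib_left sum_distrib_right
  by (subst sum.swap) (simp add: mult_ac)

text \<open>This is \<open>p(M) x\<close>.\<close>

definition poly_apply :: "complex^'m^'m \<Rightarrow> complex^'m \<Rightarrow> complex poly \<Rightarrow> complex^'m" where
  "poly_apply M x p = (\<Sum>i\<le>degree p. coeff p i *s ((*v) M ^^ i) x)"

lemma poly_apply_eq:
  assumes "degree p \<le> N"
  shows "poly_apply M x p = (\<Sum>i\<le>N. coeff p i *s ((*v) M ^^ i) x)"
  unfolding poly_apply_def using assms by (intro sum.mono_neutral_left) (auto simp: coeff_eq_0)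

lemma matrix_vector_mult_sum: "(A :: complex^'k^'m) *v (\<Sum>i\<in>I. f i) = (\<Sum>i\<in>I. A *v f i)"
  by (induction I rule: infinite_finite_induct) (auto simp: matrix_vector_right_distrib)

lemma poly_apply_linear_factor:
  "poly_apply M x ([:- a, 1:] * q) = M *v poly_apply M x q - a *s poly_apply M x q"
proof -
  let ?N = "Suc (degree q)"
  have "degree ([:- a, 1:] * q) \<le> ?N" using degree_mult_le[of "[:- a, 1:]" q] by simp
  then have "poly_apply M x ([:- a, 1:] * q)
      = (\<Sum>i\<le>?N. (coeff (pCons 0 q) i - a * coeff q i) *s ((*v) M ^^ i) x)"
    by (simp add: poly_apply_eq del: sum.atMost_Suc)
  also have "\<dots> = (\<Sum>i\<le>?N. coeff (pCons 0 q) i *s ((*v) M ^^ i) x)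
      - a *s (\<Sum>i\<le>?N. coeff q i *s ((*v) M ^^ i) x)"
    by (simp only: vec.scale_sum_right sum_subtractf[symmetric] vec.scale_left_diff_distrib vec.scale_scale)
  also have "(\<Sum>i\<le>?N. coeff q i *s ((*v) M ^^ i) x) = poly_apply M x q"
    by (rule poly_apply_eq[symmetric]) simp
  also have "(\<Sum>i\<le>?N. coeff (pCons 0 q) i *s ((*v) M ^^ i) x)
      = (\<Sum>i\<le>degree q. coeff q i *s (M *v ((*v) M ^^ i) x))"
    by (subst sum.atMost_Suc_shift) simp
  also have "\<dots> = M *v poly_apply M x q"
    by (simp add: poly_apply_def matrix_vector_mult_sum vector_scalar_commute)
  finally show ?thesis .
qed

text \<open>The iterates of \<open>x\<close> with exponents up to \<open>CARD('m)\<close> either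
  repeat or are one too many to be independent.\<close>

lemma poly_apply_annihilator:
  fixes M :: "complex^'m^'m"
  obtains p where "p \<noteq> 0" "poly_apply M x p = 0"
proof (cases "inj_on (\<lambda>i. ((*v) M ^^ i) x) {..CARD('m)}")
  case False
  then obtain i j where ij: "i < j" "((*v) M ^^ i) x = ((*v) M ^^ j) x"
    unfolding inj_on_def by (metis linorder_neqE_nat)
  define p :: "complex poly" where "p = monom 1 j - monom 1 i"
  have "coeff p j = 1" using ij by (simp add: p_def)
  then have "p \<noteq> 0" by auto
  moreover have "degree p \<le> j" unfolding p_def
    using ij by (intro degree_diff_le) (auto simp: degree_monom_eq)
  then have "poly_apply M x p = (\<Sum>k\<le>j. (if k = j then ((*v) M ^^ j) x else 0) - (if k = i then ((*v) M ^^ i) x else 0))"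
    unfolding poly_apply_eq[OF \<open>degree p \<le> j\<close>] using ij(1) by (intro sum.cong) (auto simp: p_def)
  then have "poly_apply M x p = 0"
    using ij by (simp add: sum_subtractf)
  ultimately show ?thesis using that by blast
next
  case inj: True
  let ?f = "\<lambda>i. ((*v) M ^^ i) x" and ?I = "{..CARD('m)}"
  have "vec.dim (?f ` ?I) \<le> CARD('m)" using vec.dim_subset[of "?f ` ?I" UNIV] by (simp add: vec_dim_card del: vec.dim_UNIV)
  then have "vec.dependent (?f ` ?I)"
    using inj vec.independent_card_le_dim[of "?f ` ?I" "?f ` ?I"] card_image[OF inj] by fastforce
  then obtain u v where uv: "v \<in> ?f ` ?I" "u v \<noteq> 0" "(\<Sum>w\<in>?f ` ?I. u w *s w) = 0"
    by (subst (asm) vec.dependent_finite) auto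
  define p where "p = Abs_poly (\<lambda>i. if i \<le> CARD('m) then u (?f i) else 0)"
  have c: "coeff p i = (if i \<le> CARD('m) then u (?f i) else 0)" for i
    unfolding p_def by (rule coeff_Abs_poly[of "CARD('m)", THEN fun_cong]) auto
  have "p \<noteq> 0" using uv(1,2) c by (auto simp: poly_eq_iff)
  have "poly_apply M x p = (\<Sum>i\<le>CARD('m). coeff p i *s ?f i)"
    by (rule poly_apply_eq) (auto intro!: degree_le simp: c)
  also have "\<dots> = (\<Sum>i\<le>CARD('m). u (?f i) *s ?f i)" by (intro sum.cong) (auto simp: c)
  also have "\<dots> = 0" using uv(3) by (simp add: sum.reindex[OF inj])
  finally show ?thesis using \<open>p \<noteq> 0\<close> that by blast
qed

text \<open>Among the nonzero polynomials \<open>p\<close> with \<open>p(M) x\<close> in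
  \<open>F\<close>, one of least degree has a root \<open>a\<close>. Dividing out the linear factor
  leaves, by minimality, a vector outside \<open>F\<close>, which \<open>M - mat a\<close> sends
  into \<open>F\<close>.\<close>

lemma eigenvector_mod_subspace:
  fixes M :: "complex^'m^'m"
  assumes F: "vec.subspace F" "F \<noteq> UNIV"
  obtains f a where "f \<notin> F" "M *v f - a *s f \<in> F"
proof -
  obtain x where x: "x \<notin> F" using F by blast
  obtain p0 where p0: "p0 \<noteq> 0" "poly_apply M x p0 \<in> F"
    using poly_apply_annihilator[of M x] vec.subspace_0[OF F(1)] by metis
  define p where "p = arg_min degree (\<lambda>p. p \<noteq> 0 \<and> poly_apply M x p \<in> F)"
  have "p \<noteq> 0 \<and> poly_apply M x p \<in> F" unfolding p_def by (rule arg_min_natI) (use p0 in blast)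
  then have p: "p \<noteq> 0" "poly_apply M x p \<in> F" by auto
  have min: "degree p \<le> degree q" if "q \<noteq> 0" "poly_apply M x q \<in> F" for q
    unfolding p_def by (rule arg_min_nat_le) (use that in blast)
  have "degree p \<noteq> 0"
  proof
    assume "degree p = 0"
    then have c: "coeff p 0 *s x \<in> F" "coeff p 0 \<noteq> 0" using p leading_coeff_neq_0[of p] by (auto simp: poly_apply_def)
    have "inverse (coeff p 0) *s (coeff p 0 *s x) \<in> F" by (rule vec.subspace_scale[OF F(1) c(1)])
    moreover have "inverse (coeff p 0) *s (coeff p 0 *s x) = x"
      unfolding vec.scale_scale left_inverse[OF c(2)] by simp
    ultimately show False using x by simp
  qed
  then have "\<exists>i\<in>{1..degree p}. coeff p i \<noteq> 0" using p(1) by (intro bexI[of _ "degree p"]) auto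
  then obtain a where "poly p a = 0"
    using Cauchy_Integral_Formula.fundamental_theorem_of_algebra[of "coeff p" "degree p"]
    by (auto simp: poly_altdef)
  then obtain q where q: "p = [:- a, 1:] * q" by (auto simp: poly_eq_0_iff_dvd elim: dvdE)
  have "q \<noteq> 0" using p q by auto
  then have "degree p = Suc (degree q)" unfolding q by (subst degree_mult_eq) auto
  then have "poly_apply M x q \<notin> F" using min[of q] \<open>q \<noteq> 0\<close> by auto
  moreover have "M *v poly_apply M x q - a *s poly_apply M x q \<in> F"
    using p(2) unfolding q poly_apply_linear_factor .
  ultimately show ?thesis using that by blast
qed

text \<open>\<open>transpose R - mat a\<close> maps the span of \<open>f\<close> and
  \<open>F\<close> into the smaller space \<open>F\<close>, so it is singular; determinants carry
  this over to \<open>R - mat a\<close>.\<close>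

lemma eigenvalue_transpose:
  fixes R :: "complex^'m^'m"
  assumes F: "vec.subspace F" and inv: "\<And>g. g \<in> F \<Longrightarrow> transpose R *v g \<in> F"
    and f: "f \<notin> F" "transpose R *v f - a *s f \<in> F"
  obtains v where "v \<noteq> 0" "R *v v = a *s v"
proof -
  let ?T = "transpose R - mat a"
  have T: "?T *v g = transpose R *v g - a *s g" for g
    by (simp add: matrix_vector_mult_diff_rdistrib mat_mult_vec)
  define W where "W = vec.span (insert f F)"
  have "?T *v g \<in> F" if g: "g \<in> W" for g
  proof -
    obtain k where "g - k *s f \<in> vec.span F" using g unfolding W_def vec.span_breakdown_eq by blast
    then have k: "g - k *s f \<in> F" using vec.span_eq_iff F by metis
    have "?T *v g = ?T *v (g - k *s f) + k *s (?T *v f)"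
      by (simp add: matrix_vector_mult_diff_distrib vector_scalar_commute)
    moreover have "?T *v (g - k *s f) \<in> F" "k *s (?T *v f) \<in> F"
      unfolding T
      by (rule vec.subspace_diff[OF F inv[OF k] vec.subspace_scale[OF F k]], rule vec.subspace_scale[OF F f(2)])
    ultimately show ?thesis using F by (metis vec.subspace_add)
  qed
  then have sub: "(*v) ?T ` W \<subseteq> F" by blast
  have "\<not> invertible ?T"
  proof
    assume "invertible ?T"
    then obtain S where "S ** ?T = mat 1" by (auto simp: invertible_def)
    then have "inj ((*v) ?T)" using matrix_left_invertible_injective by (metis injI inj_def)
    then have "vec.dim ((*v) ?T ` W) = vec.dim W"
      by (intro vec.dim_image_eq) (auto simp: inj_on_def)
    moreover have "vec.dim ((*v) ?T ` W) \<le> vec.dim F" by (rule vec.dim_subset[OF sub])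
    moreover have "vec.dim F < vec.dim W"
    proof -
      have "vec.span F \<subset> vec.span (insert f F)"
        using f(1) F vec.span_mono[of F "insert f F"] vec.span_base[of f "insert f F"]
        by (metis insertI1 psubsetI subset_insertI vec.span_eq_iff)
      then show ?thesis unfolding W_def by (metis vec.dim_psubset vec.dim_span)
    qed
    ultimately show False by simp
  qed
  moreover have "transpose (R - mat a) = ?T" by (simp add: vec_eq_iff transpose_def mat_def)
  ultimately have "\<not> invertible (R - mat a)"
    by (metis det_transpose invertible_det_nz)
  then obtain v where "v \<noteq> 0" "(R - mat a) *v v = 0"
    by (auto simp: invertible_left_inverse matrix_left_invertible_ker)
  then show ?thesis using that by (simp add: matrix_vector_mult_diff_rdistrib mat_mult_vec)
qed

section \<open>Sums of squares adapted to a matrix\<close>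

definition sqf :: "(complex^'m) list \<Rightarrow> complex^'m \<Rightarrow> complex^'m \<Rightarrow> real" where
  "sqf fs x y = (\<Sum>f\<leftarrow>fs. cdot f x \<bullet> cdot f y)"

lemma sqf_nonneg: "sqf fs x x \<ge> 0"
  unfolding sqf_def by (intro sum_list_nonneg) auto

lemma sqf_simps [simp]: "sqf [] x y = 0" "sqf (f # fs) x y = cdot f x \<bullet> cdot f y + sqf fs x y"
  by (simp_all add: sqf_def)

lemma sqf_scale: "sqf (map ((*s) (of_real c)) fs) x y = c\<^sup>2 * sqf fs x y"
  by (induction fs) (auto simp: cdot_simps algebra_simps power2_eq_square inner_mult_left
      simp flip: scaleR_conv_of_real)

lemma power2_add_le: "(a + b)\<^sup>2 \<le> 2 * a\<^sup>2 + 2 * (b::real)\<^sup>2"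
  using zero_le_power2[of "a - b"] by (simp add: power2_eq_square algebra_simps)

lemma cdot_span_bound:
  assumes "g \<in> vec.span (set fs)"
  obtains B where "B > 0" "\<And>x. (norm (cdot g x))\<^sup>2 \<le> B * sqf fs x x"
proof -
  have "\<exists>B>0. \<forall>x. (norm (cdot g x))\<^sup>2 \<le> B * sqf fs x x"
    using assms
  proof (induction rule: vec.span_induct_alt)
    case base
    show ?case by (auto intro!: exI[of _ 1] simp: cdot_simps sqf_nonneg)
  next
    case (step c h y)
    then obtain B where B: "B > 0" "\<And>x. (norm (cdot y x))\<^sup>2 \<le> B * sqf fs x x" by blast
    have h: "(norm (cdot h x))\<^sup>2 \<le> sqf fs x x" for x
      unfolding sqf_def power2_norm_eq_inner
      using step(1) by (intro member_le_sum_list) auto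
    have "(norm (cdot (c *s h + y) x))\<^sup>2 \<le> (2 * (norm c)\<^sup>2 + 2 * B) * sqf fs x x" for x
    proof -
      have "norm (cdot (c *s h + y) x) \<le> norm c * norm (cdot h x) + norm (cdot y x)"
        unfolding cdot_simps by (metis norm_mult norm_triangle_ineq)
      then have "(norm (cdot (c *s h + y) x))\<^sup>2 \<le> (norm c * norm (cdot h x) + norm (cdot y x))\<^sup>2"
        by (intro power_mono) auto
      also have "\<dots> \<le> 2 * (norm c * norm (cdot h x))\<^sup>2 + 2 * (norm (cdot y x))\<^sup>2"
        by (rule power2_add_le)
      also have "\<dots> \<le> 2 * ((norm c)\<^sup>2 * sqf fs x x) + 2 * (B * sqf fs x x)"
        unfolding power_mult_distrib using h B by (intro add_mono mult_left_mono) auto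
      finally show ?thesis by (simp add: algebra_simps)
    qed
    moreover have "2 * (norm c)\<^sup>2 + 2 * B > 0" using B by (simp add: add_nonneg_pos)
    ultimately show ?case by blast
  qed
  then show ?thesis using that by blast
qed

text \<open>Triangularising \<open>transpose R\<close> one functional at a time: rescaling the functionals found so
  far dominates the coupling of the new one to them.\<close>

lemma adapted_form_step:
  fixes R :: "complex^'m^'m"
  assumes ev: "\<And>z v. v \<noteq> 0 \<Longrightarrow> R *v v = z *s v \<Longrightarrow> Re z \<le> 0"
  shows "\<kappa> > 0 \<Longrightarrow> k \<le> CARD('m) \<Longrightarrow> \<exists>fs. (\<forall>f\<in>vec.span (set fs). transpose R *v f \<in> vec.span (set fs)) \<and>
    k \<le> vec.dim (set fs) \<and> (\<forall>x. sqf fs x (R *v x) \<le> \<kappa> * sqf fs x x)"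
proof (induction k arbitrary: \<kappa>)
  case 0
  show ?case by (rule exI[of _ "[]"]) simp
next
  case (Suc k)
  \<comment> \<open>Half of the rate is saved to pay for the coupling of the next
    functional.\<close>
  have "\<kappa> / 2 > 0" "k \<le> CARD('m)" using Suc.prems by auto
  from Suc.IH[OF this] obtain fs where
    inv: "\<And>f. f \<in> vec.span (set fs) \<Longrightarrow> transpose R *v f \<in> vec.span (set fs)"
    and dim: "k \<le> vec.dim (set fs)" and le: "\<And>x. sqf fs x (R *v x) \<le> \<kappa> / 2 * sqf fs x x" by metis
  show ?case
  proof (cases "vec.span (set fs) = UNIV")
    case True
    then have "vec.dim (set fs) = CARD('m)" by (metis vec.dim_span vec_dim_card)
    moreover have "sqf fs x (R *v x) \<le> \<kappa> * sqf fs x x" for x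
    proof -
      have "0 \<le> \<kappa> * sqf fs x x" using sqf_nonneg[of fs x] Suc.prems(1) by (intro mult_nonneg_nonneg) auto
      with le[of x] show ?thesis by (simp add: field_simps)
    qed
    ultimately show ?thesis using inv Suc.prems by (intro exI[of _ fs]) auto
  next
    case False
    obtain f a where f: "f \<notin> vec.span (set fs)" "transpose R *v f - a *s f \<in> vec.span (set fs)"
      using eigenvector_mod_subspace[OF vec.subspace_span False] .
    define g where "g = transpose R *v f - a *s f"
    obtain v where "v \<noteq> 0" "R *v v = a *s v"
      using eigenvalue_transpose[OF vec.subspace_span inv f] .
    then have a: "Re a \<le> 0" by (rule ev)
    obtain B where B: "B > 0" "\<And>x. (norm (cdot g x))\<^sup>2 \<le> B * sqf fs x x"
      using cdot_span_bound[of g fs] f(2) unfolding g_def by blast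
    \<comment> \<open>With this weight \<open>C\<^sup>2 * (\<kappa> / 2)\<close> equals
      \<open>B / (4 * \<kappa>)\<close>, the constant that Young's inequality leaves in front of the
      old form.\<close>
    define C where "C = sqrt (B / (2 * \<kappa>\<^sup>2))"
    have C2: "C\<^sup>2 = B / (2 * \<kappa>\<^sup>2)" using B Suc.prems by (simp add: C_def)
    have C: "C > 0" using B Suc.prems by (simp add: C_def)
    define fs' where "fs' = f # map ((*s) (of_real C)) fs"
    have gs: "vec.span (set (map ((*s) (of_real C)) fs)) = vec.span (set fs)"
      using C vec.span_image_scale[of "set fs" "\<lambda>_. of_real C"] by simp
    have span: "vec.span (set fs') = vec.span (insert f (set fs))"
      using gs by (auto simp: fs'_def vec.span_insert)
    have sub: "vec.span (set fs) \<subseteq> vec.span (set fs')" unfolding span by (intro vec.span_mono) auto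
    have fin: "f \<in> vec.span (set fs')" unfolding span by (intro vec.span_base) simp
    have inv': "transpose R *v h \<in> vec.span (set fs')" if h: "h \<in> vec.span (set fs')" for h
    proof -
      obtain c where c: "h - c *s f \<in> vec.span (set fs)"
        using h unfolding span vec.span_breakdown_eq by blast
      have "transpose R *v h = transpose R *v (h - c *s f) + c *s (g + a *s f)"
        by (simp add: g_def matrix_vector_mult_diff_distrib vector_scalar_commute)
      moreover have "g \<in> vec.span (set fs')" using f(2) sub by (auto simp: g_def)
      ultimately show ?thesis
        using inv[OF c] sub fin by (auto intro!: vec.span_add vec.span_scale)
    qed
    have "vec.span (set fs) \<subset> vec.span (set fs')" using sub fin f(1) by blast
    then have "vec.dim (set fs) < vec.dim (set fs')" by (rule vec.dim_psubset)
    then have dim': "Suc k \<le> vec.dim (set fs')" using dim by linarith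
    have le': "sqf fs' x (R *v x) \<le> \<kappa> * sqf fs' x x" for x
    proof -
      have "cdot f (R *v x) = a * cdot f x + cdot g x"
        unfolding cdot_transpose[symmetric] by (simp add: g_def flip: cdot_simps)
      then have "cdot f x \<bullet> cdot f (R *v x) = Re a * (norm (cdot f x))\<^sup>2 + cdot f x \<bullet> cdot g x"
        unfolding cmod_power2 inner_complex_def by (simp add: algebra_simps power2_eq_square)
      also have "\<dots> \<le> 0 + norm (cdot f x) * norm (cdot g x)"
        using a by (intro add_mono norm_cauchy_schwarz mult_nonpos_nonneg) auto
      \<comment> \<open>Young's inequality, weighted so that the new functional uses up exactly its
        own rate \<kappa>.\<close>
      also have "\<dots> \<le> \<kappa> * (norm (cdot f x))\<^sup>2 + (norm (cdot g x))\<^sup>2 / (4 * \<kappa>)"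
      proof -
        have "0 \<le> (2 * \<kappa> * norm (cdot f x) - norm (cdot g x))\<^sup>2" by simp
        then show ?thesis using Suc.prems(1) by (simp add: field_simps power2_eq_square)
      qed
      also have "\<dots> \<le> \<kappa> * (norm (cdot f x))\<^sup>2 + (B * sqf fs x x) / (4 * \<kappa>)"
        using B Suc.prems(1) by (intro add_left_mono divide_right_mono) auto
      finally have 1: "cdot f x \<bullet> cdot f (R *v x) \<le> \<kappa> * (norm (cdot f x))\<^sup>2 + (B * sqf fs x x) / (4 * \<kappa>)" .
      have 2: "C\<^sup>2 * sqf fs x (R *v x) \<le> C\<^sup>2 * (\<kappa> / 2 * sqf fs x x)"
        by (intro mult_left_mono le) simp
      have 3: "(B * sqf fs x x) / (4 * \<kappa>) = C\<^sup>2 * (\<kappa> / 2 * sqf fs x x)"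
        using Suc.prems(1) unfolding C2 by (simp add: field_simps power2_eq_square)
      show ?thesis
        using 1 2 unfolding 3 fs'_def sqf_simps sqf_scale power2_norm_eq_inner
        by (simp add: algebra_simps)
    qed
    show ?thesis using inv' dim' le' by blast
  qed
qed

text \<open>Once the functionals span a space of full dimension, every coordinate is controlled by
  them, so the form is positive definite.\<close>

lemma adapted_form:
  fixes R :: "complex^'m^'m"
  assumes ev: "\<And>z v. v \<noteq> 0 \<Longrightarrow> R *v v = z *s v \<Longrightarrow> Re z \<le> 0" and \<kappa>: "\<kappa> > 0"
  obtains fs B where "B > 0" "\<And>x. (norm x)\<^sup>2 \<le> B * sqf fs x x"
    "\<And>x. sqf fs x (R *v x) \<le> \<kappa> * sqf fs x x"
proof -
  obtain fs :: "(complex^'m) list" where fs: "CARD('m) \<le> vec.dim (set fs)" "\<And>x. sqf fs x (R *v x) \<le> \<kappa> * sqf fs x x"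
    using adapted_form_step[where R = R and \<kappa> = \<kappa> and k = "CARD('m)"] ev \<kappa> by blast
  have "vec.dim (set fs) = CARD('m)"
    using fs(1) vec.dim_subset[of "set fs" UNIV] by (simp add: vec_dim_card del: vec.dim_UNIV)
  then have span: "vec.span (set fs) = UNIV" using vec.dim_eq_full[of "set fs"] by (simp add: card_cart_basis vec.dimension_def)
  have "\<exists>B>0. \<forall>x. (norm (x $ i))\<^sup>2 \<le> B * sqf fs x x" for i
    using cdot_span_bound[of "axis i 1" fs] span by (metis UNIV_I cdot_axis)
  then obtain B where B: "\<And>i. B i > 0" "\<And>i x. (norm (x $ i))\<^sup>2 \<le> B i * sqf fs x x" by metis
  have "(norm x)\<^sup>2 \<le> (\<Sum>i\<in>UNIV. B i) * sqf fs x x" for x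
  proof -
    have "(norm x)\<^sup>2 = (\<Sum>i\<in>UNIV. (norm (x $ i))\<^sup>2)"
      by (simp add: norm_vec_def L2_set_def sum_nonneg)
    also have "\<dots> \<le> (\<Sum>i\<in>UNIV. B i * sqf fs x x)" by (intro sum_mono B)
    finally show ?thesis by (simp add: sum_distrib_right)
  qed
  moreover have "(\<Sum>i\<in>UNIV. B i) > 0" by (intro sum_pos B) auto
  ultimately show ?thesis using that fs(2) by blast
qed

lemma matrix_vector_scaleR: "(M :: complex^'k^'m) *v (r *\<^sub>R x) = r *\<^sub>R (M *v x)"
  by (rule linear_cmul[OF bounded_linear.linear[OF matrix_vector_mul_bounded_linear]])

lemma bounded_bilinear_sqf: "bounded_bilinear (sqf fs)"
proof -
  have "bilinear (sqf fs)"
    unfolding bilinear_def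
    by (auto intro!: linearI; induction fs)
       (auto simp: cdot_simps inner_add_left inner_add_right algebra_simps)
  then show ?thesis by (simp add: bilinear_conv_bounded_bilinear)
qed

lemma sqf_commute: "sqf fs x y = sqf fs y x"
  by (simp add: sqf_def inner_commute)

text \<open>The form adapted to the map induced by \<open>A\<close> modulo \<open>range E\<close>, minus a multiple \<open>\<eta>\<close> of the
  square norm of the component in \<open>range E\<close>; \<open>\<eta>\<close> is so small that the coupling of the two
  components is absorbed.\<close>

lemma Lyapunov_form:
  fixes A :: "complex^'m^'m" and E :: "complex^'d^'m" and B :: "complex^'m^'d" and lam :: "complex^'d"
  assumes BE: "B ** E = mat 1"
    and AE: "\<And>s. A *v (E *v s) = E *v diag_mult lam s"
    and quot: "\<And>z v. Re z > 0 \<Longrightarrow> A *v v - z *s v \<in> range ((*v) E) \<Longrightarrow> v \<in> range ((*v) E)"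
    and \<kappa>: "\<kappa> > 0" "\<And>i. \<kappa> < Re (lam $ i)"
  obtains Q c where "c > 0" "bounded_bilinear Q" "\<And>x y. Q x y = Q y x"
    "\<And>x. Q x (A *v x) \<le> \<kappa> * Q x x - c * (norm x)\<^sup>2"
    "\<And>x. B *v x = 0 \<Longrightarrow> x \<noteq> 0 \<Longrightarrow> Q x x > 0"
proof -
  have BEv: "B *v (E *v s) = s" for s
    by (simp add: matrix_vector_mul_assoc BE)
  \<comment> \<open>The projection along the range of \<open>E\<close> onto the kernel of
    \<open>B\<close>; \<open>R = N ** A\<close> then represents the map that \<open>A\<close>
    induces modulo the range of \<open>E\<close>.\<close>
  define N where "N = mat 1 - E ** B"
  have N: "N *v x = x - E *v (B *v x)" for x
    by (simp add: N_def matrix_vector_mult_diff_rdistrib matrix_vector_mul_assoc)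
  have NE: "N *v (E *v s) = 0" for s by (simp add: N BEv)
  have NN: "N *v (N *v x) = N *v x" for x
    by (subst (2) N) (simp add: matrix_vector_mult_diff_distrib NE)
  define R where "R = N ** A"
  have R: "R *v x = N *v (A *v x)" for x by (simp add: R_def matrix_vector_mul_assoc)
  have RN: "N *v (A *v x) = R *v (N *v x)" for x
    unfolding R by (subst (2) N) (simp add: matrix_vector_mult_diff_distrib AE NE)
  \<comment> \<open>An eigenvector of \<open>R\<close> with \<open>z \<noteq> 0\<close> is fixed by
    \<open>N\<close>, and \<open>A *v v - z *s v\<close> lies in the range of \<open>E\<close>. For
    \<open>Re z > 0\<close> the hypothesis \<open>quot\<close> puts \<open>v\<close> into that range
    too, where \<open>N\<close> vanishes.\<close>
  have ev: "Re z \<le> 0" if v: "v \<noteq> 0" "R *v v = z *s v" for z v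
  proof (rule ccontr)
    assume "\<not> Re z \<le> 0"
    then have z: "Re z > 0" by simp
    then have z0: "z \<noteq> 0" by auto
    have "z *s (N *v v) = N *v (R *v v)" by (simp add: v vector_scalar_commute)
    also have "\<dots> = z *s v" unfolding R NN using v by (simp add: R)
    finally have "inverse z *s (z *s (N *v v)) = inverse z *s (z *s v)" by simp
    then have Nv: "N *v v = v" unfolding vec.scale_scale left_inverse[OF z0] by simp
    have "A *v v - z *s v = E *v (B *v (A *v v))"
      using v(2) N[of "A *v v"] by (simp add: R algebra_simps)
    then have "v \<in> range ((*v) E)" using quot[OF z] by auto
    then show False using Nv NE v(1) by auto
  qed
  have k2: "\<kappa> / 2 > 0" using \<kappa>(1) by simp
  have "\<exists>fs b. b > 0 \<and> (\<forall>x. (norm x)\<^sup>2 \<le> b * sqf fs x x) \<and> (\<forall>x. sqf fs x (R *v x) \<le> \<kappa> / 2 * sqf fs x x)"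
  proof (rule adapted_form[where R = R and \<kappa> = "\<kappa> / 2"])
    show "Re z \<le> 0" if "v \<noteq> 0" "R *v v = z *s v" for z v using ev that .
  qed (use k2 in blast)+
  then obtain fs b where b: "b > 0" "\<And>x. (norm x)\<^sup>2 \<le> b * sqf fs x x"
    and fs: "\<And>x. sqf fs x (R *v x) \<le> \<kappa> / 2 * sqf fs x x" by blast
  obtain \<delta> where \<delta>: "\<delta> > 0" "\<And>i. \<delta> \<le> Re (lam $ i) - \<kappa>"
    using ex_pos_lower_bound[of "\<lambda>i. Re (lam $ i) - \<kappa>"] \<kappa>(2) by (metis diff_gt_0_iff_gt)
  obtain G where G: "G > 0" "\<And>x. norm ((B ** A) *v x) \<le> norm x * G"
    using bounded_linear.pos_bounded[OF matrix_vector_mul_bounded_linear[of "B ** A"]] by blast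
  obtain K where K: "K > 0" "\<And>x. norm (E *v x) \<le> norm x * K"
    using bounded_linear.pos_bounded[OF matrix_vector_mul_bounded_linear[of E]] by blast
  \<comment> \<open>Then \<open>\<eta> * G\<^sup>2 / (2 * \<delta>) = \<kappa> / (4 * b)\<close>:
    the coupling costs half of the margin \<open>\<kappa> / (2 * b)\<close> of the quotient part and
    half of the margin \<delta> of the unstable part.\<close>
  define \<eta> where "\<eta> = \<kappa> * \<delta> / (2 * b * G\<^sup>2)"
  have \<eta>: "\<eta> > 0" using \<kappa> \<delta> b G by (simp add: \<eta>_def)
  define Q where "Q x y = sqf fs (N *v x) (N *v y) - \<eta> * ((B *v x) \<bullet> (B *v y))" for x y
  \<comment> \<open>The smaller of the two margins left over; the denominator compares
    \<open>norm x\<close> with its components, by \<open>x = y + E *v s\<close>.\<close>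
  define c where "c = min (\<kappa> / (4 * b)) (\<eta> * \<delta> / 2) / (2 + 2 * K\<^sup>2)"
  have den: "2 + 2 * K\<^sup>2 > 0" by (simp add: add_pos_nonneg)
  show ?thesis
  proof
    show "c > 0" using \<kappa> b \<eta> \<delta> den by (simp add: c_def)
    have "bilinear Q"
      unfolding bilinear_def Q_def
      by (auto intro!: linearI simp: matrix_vector_right_distrib inner_add_left inner_add_right algebra_simps
          matrix_vector_scaleR bounded_bilinear.add_left[OF bounded_bilinear_sqf]
          bounded_bilinear.add_right[OF bounded_bilinear_sqf]
          bounded_bilinear.scaleR_left[OF bounded_bilinear_sqf] bounded_bilinear.scaleR_right[OF bounded_bilinear_sqf])
    then show "bounded_bilinear Q" by (simp add: bilinear_conv_bounded_bilinear)
    show "Q x y = Q y x" for x y by (simp add: Q_def sqf_commute[of _ "N *v x"] inner_commute)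
    show "Q x x > 0" if x: "B *v x = 0" "x \<noteq> 0" for x
    proof -
      have "0 < (norm x)\<^sup>2" using x by simp
      also have "\<dots> \<le> b * sqf fs x x" by (rule b)
      finally show ?thesis using x b by (simp add: Q_def N zero_less_mult_iff)
    qed
    show "Q x (A *v x) \<le> \<kappa> * Q x x - c * (norm x)\<^sup>2" for x
    proof -
      define y where "y = N *v x"
      define s where "s = B *v x"
      have x: "x = y + E *v s" by (simp add: y_def s_def N)
      define w where "w = B *v (A *v y)"
      have BA: "B *v (A *v x) = w + diag_mult lam s"
        unfolding w_def by (subst x) (simp add: matrix_vector_right_distrib AE BEv)
      have NA: "N *v (A *v x) = R *v y" by (simp add: RN y_def)
      have w: "norm w \<le> norm y * G" using G(2)[of y] by (simp add: w_def matrix_vector_mul_assoc)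
      have lam: "s \<bullet> diag_mult lam s \<ge> (\<kappa> + \<delta>) * (norm s)\<^sup>2"
      proof -
        have "s $ i \<bullet> (lam $ i * s $ i) = Re (lam $ i) * (norm (s $ i))\<^sup>2" for i
          unfolding cmod_power2 inner_complex_def by (simp add: algebra_simps power2_eq_square)
        then have "s \<bullet> diag_mult lam s = (\<Sum>i\<in>UNIV. Re (lam $ i) * (norm (s $ i))\<^sup>2)"
          by (simp add: inner_vec_def)
        also have "\<dots> \<ge> (\<Sum>i\<in>UNIV. (\<kappa> + \<delta>) * (norm (s $ i))\<^sup>2)"
          using \<delta>(2) by (intro sum_mono mult_right_mono) (auto simp: algebra_simps)
        finally show ?thesis
          by (simp add: norm_vec_def L2_set_def sum_nonneg sum_distrib_left)
      qed
      have cross: "- (s \<bullet> w) \<le> \<delta> / 2 * (norm s)\<^sup>2 + G\<^sup>2 / (2 * \<delta>) * (norm y)\<^sup>2"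
      proof -
        have "- (s \<bullet> w) \<le> norm s * norm w" using norm_cauchy_schwarz[of "- s" w] by simp
        also have "\<dots> \<le> norm s * (norm y * G)" by (intro mult_left_mono w) simp
        also have "\<dots> \<le> \<delta> / 2 * (norm s)\<^sup>2 + G\<^sup>2 / (2 * \<delta>) * (norm y)\<^sup>2"
        proof -
          have "0 \<le> (\<delta> * norm s - G * norm y)\<^sup>2" by simp
          then show ?thesis using \<delta>(1) by (simp add: field_simps power2_eq_square)
        qed
        finally show ?thesis .
      qed
      have "\<eta> * (G\<^sup>2 / (2 * \<delta>) * (norm y)\<^sup>2) = \<kappa> / (4 * b) * (norm y)\<^sup>2"
        using G \<delta> b by (simp add: \<eta>_def field_simps power2_eq_square)
      then have cross': "\<eta> * (- (s \<bullet> w)) \<le> \<eta> * (\<delta> / 2 * (norm s)\<^sup>2) + \<kappa> / (4 * b) * (norm y)\<^sup>2"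
        using mult_left_mono[OF cross, of \<eta>] \<eta> by (simp add: algebra_simps)
      have lam': "\<eta> * ((\<kappa> + \<delta>) * (norm s)\<^sup>2) \<le> \<eta> * (s \<bullet> diag_mult lam s)"
        using lam \<eta> by (intro mult_left_mono) auto
      have y: "\<kappa> / (2 * b) * (norm y)\<^sup>2 \<le> \<kappa> / 2 * sqf fs y y"
        using mult_left_mono[OF b(2)[of y], of "\<kappa> / (2 * b)"] b(1) \<kappa>(1) by simp
      have "Q x (A *v x) = sqf fs y (R *v y) - \<eta> * (s \<bullet> diag_mult lam s) + \<eta> * (- (s \<bullet> w))"
        unfolding Q_def NA BA by (simp add: y_def s_def inner_add_right algebra_simps)
      also have "\<dots> \<le> \<kappa> / 2 * sqf fs y y - \<eta> * ((\<kappa> + \<delta>) * (norm s)\<^sup>2)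
          + (\<eta> * (\<delta> / 2 * (norm s)\<^sup>2) + \<kappa> / (4 * b) * (norm y)\<^sup>2)"
        using fs[of y] lam' cross' by linarith
      also have "\<dots> \<le> \<kappa> * (sqf fs y y - \<eta> * (norm s)\<^sup>2)
          - (\<kappa> / (4 * b) * (norm y)\<^sup>2 + \<eta> * \<delta> / 2 * (norm s)\<^sup>2)"
        using y by (simp add: algebra_simps)
      also have "sqf fs y y - \<eta> * (norm s)\<^sup>2 = Q x x"
        by (simp add: Q_def y_def s_def power2_norm_eq_inner)
      finally have "Q x (A *v x)
          \<le> \<kappa> * Q x x - (\<kappa> / (4 * b) * (norm y)\<^sup>2 + \<eta> * \<delta> / 2 * (norm s)\<^sup>2)" .
      moreover have "c * (norm x)\<^sup>2 \<le> \<kappa> / (4 * b) * (norm y)\<^sup>2 + \<eta> * \<delta> / 2 * (norm s)\<^sup>2"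
      proof -
        define m where "m = min (\<kappa> / (4 * b)) (\<eta> * \<delta> / 2)"
        have m: "m > 0" "m \<le> \<kappa> / (4 * b)" "m \<le> \<eta> * \<delta> / 2" using \<kappa> b \<eta> \<delta> by (auto simp: m_def)
        have "norm x \<le> norm y + norm s * K" unfolding x using K(2) norm_triangle_le by (metis add_left_mono)
        then have "(norm x)\<^sup>2 \<le> (norm y + norm s * K)\<^sup>2" by (intro power_mono) auto
        also have "\<dots> \<le> 2 * (norm y)\<^sup>2 + 2 * (norm s * K)\<^sup>2" by (rule power2_add_le)
        also have "\<dots> \<le> (2 + 2 * K\<^sup>2) * ((norm y)\<^sup>2 + (norm s)\<^sup>2)"
          by (simp add: algebra_simps power_mult_distrib)
        finally have "c * (norm x)\<^sup>2 \<le> c * ((2 + 2 * K\<^sup>2) * ((norm y)\<^sup>2 + (norm s)\<^sup>2))"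
          using \<open>c > 0\<close> by (intro mult_left_mono) auto
        also have "\<dots> = m * ((norm y)\<^sup>2 + (norm s)\<^sup>2)"
          using den by (simp add: c_def m_def)
        also have "\<dots> = m * (norm y)\<^sup>2 + m * (norm s)\<^sup>2" by (rule distrib_left)
        also have "\<dots> \<le> \<kappa> / (4 * b) * (norm y)\<^sup>2 + \<eta> * \<delta> / 2 * (norm s)\<^sup>2"
          using m by (intro add_mono mult_right_mono) auto
        finally show ?thesis .
      qed
      ultimately show ?thesis by linarith
    qed
  qed
qed

text \<open>The equation modulo the range of \<open>E\<close> is solved coordinatewise wherever
  \<open>lam $ i \<noteq> z\<close>. What remains is a vector killed by the square of
  \<open>A - mat z\<close>, hence a member of the unstable subspace.\<close>

lemma unstable_quotient:
  fixes A :: "complex^'m^'m" and E :: "complex^'d^'m"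
  assumes AE: "\<And>s. A *v (E *v s) = E *v diag_mult lam s"
    and E: "range ((*v) E) = unstable_subspace A"
    and z: "Re z > 0" and v: "A *v v - z *s v \<in> range ((*v) E)"
  shows "v \<in> range ((*v) E)"
proof -
  obtain s where s: "A *v v - z *s v = E *v s" using v by auto
  define t where "t = (\<chi> i. if lam $ i = z then 0 else s $ i / (lam $ i - z))"
  define r where "r = (\<chi> i. if lam $ i = z then s $ i else 0)"
  define w where "w = v - E *v t"
  have Az: "(A - mat z) *v x = A *v x - z *s x" for x
    by (simp add: matrix_vector_mult_diff_rdistrib mat_mult_vec)
  have AzE: "(A - mat z) *v (E *v x) = E *v (\<chi> i. (lam $ i - z) * x $ i)" for x
    unfolding Az AE vector_scalar_commute[symmetric] matrix_vector_mult_diff_distrib[symmetric]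
    by (rule arg_cong[where f = "(*v) E"]) (simp add: vec_eq_iff algebra_simps)
  have "(A - mat z) *v w = E *v s - E *v (\<chi> i. (lam $ i - z) * t $ i)"
    unfolding w_def matrix_vector_mult_diff_distrib AzE by (simp add: Az s)
  also have "\<dots> = E *v r"
    unfolding matrix_vector_mult_diff_distrib[symmetric]
    by (rule arg_cong[where f = "(*v) E"]) (simp add: vec_eq_iff t_def r_def)
  finally have 1: "(A - mat z) *v w = E *v r" .
  have "(\<chi> i. (lam $ i - z) * r $ i) = 0" by (simp add: vec_eq_iff r_def)
  then have "(A - mat z) *v (E *v r) = 0" unfolding AzE by simp
  then have "((*v) (A - mat z) ^^ 2) w = 0" using 1 by (simp add: numeral_2_eq_2)
  then have "w \<in> gen_eigenspace A z" unfolding gen_eigenspace_def by blast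
  then have "w \<in> unstable_subspace A" using z unfolding unstable_subspace_def by (intro vec.span_base) auto
  moreover have "E *v t \<in> unstable_subspace A" using E by auto
  ultimately have "w + E *v t \<in> unstable_subspace A"
    unfolding unstable_subspace_def by (rule vec.span_add)
  then show ?thesis by (simp add: w_def E)
qed

text \<open>Induction over a set containing the support of a kernel vector:
  \<open>A - mat (lam $ k)\<close> removes the coordinate \<open>k\<close> and multiplies the others
  by nonzero factors, the eigenvalues being distinct.\<close>

lemma inj_eigenvector_matrix:
  fixes A :: "complex^'m^'m" and E :: "complex^'d^'m"
  assumes AE: "\<And>s. A *v (E *v s) = E *v diag_mult lam s"
    and lam: "inj (($) lam)" and ne: "\<And>i. E *v axis i 1 \<noteq> 0"
  shows "inj ((*v) E)"
proof -
  have "finite S \<Longrightarrow> E *v s = 0 \<Longrightarrow> (\<And>i. i \<notin> S \<Longrightarrow> s $ i = 0) \<Longrightarrow> s = 0" for S s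
  proof (induction S arbitrary: s rule: finite_induct)
    case empty
    then show ?case by (simp add: vec_eq_iff)
  next
    case (insert k S)
    have "E *v (\<chi> i. (lam $ i - lam $ k) * s $ i) = A *v (E *v s) - lam $ k *s (E *v s)"
      unfolding AE vector_scalar_commute[symmetric] matrix_vector_mult_diff_distrib[symmetric]
      by (rule arg_cong[where f = "(*v) E"]) (simp add: vec_eq_iff algebra_simps)
    then have "E *v (\<chi> i. (lam $ i - lam $ k) * s $ i) = 0" using insert.prems by simp
    then have "(\<chi> i. (lam $ i - lam $ k) * s $ i) = 0"
    proof (rule insert.IH)
      show "(\<chi> i. (lam $ i - lam $ k) * s $ i) $ i = 0" if "i \<notin> S" for i
        using insert.prems(2)[of i] that by (cases "i = k") auto
    qed
    then have "(lam $ i - lam $ k) * s $ i = 0" for i by (simp add: vec_eq_iff)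
    then have s: "s $ i = 0" if "i \<noteq> k" for i using lam that by (auto dest: injD)
    then have "s = s $ k *s axis k 1" by (simp add: vec_eq_iff axis_def)
    then have "s $ k *s (E *v axis k 1) = 0" using insert.prems(1) by (metis vector_scalar_commute)
    then have "s $ k = 0" using ne by simp
    then have "s $ i = 0" for i using s by (cases "i = k") auto
    then show ?case by (simp add: vec_eq_iff)
  qed
  from this[of UNIV] show ?thesis by (simp add: vec.inj_iff_eq_0)
qed

text \<open>Eigenvectors for eigenvalues of positive real part lie in the unstable subspace;
  counting dimensions leaves no room for anything beyond their span.\<close>

lemma unstable_subspace_eq_range:
  fixes A :: "complex^'m^'m" and E :: "complex^'d^'m"
  assumes AE: "\<And>s. A *v (E *v s) = E *v diag_mult lam s"
    and inj: "inj ((*v) E)" and lam: "\<And>i. Re (lam $ i) > 0"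
    and dim: "vec.dim (unstable_subspace A) = CARD('d)"
  shows "range ((*v) E) = unstable_subspace A"
proof -
  have sub: "vec.subspace (unstable_subspace A)" by (simp add: unstable_subspace_def)
  have axis: "E *v axis i 1 \<in> unstable_subspace A" for i
  proof -
    have "(\<chi> j. lam $ j * axis i 1 $ j) = lam $ i *s axis i 1" by (simp add: vec_eq_iff axis_def)
    then have "A *v (E *v axis i 1) = lam $ i *s (E *v axis i 1)"
      unfolding AE by (simp add: vector_scalar_commute)
    then have "((*v) (A - mat (lam $ i)) ^^ 1) (E *v axis i 1) = 0"
      by (simp add: matrix_vector_mult_diff_rdistrib mat_mult_vec)
    then have "E *v axis i 1 \<in> gen_eigenspace A (lam $ i)" unfolding gen_eigenspace_def by blast
    then show ?thesis unfolding unstable_subspace_def using lam by (intro vec.span_base) auto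
  qed
  have "E *v s \<in> unstable_subspace A" for s
  proof -
    have "E *v s = (\<Sum>i\<in>UNIV. s $ i *s (E *v axis i 1))"
      by (subst basis_expansion[of s, symmetric]) (simp only: matrix_vector_mult_sum vector_scalar_commute)
    also have "\<dots> \<in> unstable_subspace A"
      by (intro vec.subspace_sum[OF sub] vec.subspace_scale[OF sub] axis)
    finally show ?thesis .
  qed
  then have "range ((*v) E) \<subseteq> unstable_subspace A" by blast
  moreover have "vec.subspace (range ((*v) E))"
    by (rule vec.subspace_image) (auto simp: vec.subspace_UNIV)
  moreover have "vec.dim (range ((*v) E)) = CARD('d)"
    using vec.dim_image_eq[of "(*v) E" UNIV] inj by (simp add: vec_dim_card del: vec.dim_UNIV)
  ultimately show ?thesis using sub dim by (intro vec.subspace_dim_equal) auto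
qed

section \<open>Parametrisations conjugating to the linear flow\<close>

lemma differential_inequality_backward:
  fixes d :: "real \<Rightarrow> 'a::real_inner"
  assumes st: "s \<le> t" and cont: "continuous_on {s..t} d"
    and deriv: "\<And>x. s < x \<Longrightarrow> x < t \<Longrightarrow> (d has_vector_derivative d' x) (at x)"
    and L: "\<And>x. s < x \<Longrightarrow> x < t \<Longrightarrow> norm (d' x) \<le> L * norm (d x)"
  shows "norm (d s) \<le> exp (L * (t - s)) * norm (d t)"
proof -
  \<comment> \<open>The weight \<open>exp (2 * L * x)\<close> compensates the fastest decrease of
    the squared norm that \<open>L\<close> permits, so the product is nondecreasing.\<close>
  have mono: "exp (2 * L * s) * (d s \<bullet> d s) \<le> exp (2 * L * t) * (d t \<bullet> d t)"
  proof (cases "s < t")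
    case True
    let ?\<phi> = "\<lambda>x. exp (2 * L * x) * (d x \<bullet> d x)"
    have D: "DERIV ?\<phi> x :> exp (2 * L * x) * (2 * L * (d x \<bullet> d x) + 2 * (d x \<bullet> d' x))" if "s < x" "x < t" for x
      using deriv[OF that] unfolding has_field_derivative_def has_vector_derivative_def
      by (auto intro!: derivative_eq_intros simp: inner_commute algebra_simps fun_eq_iff)
    have C: "continuous_on {s..t} ?\<phi>" by (intro continuous_intros cont)
    have "?\<phi> differentiable (at x)" if "s < x" "x < t" for x
      using D[OF that] real_differentiable_def by blast
    from MVT[OF True C this]
    obtain l z where z: "s < z" "z < t" "DERIV ?\<phi> z :> l" "?\<phi> t - ?\<phi> s = (t - s) * l"
      by blast
    have l: "l = exp (2 * L * z) * (2 * L * (d z \<bullet> d z) + 2 * (d z \<bullet> d' z))"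
      using DERIV_unique[OF z(3) D[OF z(1,2)]] .
    have "\<bar>d z \<bullet> d' z\<bar> \<le> norm (d z) * norm (d' z)" by (rule Cauchy_Schwarz_ineq2)
    also have "\<dots> \<le> norm (d z) * (L * norm (d z))" by (intro mult_left_mono L z) simp
    also have "\<dots> = L * (d z \<bullet> d z)" by (simp add: dot_square_norm power2_eq_square)
    finally have "0 \<le> 2 * L * (d z \<bullet> d z) + 2 * (d z \<bullet> d' z)" by linarith
    then have "l \<ge> 0" unfolding l by simp
    then have "(t - s) * l \<ge> 0" using True by simp
    then show ?thesis using z(4) by linarith
  qed (use st in simp)
  show ?thesis
  proof (rule power2_le_imp_le)
    have "exp (- (2 * L * s)) * (exp (2 * L * s) * (d s \<bullet> d s)) \<le> exp (- (2 * L * s)) * (exp (2 * L * t) * (d t \<bullet> d t))"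
      by (intro mult_left_mono mono) simp
    moreover have "exp (- (2 * L * s)) * exp (2 * L * s) = 1"
      "exp (- (2 * L * s)) * exp (2 * L * t) = exp (2 * (L * (t - s)))"
      by (simp_all add: right_diff_distrib flip: exp_add)
    ultimately have "d s \<bullet> d s \<le> exp (2 * (L * (t - s))) * (d t \<bullet> d t)"
      by (simp only: mult.assoc[symmetric] mult_1_left)
    then show "(norm (d s))\<^sup>2 \<le> (exp (L * (t - s)) * norm (d t))\<^sup>2"
      by (simp add: power2_norm_eq_inner power_mult_distrib exp_double[symmetric])
  qed simp
qed

lemma differential_inequality_forward:
  fixes d :: "real \<Rightarrow> 'a::real_inner"
  assumes st: "s \<le> t" and cont: "continuous_on {s..t} d"
    and deriv: "\<And>x. s < x \<Longrightarrow> x < t \<Longrightarrow> (d has_vector_derivative d' x) (at x)"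
    and L: "\<And>x. s < x \<Longrightarrow> x < t \<Longrightarrow> norm (d' x) \<le> L * norm (d x)"
  shows "norm (d t) \<le> exp (L * (t - s)) * norm (d s)"
proof -
  have "norm (d (- (- t))) \<le> exp (L * (- s - - t)) * norm (d (- (- s)))"
  proof (rule differential_inequality_backward[where d = "\<lambda>x. d (- x)" and d' = "\<lambda>x. - d' (- x)" and s = "- t"])
    show "continuous_on {- t..- s} (\<lambda>x. d (- x))"
      by (rule continuous_on_compose2[OF cont]) (auto intro!: continuous_intros)
    show "((\<lambda>x. d (- x)) has_vector_derivative - d' (- x)) (at x)" if "- t < x" "x < - s" for x
    proof -
      have "(uminus has_vector_derivative - 1) (at x)" by (auto intro!: derivative_eq_intros)
      from vector_diff_chain_at[OF this, of d "d' (- x)"] deriv[of "- x"] that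
      show ?thesis by (simp add: o_def)
    qed
  qed (use st L in auto)
  then show ?thesis by simp
qed

section \<open>The diagonal linear flow\<close>

lemma norm_vec_scale_le:
  fixes \<sigma> :: "complex^'d"
  assumes "\<And>i. norm (c i) \<le> M"
  shows "norm (\<chi> i. c i * \<sigma> $ i) \<le> M * norm \<sigma>"
proof -
  have M: "M \<ge> 0" using assms norm_ge_zero order_trans by blast
  have "norm (\<chi> i. c i * \<sigma> $ i) \<le> L2_set (\<lambda>i. M * norm (\<sigma> $ i)) UNIV"
    unfolding norm_vec_def by (intro L2_set_mono) (auto simp: norm_mult assms mult_right_mono)
  then show ?thesis using M by (simp add: norm_vec_def L2_set_right_distrib)
qed

definition diag_flow :: "complex^'d \<Rightarrow> real \<Rightarrow> complex^'d \<Rightarrow> complex^'d" where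
  "diag_flow lam t \<sigma> = (\<chi> i. exp (lam $ i * of_real t) * \<sigma> $ i)"

lemma diag_flow_0 [simp]: "diag_flow lam 0 \<sigma> = \<sigma>"
  by (simp add: diag_flow_def)

lemma diag_flow_diag_flow [simp]: "diag_flow lam s (diag_flow lam t \<sigma>) = diag_flow lam (s + t) \<sigma>"
  by (simp add: diag_flow_def vec_eq_iff exp_add[symmetric] algebra_simps flip: mult.assoc)

lemma diag_flow_diff: "diag_flow lam t (\<sigma> - \<tau>) = diag_flow lam t \<sigma> - diag_flow lam t \<tau>"
  by (simp add: diag_flow_def vec_eq_iff algebra_simps)

lemma norm_diag_flow_le:
  assumes "\<And>i. a \<le> Re (lam $ i)" "t \<le> 0"
  shows "norm (diag_flow lam t \<sigma>) \<le> exp (a * t) * norm \<sigma>"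
  unfolding diag_flow_def
  by (rule norm_vec_scale_le) (use assms in \<open>auto intro: mult_right_mono_neg\<close>)

lemma norm_diag_flow_le':
  "norm (diag_flow lam t \<sigma>) \<le> exp (norm lam * \<bar>t\<bar>) * norm \<sigma>"
  unfolding diag_flow_def
proof (rule norm_vec_scale_le)
  fix i
  have "Re (lam $ i) * t \<le> \<bar>Re (lam $ i)\<bar> * \<bar>t\<bar>" by (metis abs_ge_self abs_mult)
  also have "\<dots> \<le> norm lam * \<bar>t\<bar>"
    using abs_Re_le_cmod[of "lam $ i"] norm_component_le[of lam i]
    by (intro mult_right_mono) auto
  finally show "norm (exp (lam $ i * of_real t)) \<le> exp (norm lam * \<bar>t\<bar>)" by simp
qed

lemma has_vector_derivative_diag_flow:
  "((\<lambda>t. diag_flow lam t \<sigma>) has_vector_derivative diag_mult lam (diag_flow lam t \<sigma>)) (at t within S)"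
  unfolding has_vector_derivative_def
proof (subst has_derivative_componentwise_within, intro ballI)
  fix b :: "complex^'a" assume "b \<in> Basis"
  then obtain i u where b: "b = axis i u" by (auto simp: Basis_vec_def)
  have "((\<lambda>z. exp (lam $ i * z) * \<sigma> $ i) has_field_derivative lam $ i * (exp (lam $ i * of_real t) * \<sigma> $ i))
      (at (of_real t))"
    by (auto intro!: derivative_eq_intros)
  from has_vector_derivative_real_field[OF this]
  have "((\<lambda>t. diag_flow lam t \<sigma> $ i) has_vector_derivative lam $ i * diag_flow lam t \<sigma> $ i) (at t within S)"
    by (simp add: diag_flow_def)
  then have "((\<lambda>t. diag_flow lam t \<sigma> $ i) has_derivative (\<lambda>h. h *\<^sub>R (lam $ i * diag_flow lam t \<sigma> $ i))) (at t within S)"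
    by (simp add: has_vector_derivative_def)
  from has_derivative_inner_left[OF this, of u]
  show "((\<lambda>t. diag_flow lam t \<sigma> \<bullet> b) has_derivative
      (\<lambda>h. (h *\<^sub>R diag_mult lam (diag_flow lam t \<sigma>)) \<bullet> b)) (at t within S)"
    by (simp add: b inner_axis)
qed

lemma continuous_on_diag_flow: "continuous_on S (\<lambda>t. diag_flow lam t \<sigma>)"
  by (rule continuous_on_vector_derivative[OF has_vector_derivative_diag_flow])

text \<open>Isolates what the dynamical argument uses, independently of series and of
  \<open>G\<close>. The nonlinearity enters through Lipschitz bounds, with constants that become
  small at the origin, which is the form in which the Schwarz lemma delivers them.\<close>

locale unstable_parametrization =
  fixes f N :: "complex^'m \<Rightarrow> complex^'m" and A :: "complex^'m^'m" and U :: "(complex^'m) set"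
    and lam :: "complex^'d" and P :: "complex^'d \<Rightarrow> complex^'m" and J :: "complex^'d \<Rightarrow> complex^'d^'m"
  assumes f_eq: "\<And>w. f w = A *v w + N w"
    and open_U: "open U"
    and N_lipschitz: "\<And>w. w \<in> U \<Longrightarrow> \<exists>r>0. \<exists>L. L-lipschitz_on (ball w r) N"
    and N_small: "\<And>\<rho>. \<rho> > 0 \<Longrightarrow> \<exists>r>0. \<forall>v\<in>ball 0 r. \<forall>w\<in>ball 0 r. norm (N v - N w) \<le> \<rho> * norm (v - w)"
    and N_0: "N 0 = 0"
    and lam_pos: "\<And>i. Re (lam $ i) > 0"
    and P_cont: "continuous_on (cball 0 1) P"
    and P_U: "P ` ball 0 1 \<subseteq> U"
    and P_deriv: "\<And>\<sigma>. \<sigma> \<in> ball 0 1 \<Longrightarrow> (P has_derivative (\<lambda>h. J \<sigma> *v h)) (at \<sigma>)"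
    and J_cont: "\<And>\<sigma>. \<sigma> \<in> ball 0 1 \<Longrightarrow> isCont J \<sigma>"
    and P_bound: "\<exists>C\<ge>0. \<forall>\<sigma>. norm \<sigma> \<le> 1 \<longrightarrow> norm (P \<sigma>) \<le> C * norm \<sigma>"
    and P_invariant: "\<And>\<sigma>. \<sigma> \<in> ball 0 1 \<Longrightarrow> J \<sigma> *v diag_mult lam \<sigma> = f (P \<sigma>)"
    and J0_eigen: "\<And>s. A *v (J 0 *v s) = J 0 *v diag_mult lam s"
    and J0_inj: "inj ((*v) (J 0))"
    and J0_range: "range ((*v) (J 0)) = unstable_subspace A"
begin

lemma P_0 [simp]: "P 0 = 0"
proof -
  obtain C where "\<And>\<sigma>. norm \<sigma> \<le> 1 \<Longrightarrow> norm (P \<sigma>) \<le> C * norm \<sigma>" using P_bound by blast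
  from this[of 0] show ?thesis by simp
qed

lemma f_0: "f 0 = 0"
  by (simp add: f_eq N_0)

lemma f_has_derivative: "(f has_derivative ((*v) A)) (at 0)"
  unfolding has_derivative_at_alt
proof (intro conjI allI impI)
  show "bounded_linear ((*v) A)" by simp
  fix e :: real assume "e > 0"
  then obtain r where r: "r > 0" "\<And>v w. v \<in> ball 0 r \<Longrightarrow> w \<in> ball 0 r \<Longrightarrow> norm (N v - N w) \<le> e * norm (v - w)"
    using N_small by blast
  show "\<exists>d>0. \<forall>y. norm (y - 0) < d \<longrightarrow> norm (f y - f 0 - A *v (y - 0)) \<le> e * norm (y - 0)"
    using r(1) r(2)[of _ 0] by (intro exI[of _ r]) (auto simp: f_eq N_0)
qed

text \<open>Local Lipschitz constants combine to a global one on a compact set even if it is not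
  convex, such as an orbit or the image of a ball. The time set \<open>{0}\<close> is a dummy that
  adapts \<open>f\<close> to \<open>local_lipschitz\<close>.\<close>

lemma f_lipschitz_compact:
  assumes "compact K" "K \<subseteq> U"
  obtains L where "\<And>x y. x \<in> K \<Longrightarrow> y \<in> K \<Longrightarrow> norm (f x - f y) \<le> L * norm (x - y)"
proof -
  have "local_lipschitz {0::real} K (\<lambda>_. f)"
    unfolding local_lipschitz_def
  proof (intro ballI)
    fix x assume "x \<in> K"
    then obtain r L where r: "r > 0" "L-lipschitz_on (ball x r) N" using N_lipschitz assms(2) by blast
    obtain B where B: "\<And>v. norm (A *v v) \<le> norm v * B" "B \<ge> 0"
      using bounded_linear.nonneg_bounded[OF matrix_vector_mul_bounded_linear[of A]] by metis
    have "B-lipschitz_on (ball x r) ((*v) A)"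
      by (rule lipschitz_onI) (auto simp: dist_norm B mult.commute[of B] simp flip: matrix_vector_mult_diff_distrib)
    from lipschitz_on_add[OF this r(2)] have "(B + L)-lipschitz_on (ball x r) f"
      by (simp add: f_eq[abs_def])
    then have "(B + L)-lipschitz_on (cball x (r/2) \<inter> K) f"
      by (rule lipschitz_on_subset) (use r in auto)
    then show "\<exists>u>0. \<exists>L. \<forall>t\<in>cball t u \<inter> {0}. L-lipschitz_on (cball x u \<inter> K) f" for t :: real
      using r by (intro exI[of _ "r/2"]) auto
  qed
  then obtain L where "\<And>t. t \<in> {0::real} \<Longrightarrow> L-lipschitz_on K f"
    using local_lipschitz_compact_implies_lipschitz[of "{0::real}" K "\<lambda>_. f"] assms(1) by auto
  then show ?thesis using that by (auto simp: lipschitz_on_def dist_norm)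
qed

text \<open>Gronwall estimates in both time directions propagate agreement from either end.
  Derivatives are demanded inside the interval alone, so an end point may correspond to a point of
  the sphere.\<close>

lemma solutions_unique:
  assumes st: "s \<le> t" and u: "continuous_on {s..t} u" and v: "continuous_on {s..t} v"
    and u': "\<And>x. s < x \<Longrightarrow> x < t \<Longrightarrow> (u has_vector_derivative f (u x)) (at x)"
    and v': "\<And>x. s < x \<Longrightarrow> x < t \<Longrightarrow> (v has_vector_derivative f (v x)) (at x)"
    and uU: "u ` {s..t} \<subseteq> U" and vU: "v ` {s..t} \<subseteq> U"
  shows "u s = v s \<longleftrightarrow> u t = v t"
proof -
  have "compact (u ` {s..t} \<union> v ` {s..t})" by (intro compact_Un compact_continuous_image u v) auto
  then obtain L where L: "\<And>x y. x \<in> u ` {s..t} \<union> v ` {s..t} \<Longrightarrow> y \<in> u ` {s..t} \<union> v ` {s..t} \<Longrightarrow>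
      norm (f x - f y) \<le> L * norm (x - y)"
    using f_lipschitz_compact uU vU by (metis Un_least)
  have cont: "continuous_on {s..t} (\<lambda>x. u x - v x)" by (intro continuous_intros u v)
  have D: "((\<lambda>x. u x - v x) has_vector_derivative f (u x) - f (v x)) (at x)" if "s < x" "x < t" for x
    by (intro has_vector_derivative_diff u' v' that)
  have B: "norm (f (u x) - f (v x)) \<le> L * norm (u x - v x)" if "s < x" "x < t" for x
    using that by (intro L) auto
  show ?thesis
    using differential_inequality_backward[OF st cont D B] differential_inequality_forward[OF st cont D B] by auto
qed

abbreviation flow :: "real \<Rightarrow> complex^'d \<Rightarrow> complex^'d" where
  "flow \<equiv> diag_flow lam"

lemma P_flow_solution:
  assumes "flow (t - c) \<sigma> \<in> ball 0 1"
  shows "((\<lambda>t. P (flow (t - c) \<sigma>)) has_vector_derivative f (P (flow (t - c) \<sigma>))) (at t)"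
proof -
  have "((\<lambda>t. t - c) has_vector_derivative 1) (at t)" by (auto intro!: derivative_eq_intros)
  from vector_diff_chain_at[OF this has_vector_derivative_diag_flow]
  have "((\<lambda>t. flow (t - c) \<sigma>) has_derivative
      (\<lambda>h. h *\<^sub>R diag_mult lam (flow (t - c) \<sigma>))) (at t)"
    by (simp add: o_def has_vector_derivative_def)
  from diff_chain_at[OF this P_deriv[OF assms]] show ?thesis
    by (simp add: o_def has_vector_derivative_def matrix_vector_scaleR P_invariant[OF assms])
qed

lemma continuous_on_P_flow:
  assumes "\<And>t. t \<in> S \<Longrightarrow> norm (flow (t - c) \<sigma>) \<le> 1"
  shows "continuous_on S (\<lambda>t. P (flow (t - c) \<sigma>))"
proof (rule continuous_on_compose2[OF P_cont])
  show "continuous_on S (\<lambda>t. flow (t - c) \<sigma>)"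
    by (rule continuous_on_compose2[OF continuous_on_diag_flow[of UNIV]]) (auto intro!: continuous_intros)
qed (use assms in auto)

section \<open>Contraction of the linear flow backward in time\<close>

definition rate :: real where "rate = Min (range (\<lambda>i. Re (lam $ i)))"

lemma rate_pos: "rate > 0" and rate_le: "rate \<le> Re (lam $ i)"
  using lam_pos by (auto simp: rate_def)

lemma norm_flow_le: "t \<le> 0 \<Longrightarrow> norm (flow t \<sigma>) \<le> exp (rate * t) * norm \<sigma>"
  by (rule norm_diag_flow_le[OF rate_le])

lemma norm_flow_le_exp: "t \<le> 0 \<Longrightarrow> norm \<sigma> \<le> 1 \<Longrightarrow> norm (flow t \<sigma>) \<le> exp (rate * t)"
  by (rule order_trans[OF norm_flow_le mult_left_le]) auto

lemma norm_flow_le_norm: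
  assumes "t \<le> 0" shows "norm (flow t \<sigma>) \<le> norm \<sigma>"
proof -
  have "exp (rate * t) \<le> 1" using rate_pos assms by (simp add: mult_nonneg_nonpos)
  then have "exp (rate * t) * norm \<sigma> \<le> 1 * norm \<sigma>" by (intro mult_right_mono) auto
  then show ?thesis using norm_flow_le[OF assms, of \<sigma>] by simp
qed

lemma flow_in_ball:
  assumes "t < 0" "norm \<sigma> \<le> 1" shows "flow t \<sigma> \<in> ball 0 1"
proof -
  have "exp (rate * t) < 1" using rate_pos assms by (simp add: mult_pos_neg)
  moreover have "exp (rate * t) * norm \<sigma> \<le> exp (rate * t) * 1" using assms by (intro mult_left_mono) auto
  ultimately have "norm (flow t \<sigma>) < 1"
    using norm_flow_le[OF less_imp_le[OF assms(1)], of \<sigma>] by linarith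
  then show ?thesis by simp
qed

lemma flow_in_ball': "t \<le> 0 \<Longrightarrow> \<sigma> \<in> ball 0 1 \<Longrightarrow> flow t \<sigma> \<in> ball 0 1"
  using norm_flow_le_norm[of t \<sigma>] by simp

text \<open>Subtracting the injective linear map \<open>J 0\<close> leaves a map with small
  Lipschitz constant on a small convex ball, since \<open>J\<close> is continuous at
  \<open>0\<close>.\<close>

lemma P_bilipschitz_near_0:
  obtains r c where "r > 0" "c > 0"
    "\<And>\<sigma> \<tau>. \<sigma> \<in> ball 0 r \<Longrightarrow> \<tau> \<in> ball 0 r \<Longrightarrow> c * norm (\<sigma> - \<tau>) \<le> norm (P \<sigma> - P \<tau>)"
proof -
  obtain B where B: "B ** J 0 = mat 1" using J0_inj matrix_left_invertible_injective by (metis injI inj_def)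
  obtain b where b: "b > 0" "\<And>x. norm (B *v x) \<le> norm x * b"
    using bounded_linear.pos_bounded[OF matrix_vector_mul_bounded_linear[of B]] by blast
  have J0: "norm h \<le> norm (J 0 *v h) * b" for h
    using b(2)[of "J 0 *v h"] by (simp add: matrix_vector_mul_assoc B)
  define K where "K = real CARD('m) * real CARD('d)"
  have K: "K > 0" by (simp add: K_def)
  \<comment> \<open>\<open>J 0\<close> stretches every vector by at least \<open>2 * e\<close>, of
    which the nonlinear remainder may consume half.\<close>
  define e where "e = 1 / (2 * b)"
  have e: "e > 0" using b by (simp add: e_def)
  have "e / K > 0" using e K by simp
  moreover have "isCont J 0" by (rule J_cont) simp
  ultimately obtain r0 where r0: "r0 > 0" "\<And>\<sigma>. dist \<sigma> 0 < r0 \<Longrightarrow> dist (J \<sigma>) (J 0) < e / K"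
    unfolding continuous_at_eps_delta by blast
  define r where "r = min r0 1"
  have r: "r > 0" "r \<le> 1" using r0 by (auto simp: r_def)
  have close: "norm ((P \<sigma> - J 0 *v \<sigma>) - (P \<tau> - J 0 *v \<tau>)) \<le> e * norm (\<sigma> - \<tau>)"
    if "\<sigma> \<in> ball 0 r" "\<tau> \<in> ball 0 r" for \<sigma> \<tau>
  proof (rule differentiable_bound[OF convex_ball _ _ that])
    fix x :: "complex^'d" assume x: "x \<in> ball 0 r"
    show "((\<lambda>\<sigma>. P \<sigma> - J 0 *v \<sigma>) has_derivative (\<lambda>h. J x *v h - J 0 *v h)) (at x within ball 0 r)"
      using x r by (intro has_derivative_diff has_derivative_at_withinI[OF P_deriv]
          bounded_linear_imp_has_derivative matrix_vector_mul_bounded_linear) auto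
    show "onorm (\<lambda>h. J x *v h - J 0 *v h) \<le> e"
    proof (rule onorm_bound)
      fix h :: "complex^'d"
      have "dist (J x) (J 0) < e / K" using x by (intro r0) (auto simp: r_def)
      then have "K * norm (J x - J 0) \<le> K * (e / K)" using K by (intro mult_left_mono) (auto simp: dist_norm)
      then have "K * norm (J x - J 0) * norm h \<le> e * norm h" using K by (intro mult_right_mono) auto
      then show "norm (J x *v h - J 0 *v h) \<le> e * norm h"
        using norm_matrix_vector_le[of "J x - J 0" h] by (simp add: K_def matrix_vector_mult_diff_rdistrib)
    qed (use e in simp)
  qed
  have "e * norm (\<sigma> - \<tau>) \<le> norm (P \<sigma> - P \<tau>)" if "\<sigma> \<in> ball 0 r" "\<tau> \<in> ball 0 r" for \<sigma> \<tau>
  proof -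
    have "norm (J 0 *v (\<sigma> - \<tau>)) \<le> norm (P \<sigma> - P \<tau>) + norm ((P \<sigma> - J 0 *v \<sigma>) - (P \<tau> - J 0 *v \<tau>))"
      using norm_triangle_ineq4[of "P \<sigma> - P \<tau>" "(P \<sigma> - J 0 *v \<sigma>) - (P \<tau> - J 0 *v \<tau>)"]
      by (simp add: matrix_vector_mult_diff_distrib)
    moreover have "2 * e * norm (\<sigma> - \<tau>) \<le> norm (J 0 *v (\<sigma> - \<tau>))"
      using J0[of "\<sigma> - \<tau>"] b(1) by (simp add: e_def field_simps)
    ultimately show ?thesis using close[OF that] by linarith
  qed
  then show ?thesis using that r(1) e by blast
qed

text \<open>The bound near \<open>0\<close> is transported by the flow: after a time
  \<open>T\<close> backward both orbits are in the small ball, Gronwall limits the growth of their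
  distance by \<open>exp (L * T)\<close>, and the linear flow back to time \<open>0\<close>
  stretches by at most \<open>M\<close>. The constant \<open>L\<close> comes from compactness of the
  image of \<open>cball 0 \<rho>\<close> inside \<open>U\<close>, whence \<rho> < 1.\<close>

lemma P_bilipschitz:
  assumes \<rho>: "\<rho> < 1"
  obtains c where "c > 0" "\<And>\<sigma> \<tau>. \<sigma> \<in> cball 0 \<rho> \<Longrightarrow> \<tau> \<in> cball 0 \<rho> \<Longrightarrow> c * norm (\<sigma> - \<tau>) \<le> norm (P \<sigma> - P \<tau>)"
proof -
  obtain r c where r: "r > 0" and c: "c > 0"
    "\<And>\<sigma> \<tau>. \<sigma> \<in> ball 0 r \<Longrightarrow> \<tau> \<in> ball 0 r \<Longrightarrow> c * norm (\<sigma> - \<tau>) \<le> norm (P \<sigma> - P \<tau>)"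
    using P_bilipschitz_near_0 by metis
  \<comment> \<open>Then \<open>exp (- rate * T) \<le> r / 2\<close>; the maximum keeps
    \<open>T\<close> nonnegative when \<open>r\<close> is large.\<close>
  define T where "T = max 0 (ln (2 / r) / rate)"
  have T: "T \<ge> 0" by (simp add: T_def)
  have "ln (2 / r) \<le> rate * T" using rate_pos by (simp add: T_def max_def field_simps)
  then have "2 / r \<le> exp (rate * T)" using r by (metis divide_pos_pos exp_le_cancel_iff exp_ln zero_less_numeral)
  then have "exp (rate * (- T)) < r" using r by (simp add: exp_minus field_simps)
  then have near: "flow (- T) \<sigma> \<in> ball 0 r" if "norm \<sigma> \<le> 1" for \<sigma>
    using le_less_trans[OF norm_flow_le_exp[OF _ that]] T by simp
  define M where "M = exp (norm lam * T)"
  have M: "norm \<sigma> \<le> M * norm (flow (- T) \<sigma>)" for \<sigma>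
    using norm_diag_flow_le'[of lam T "flow (- T) \<sigma>"] T by (simp add: M_def)
  have sub: "cball (0 :: complex^'d) \<rho> \<subseteq> ball 0 1" using \<rho> by auto
  have "compact (P ` cball 0 \<rho>)"
    using \<rho> by (intro compact_continuous_image continuous_on_subset[OF P_cont]) auto
  moreover have "P ` cball 0 \<rho> \<subseteq> U" using P_U sub by blast
  ultimately obtain L where L: "\<And>x y. x \<in> P ` cball 0 \<rho> \<Longrightarrow> y \<in> P ` cball 0 \<rho> \<Longrightarrow> norm (f x - f y) \<le> L * norm (x - y)"
    using f_lipschitz_compact by metis
  have "c / (M * exp (L * T)) * norm (\<sigma> - \<tau>) \<le> norm (P \<sigma> - P \<tau>)"
    if \<sigma>: "\<sigma> \<in> cball 0 \<rho>" and \<tau>: "\<tau> \<in> cball 0 \<rho>" for \<sigma> \<tau>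
  proof -
    define d where "d t = P (flow (t - 0) \<sigma>) - P (flow (t - 0) \<tau>)" for t
    have small: "norm (flow t \<sigma>) \<le> \<rho>" "norm (flow t \<tau>) \<le> \<rho>" if "t \<le> 0" for t
      using norm_flow_le_norm[OF that, of \<sigma>] norm_flow_le_norm[OF that, of \<tau>] \<sigma> \<tau> by auto
    have "norm (d (- T)) \<le> exp (L * (0 - - T)) * norm (d 0)"
    proof (rule differential_inequality_backward)
      show "continuous_on {- T..0} d"
        unfolding d_def using small \<rho> by (intro continuous_on_diff continuous_on_P_flow) fastforce+
      show "(d has_vector_derivative f (P (flow (x - 0) \<sigma>)) - f (P (flow (x - 0) \<tau>))) (at x)"
        if "- T < x" "x < 0" for x
        unfolding d_def using small[of x] that \<rho> by (intro has_vector_derivative_diff P_flow_solution) auto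
      show "norm (f (P (flow (x - 0) \<sigma>)) - f (P (flow (x - 0) \<tau>))) \<le> L * norm (d x)"
        if "- T < x" "x < 0" for x
        unfolding d_def using small[of x] that by (intro L) auto
    qed (use T in simp)
    then have 1: "norm (d (- T)) \<le> exp (L * T) * norm (P \<sigma> - P \<tau>)" by (simp add: d_def)
    define X where "X = norm (flow (- T) \<sigma> - flow (- T) \<tau>)"
    have "M > 0" by (simp add: M_def)
    have "norm (\<sigma> - \<tau>) \<le> M * X"
      using M[of "\<sigma> - \<tau>"] by (simp add: diag_flow_diff X_def)
    then have "c * norm (\<sigma> - \<tau>) \<le> c * (M * X)" using c(1) by (intro mult_left_mono) auto
    also have "\<dots> = M * (c * X)" by simp
    also have "\<dots> \<le> M * norm (d (- T))"
      using c(2)[OF near near] \<sigma> \<tau> \<rho> \<open>M > 0\<close> by (intro mult_left_mono) (auto simp: d_def X_def)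
    also have "\<dots> \<le> M * (exp (L * T) * norm (P \<sigma> - P \<tau>))"
      using 1 \<open>M > 0\<close> by (intro mult_left_mono) auto
    finally show ?thesis using \<open>M > 0\<close> by (simp add: field_simps)
  qed
  moreover have "c / (M * exp (L * T)) > 0" using c by (simp add: M_def)
  ultimately show ?thesis using that by blast
qed

text \<open>Along a direction in the kernel of the Jacobian the increments of \<open>P\<close> would
  be smaller than the lower Lipschitz bound allows.\<close>

lemma J_inj:
  assumes "\<sigma> \<in> ball 0 1"
  shows "inj ((*v) (J \<sigma>))"
proof -
  have "h = 0" if h: "J \<sigma> *v h = 0" for h
  proof -
    define \<rho> where "\<rho> = (1 + norm \<sigma>) / 2"
    have \<rho>: "norm \<sigma> < \<rho>" "\<rho> < 1" using assms by (auto simp: \<rho>_def)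
    obtain c where c: "c > 0" "\<And>\<sigma> \<tau>. \<sigma> \<in> cball 0 \<rho> \<Longrightarrow> \<tau> \<in> cball 0 \<rho> \<Longrightarrow> c * norm (\<sigma> - \<tau>) \<le> norm (P \<sigma> - P \<tau>)"
      using P_bilipschitz[OF \<rho>(2)] by metis
    have "c / 2 > 0" using c by simp
    then obtain d where d: "d > 0" "\<And>y. norm (y - \<sigma>) < d \<Longrightarrow> norm (P y - P \<sigma> - J \<sigma> *v (y - \<sigma>)) \<le> c / 2 * norm (y - \<sigma>)"
      using P_deriv[OF assms] unfolding has_derivative_at_alt by meson
    define e where "e = min d (\<rho> - norm \<sigma>) / (2 * (norm h + 1))"
    have n: "norm h + 1 > 0" by (simp add: add_nonneg_pos)
    have e: "e > 0" using d \<rho> n by (simp add: e_def)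
    have eh: "norm (e *\<^sub>R h) < min d (\<rho> - norm \<sigma>)"
    proof -
      have "norm (e *\<^sub>R h) = e * norm h" using e by simp
      also have "\<dots> < e * (2 * (norm h + 1))"
      proof (rule mult_strict_left_mono[OF _ e])
        show "norm h < 2 * (norm h + 1)" using n by (smt (verit))
      qed
      also have "\<dots> = min d (\<rho> - norm \<sigma>)" using n by (simp add: e_def)
      finally show ?thesis .
    qed
    have "norm (P (\<sigma> + e *\<^sub>R h) - P \<sigma>) \<le> c / 2 * norm (e *\<^sub>R h)"
      using d(2)[of "\<sigma> + e *\<^sub>R h"] eh h by (simp add: matrix_vector_scaleR)
    moreover have "c * norm (e *\<^sub>R h) \<le> norm (P (\<sigma> + e *\<^sub>R h) - P \<sigma>)"
      using c(2)[of "\<sigma> + e *\<^sub>R h" \<sigma>] eh \<rho> norm_triangle_ineq[of \<sigma> "e *\<^sub>R h"] by simp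
    ultimately have "c * norm (e *\<^sub>R h) \<le> 0" by linarith
    then show "h = 0" using c e by (simp add: mult_le_0_iff)
  qed
  then show ?thesis by (simp add: vec.inj_iff_eq_0)
qed

lemma P_inj_on: "inj_on P (ball 0 1)"
proof (rule inj_onI)
  fix \<sigma> \<tau> assume st: "\<sigma> \<in> ball 0 1" "\<tau> \<in> ball 0 1" "P \<sigma> = P \<tau>"
  then have "max (norm \<sigma>) (norm \<tau>) < 1" by simp
  then obtain c where c: "c > 0" "\<And>\<sigma>' \<tau>'. \<sigma>' \<in> cball 0 (max (norm \<sigma>) (norm \<tau>)) \<Longrightarrow>
      \<tau>' \<in> cball 0 (max (norm \<sigma>) (norm \<tau>)) \<Longrightarrow> c * norm (\<sigma>' - \<tau>') \<le> norm (P \<sigma>' - P \<tau>')"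
    using P_bilipschitz by metis
  from c(2)[of \<sigma> \<tau>] c(1) st show "\<sigma> = \<tau>" by (simp add: mult_le_0_iff)
qed

text \<open>Uniqueness moves the coincidence one unit of time back, where both points lie in the
  open ball and \<open>P\<close> is injective; the linear flow is invertible. A point \<tau> of the
  sphere is admissible because \<open>P \<tau> = P \<sigma>\<close> lies in
  \<open>U\<close>.\<close>

lemma P_eq_closed_ball:
  assumes \<sigma>: "\<sigma> \<in> ball 0 1" and \<tau>: "\<tau> \<in> cball 0 1" and eq: "P \<sigma> = P \<tau>"
  shows "\<sigma> = \<tau>"
proof -
  have in_ball: "flow (t - 0) \<sigma> \<in> ball 0 1 \<and> flow (t - 0) \<tau> \<in> ball 0 1" if "t < 0" for t
    using flow_in_ball[OF that] \<sigma> \<tau> by simp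
  have "P (flow (- 1 - 0) \<sigma>) = P (flow (- 1 - 0) \<tau>) \<longleftrightarrow>
      P (flow (0 - 0) \<sigma>) = P (flow (0 - 0) \<tau>)"
  proof (rule solutions_unique[where u = "\<lambda>t. P (flow (t - 0) \<sigma>)"
        and v = "\<lambda>t. P (flow (t - 0) \<tau>)"])
    show "continuous_on {- 1..0} (\<lambda>t. P (flow (t - 0) \<sigma>))"
      "continuous_on {- 1..0} (\<lambda>t. P (flow (t - 0) \<tau>))"
      using norm_flow_le_norm[of _ \<sigma>] norm_flow_le_norm[of _ \<tau>] \<sigma> \<tau>
      by (intro continuous_on_P_flow; fastforce)+
    have PU: "P (flow (t - 0) \<sigma>) \<in> U \<and> P (flow (t - 0) \<tau>) \<in> U" if "t \<le> 0" for t
    proof (cases "t = 0")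
      case True
      moreover have "P \<sigma> \<in> U" using P_U \<sigma> by blast
      ultimately show ?thesis using eq by simp
    next
      case False
      then show ?thesis using in_ball[of t] that P_U by auto
    qed
    then show "(\<lambda>t. P (flow (t - 0) \<sigma>)) ` {- 1..0} \<subseteq> U"
      "(\<lambda>t. P (flow (t - 0) \<tau>)) ` {- 1..0} \<subseteq> U" by auto
    show "((\<lambda>t. P (flow (t - 0) \<sigma>)) has_vector_derivative f (P (flow (x - 0) \<sigma>))) (at x)"
      "((\<lambda>t. P (flow (t - 0) \<tau>)) has_vector_derivative f (P (flow (x - 0) \<tau>))) (at x)"
      if "x < 0" for x
      by (rule P_flow_solution[OF conjunct1[OF in_ball[OF that]]],
          rule P_flow_solution[OF conjunct2[OF in_ball[OF that]]])
  qed simp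
  then have "flow (- 1) \<sigma> = flow (- 1) \<tau>"
    using eq in_ball[of "- 1"] P_inj_on by (auto dest: inj_onD)
  then have "flow 1 (flow (- 1) \<sigma>) = flow 1 (flow (- 1) \<tau>)" by simp
  then show ?thesis by simp
qed

text \<open>\<open>P\<close> is a closed map onto its image: no point of the sphere shares its image
  with an interior point, so the image of a relatively closed set is the trace of a compact
  one.\<close>

lemma P_homeomorphism:
  obtains \<psi> where "homeomorphism (ball 0 1) (P ` ball 0 1) P \<psi>"
proof (rule homeomorphism_injective_closed_map[of "ball 0 1" P "P ` ball 0 1"])
  show "continuous_on (ball 0 1) P" by (rule continuous_on_subset[OF P_cont]) auto
  fix C assume "closedin (top_of_set (ball (0 :: complex^'d) 1)) C"
  then obtain D where D: "closed D" "C = ball 0 1 \<inter> D" by (auto simp: closedin_closed)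
  have "P ` C = P ` ball 0 1 \<inter> P ` (cball 0 1 \<inter> D)"
  proof
    show "P ` C \<subseteq> P ` ball 0 1 \<inter> P ` (cball 0 1 \<inter> D)" unfolding D by auto
    show "P ` ball 0 1 \<inter> P ` (cball 0 1 \<inter> D) \<subseteq> P ` C"
    proof
      fix w assume "w \<in> P ` ball 0 1 \<inter> P ` (cball 0 1 \<inter> D)"
      then obtain \<sigma> \<tau> where "\<sigma> \<in> ball 0 1" "\<tau> \<in> cball 0 1 \<inter> D" "w = P \<sigma>" "w = P \<tau>" by blast
      then show "w \<in> P ` C" using P_eq_closed_ball[of \<sigma> \<tau>] D by auto
    qed
  qed
  moreover have "compact (P ` (cball 0 1 \<inter> D))"
    using D(1) by (intro compact_continuous_image continuous_on_subset[OF P_cont] compact_Int_closed) auto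
  ultimately show "closedin (top_of_set (P ` ball 0 1)) (P ` C)"
    by (auto simp: closedin_closed intro: compact_imp_closed)
qed (use P_inj_on that in auto)

lemma P_chart:
  assumes \<sigma>: "\<sigma> \<in> ball 0 1"
  shows "local_chart (P ` ball 0 1) (P \<sigma>) (ball (- \<sigma>) 1) (\<lambda>s. P (\<sigma> + s)) (\<lambda>s. J (\<sigma> + s))"
proof -
  obtain \<psi> where \<psi>: "homeomorphism (ball 0 1) (P ` ball 0 1) P \<psi>" using P_homeomorphism .
  have in_ball: "\<sigma> + s \<in> ball 0 1" if "s \<in> ball (- \<sigma>) 1" for s
    using that by (simp add: dist_norm norm_minus_commute)
  have "homeomorphism (ball (- \<sigma>) 1) (ball 0 1) (\<lambda>s. \<sigma> + s) (\<lambda>s. s - \<sigma>)"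
    using in_ball by (intro homeomorphismI) (auto intro!: continuous_intros simp: dist_norm norm_minus_commute)
  from homeomorphism_compose[OF this \<psi>]
  have "homeomorphism (ball (- \<sigma>) 1) (P ` ball 0 1 \<inter> UNIV) (\<lambda>s. P (\<sigma> + s)) ((\<lambda>s. s - \<sigma>) \<circ> \<psi>)"
    by (simp add: o_def)
  moreover have "((\<lambda>s. P (\<sigma> + s)) has_derivative ((*v) (J (\<sigma> + s)))) (at s)" if "s \<in> ball (- \<sigma>) 1" for s
  proof -
    have "((\<lambda>s. \<sigma> + s) has_derivative (\<lambda>h. h)) (at s)" by (auto intro!: derivative_eq_intros)
    from diff_chain_at[OF this P_deriv[OF in_ball[OF that]]] show ?thesis by (simp add: o_def)
  qed
  moreover have "continuous_on (ball 0 1) J" using J_cont by (intro continuous_at_imp_continuous_on) auto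
  then have "continuous_on (ball (- \<sigma>) 1) (\<lambda>s. J (\<sigma> + s))"
    by (rule continuous_on_compose2) (use in_ball in \<open>auto intro!: continuous_intros\<close>)
  ultimately show ?thesis
    unfolding local_chart_def using J_inj in_ball \<sigma> by (auto intro!: exI[of _ UNIV])
qed

section \<open>Comparison with the local unstable set\<close>

lemma param_subset_local_unstable_set:
  "P ` ball 0 1 \<subseteq> local_unstable_set f (U - P ` sphere 0 1)"
proof
  fix w assume "w \<in> P ` ball 0 1"
  then obtain \<sigma> where \<sigma>: "\<sigma> \<in> ball 0 1" "w = P \<sigma>" by blast
  define u where "u t = P (flow (t - 0) \<sigma>)" for t
  obtain C where C: "C \<ge> 0" "\<And>\<sigma>. norm \<sigma> \<le> 1 \<Longrightarrow> norm (P \<sigma>) \<le> C * norm \<sigma>" using P_bound by blast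
  have in_ball: "flow (t - 0) \<sigma> \<in> ball 0 1" if "t \<le> 0" for t
    using flow_in_ball'[OF that \<sigma>(1)] by simp
  have "u t \<in> U - P ` sphere 0 1" if "t \<le> 0" for t
  proof -
    have "u t \<in> U" unfolding u_def using P_U in_ball[OF that] by blast
    moreover have "u t \<noteq> P \<tau>" if \<tau>: "\<tau> \<in> sphere 0 1" for \<tau>
      using P_eq_closed_ball[OF in_ball[OF \<open>t \<le> 0\<close>], of \<tau>] in_ball[OF \<open>t \<le> 0\<close>] \<tau> by (auto simp: u_def)
    ultimately show ?thesis by blast
  qed
  moreover have "(u has_vector_derivative f (u t)) (at t within {..0})" if "t \<le> 0" for t
    unfolding u_def by (rule has_vector_derivative_at_within[OF P_flow_solution[OF in_ball[OF that]]])
  moreover have "norm (u t) \<le> C * exp (rate * t)" if "t \<le> 0" for t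
  proof -
    have "norm (u t) \<le> C * norm (flow (t - 0) \<sigma>)"
      unfolding u_def using in_ball[OF that] by (intro C) auto
    also have "\<dots> \<le> C * exp (rate * t)"
      using norm_flow_le_exp[OF that, of \<sigma>] \<sigma>(1) C(1) by (intro mult_left_mono) auto
    finally show ?thesis .
  qed
  then have "\<exists>C. \<exists>\<gamma>>0. \<forall>t\<le>0. norm (u t) \<le> C * exp (\<gamma> * t)" using rate_pos by blast
  moreover have "u 0 = w" by (simp add: u_def \<sigma>(2))
  ultimately show "w \<in> local_unstable_set f (U - P ` sphere 0 1)"
    unfolding local_unstable_set_def by blast
qed

text \<open>Far in the past \<open>u\<close> is compared with the orbit on the manifold having the same unstable
  component at time \<open>T\<close>. Along their difference \<open>d\<close> the weighted form \<open>exp (- 2 \<kappa> t) Q d d\<close> is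
  nonincreasing and tends to \<open>0\<close> as \<open>t \<rightarrow> - \<infinity>\<close>, so it is nonpositive at \<open>T\<close>, which forces
  \<open>d T = 0\<close>.\<close>

lemma backward_orbit_enters:
  assumes u': "\<And>t. t < 0 \<Longrightarrow> (u has_vector_derivative f (u t)) (at t)"
    and decay: "\<And>t. t \<le> 0 \<Longrightarrow> norm (u t) \<le> C * exp (\<gamma> * t)" and \<gamma>: "\<gamma> > 0"
  obtains T \<sigma> where "T < 0" "\<sigma> \<in> ball 0 1" "u T = P \<sigma>"
proof -
  obtain B where BJ: "B ** J 0 = mat 1"
    using J0_inj matrix_left_invertible_injective by (metis injI inj_def)
  \<comment> \<open>Both orbits then decay at least like \<open>exp (2 * \<kappa> * t)\<close>, so
    quadratic terms still tend to \<open>0\<close> after multiplication by the weight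
    \<open>exp (- (2 * \<kappa>) * t)\<close>; \<open>\<kappa> < rate\<close> is what the Lyapunov
    form requires.\<close>
  define \<kappa> where "\<kappa> = min \<gamma> rate / 2"
  have \<kappa>: "0 < \<kappa>" "\<kappa> < rate" "2 * \<kappa> \<le> \<gamma>" "2 * \<kappa> \<le> rate" using \<gamma> rate_pos by (auto simp: \<kappa>_def)
  have \<kappa>_lam: "\<kappa> < Re (lam $ i)" for i using \<kappa>(2) rate_le[of i] by linarith
  obtain Q c where c: "c > 0" and Q: "bounded_bilinear Q" "\<And>x y. Q x y = Q y x"
    "\<And>x. Q x (A *v x) \<le> \<kappa> * Q x x - c * (norm x)\<^sup>2" "\<And>x. B *v x = 0 \<Longrightarrow> x \<noteq> 0 \<Longrightarrow> Q x x > (0 :: real)"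
    by (rule Lyapunov_form[OF BJ J0_eigen _ \<kappa>(1) \<kappa>_lam],
        erule (1) unstable_quotient[OF J0_eigen J0_range], rule that)
  obtain K where K: "K > 0" "\<And>x y. norm (Q x y) \<le> norm x * norm y * K"
    using bounded_bilinear.pos_bounded[OF Q(1)] by blast
  \<comment> \<open>With this Lipschitz constant the nonlinear part contributes at most
    \<open>c * (norm (v - w))\<^sup>2\<close>, which the strict decrease of the linear part
    absorbs.\<close>
  have "c / K > 0" using c K by simp
  then obtain r where r: "r > 0" "\<And>v w. v \<in> ball 0 r \<Longrightarrow> w \<in> ball 0 r \<Longrightarrow> norm (N v - N w) \<le> c / K * norm (v - w)"
    using N_small by blast
  have Q_f: "Q (v - w) (f v - f w) \<le> \<kappa> * Q (v - w) (v - w)" if "v \<in> ball 0 r" "w \<in> ball 0 r" for v w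
  proof -
    have "Q (v - w) (N v - N w) \<le> norm (v - w) * norm (N v - N w) * K"
      using K(2)[of "v - w" "N v - N w"] by simp
    also have "\<dots> \<le> norm (v - w) * (c / K * norm (v - w)) * K"
      using K(1) by (intro mult_right_mono mult_left_mono r that) auto
    also have "\<dots> = c * (norm (v - w))\<^sup>2" using K by (simp add: power2_eq_square)
    finally have "Q (v - w) (N v - N w) \<le> c * (norm (v - w))\<^sup>2" .
    moreover have "f v - f w = A *v (v - w) + (N v - N w)"
      by (simp add: f_eq matrix_vector_mult_diff_distrib)
    then have "Q (v - w) (f v - f w) = Q (v - w) (A *v (v - w)) + Q (v - w) (N v - N w)"
      by (simp add: bounded_bilinear.add_right[OF Q(1)])
    ultimately show ?thesis using Q(3)[of "v - w"] by linarith
  qed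
  obtain M where M: "M \<ge> 0" "\<And>\<sigma>. norm \<sigma> \<le> 1 \<Longrightarrow> norm (P \<sigma>) \<le> M * norm \<sigma>" using P_bound by blast
  define s where "s = min 1 (r / (M + 1))"
  have s: "s > 0" "s \<le> 1" using r M by (auto simp: s_def)
  have Ps: "P \<sigma> \<in> ball 0 r" if "\<sigma> \<in> ball 0 s" for \<sigma>
  proof -
    have "norm (P \<sigma>) \<le> M * norm \<sigma>" using that s by (intro M) auto
    also have "\<dots> \<le> M * (r / (M + 1))" using that M by (intro mult_left_mono) (auto simp: s_def)
    also have "\<dots> < r" using r M by (simp add: field_simps)
    finally show ?thesis by simp
  qed
  have BJv: "B *v (J 0 *v h) = h" for h by (simp add: matrix_vector_mul_assoc BJ)
  \<comment> \<open>The unstable component of \<open>P\<close> has the identity as derivative at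
    \<open>0\<close>, so by an open mapping argument it attains every small value on
    \<open>ball 0 s\<close>; this supplies the orbit used for comparison.\<close>
  have "((\<lambda>\<sigma>. B *v P \<sigma>) has_derivative (\<lambda>h. h)) (at 0)"
    using bounded_linear.has_derivative[OF matrix_vector_mul_bounded_linear P_deriv[of 0], of B]
    by (simp add: BJv)
  moreover have "continuous_on (ball 0 1) (\<lambda>\<sigma>. B *v P \<sigma>)"
    by (intro bounded_linear.continuous_on[OF matrix_vector_mul_bounded_linear] continuous_on_subset[OF P_cont]) auto
  ultimately have "B *v P 0 \<in> interior ((\<lambda>\<sigma>. B *v P \<sigma>) ` ball 0 s)"
    using s by (intro sussmann_open_mapping[of "ball 0 1" _ 0 "\<lambda>h. h" "\<lambda>h. h"])
      (auto simp: fun_eq_iff interior_open)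
  then have "0 \<in> interior ((\<lambda>\<sigma>. B *v P \<sigma>) ` ball 0 s)" by simp
  then obtain e where e: "e > 0" "ball 0 e \<subseteq> (\<lambda>\<sigma>. B *v P \<sigma>) ` ball 0 s"
    unfolding mem_interior by blast
  obtain b where b: "b > 0" "\<And>x. norm (B *v x) \<le> norm x * b"
    using bounded_linear.pos_bounded[OF matrix_vector_mul_bounded_linear[of B]] by blast
  define C' where "C' = max C 1"
  have C': "C' > 0" by (simp add: C'_def)
  have decay': "norm (u t) \<le> C' * exp (\<gamma> * t)" if "t \<le> 0" for t
  proof -
    have "C * exp (\<gamma> * t) \<le> C' * exp (\<gamma> * t)" by (intro mult_right_mono) (auto simp: C'_def)
    then show ?thesis using decay[OF that] by linarith
  qed
  \<comment> \<open>The first bound keeps \<open>u\<close> where the Lyapunov estimate holds, the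
    second keeps its unstable component among the attained values.\<close>
  define q where "q = min r (e / b)"
  have q: "q > 0" using r e b by (simp add: q_def)
  define T where "T = min (- 1) (ln (q / (2 * C')) / \<gamma>)"
  have T: "T < 0" by (simp add: T_def)
  have small: "norm (u t) < q" if "t \<le> T" for t
  proof -
    have "t \<le> ln (q / (2 * C')) / \<gamma>" using that by (simp add: T_def)
    then have "\<gamma> * t \<le> ln (q / (2 * C'))" by (simp only: pos_le_divide_eq[OF \<gamma>] mult.commute[of t])
    then have "exp (\<gamma> * t) \<le> q / (2 * C')" using q C' by (metis divide_pos_pos exp_le_cancel_iff exp_ln mult_pos_pos zero_less_numeral)
    then have "C' * exp (\<gamma> * t) \<le> q / 2" using C' by (simp add: field_simps)
    then show ?thesis using decay'[of t] that T q by linarith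
  qed
  have "norm (B *v u T) \<le> norm (u T) * b" by (rule b)
  also have "\<dots> < q * b" using small[of T] b by (intro mult_strict_right_mono) auto
  also have "\<dots> \<le> e / b * b" using b by (intro mult_right_mono) (auto simp: q_def)
  finally have "B *v u T \<in> ball 0 e" using b by simp
  then obtain \<sigma> where \<sigma>: "\<sigma> \<in> ball 0 s" "B *v u T = B *v P \<sigma>" using e by blast
  define v where "v t = P (flow (t - T) \<sigma>)" for t
  define d where "d t = u t - v t" for t
  have flow_s: "flow (t - T) \<sigma> \<in> ball 0 s" if "t \<le> T" for t
    using norm_flow_le_norm[of "t - T" \<sigma>] \<sigma>(1) that by simp
  define \<phi> where "\<phi> t = exp (- (2 * \<kappa>) * t) * Q (d t) (d t)" for t
  have D: "DERIV \<phi> t :> exp (- (2 * \<kappa>) * t) * (2 * Q (d t) (f (u t) - f (v t)) - 2 * \<kappa> * Q (d t) (d t))"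
    if t: "t \<le> T" for t
  proof -
    have "flow (t - T) \<sigma> \<in> ball 0 1" using flow_s[OF t] s by auto
    then have "(d has_vector_derivative f (u t) - f (v t)) (at t)"
      unfolding d_def v_def using t T by (intro has_vector_derivative_diff u' P_flow_solution) auto
    then have dd: "(d has_derivative (\<lambda>h. h *\<^sub>R (f (u t) - f (v t)))) (at t)"
      by (simp add: has_vector_derivative_def)
    have "(\<lambda>h. Q (d t) (h *\<^sub>R (f (u t) - f (v t))) + Q (h *\<^sub>R (f (u t) - f (v t))) (d t))
        = (*) (2 * Q (d t) (f (u t) - f (v t)))"
      by (simp add: fun_eq_iff bounded_bilinear.scaleR_left[OF Q(1)] bounded_bilinear.scaleR_right[OF Q(1)]
          Q(2)[of _ "d t"])
    then have "DERIV (\<lambda>t. Q (d t) (d t)) t :> 2 * Q (d t) (f (u t) - f (v t))"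
      using bounded_bilinear.FDERIV[OF Q(1) dd dd] by (simp only: has_field_derivative_def)
    then show ?thesis unfolding \<phi>_def
      by (auto intro!: derivative_eq_intros simp: algebra_simps)
  qed
  have \<phi>_mono: "\<phi> T \<le> \<phi> t" if "t \<le> T" for t
  proof (rule DERIV_nonpos_imp_nonincreasing[OF that])
    fix x assume x: "t \<le> x" "x \<le> T"
    have "u x \<in> ball 0 r" using small[OF x(2)] by (simp add: q_def)
    then have "Q (d x) (f (u x) - f (v x)) \<le> \<kappa> * Q (d x) (d x)"
      unfolding d_def using Ps[OF flow_s[OF x(2)]] by (intro Q_f) (auto simp: v_def)
    then show "\<exists>y. DERIV \<phi> x :> y \<and> y \<le> 0"
      using D[OF x(2)] by (intro exI conjI) (auto simp: mult_le_0_iff)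
  qed
  define E where "E = C' + M * exp (- (rate * T))"
  have d_le: "norm (d t) \<le> E * exp (2 * \<kappa> * t)" if t: "t \<le> T" for t
  proof -
    have t0: "t \<le> 0" using t T by simp
    have "norm (u t) \<le> C' * exp (\<gamma> * t)" by (rule decay'[OF t0])
    also have "\<dots> \<le> C' * exp (2 * \<kappa> * t)"
      using \<kappa>(3) t0 C' by (intro mult_left_mono) (auto intro: mult_right_mono_neg)
    finally have 1: "norm (u t) \<le> C' * exp (2 * \<kappa> * t)" .
    have "norm (v t) \<le> M * norm (flow (t - T) \<sigma>)"
      unfolding v_def using flow_s[OF t] s by (intro M) auto
    also have "\<dots> \<le> M * exp (rate * (t - T))"
      using norm_flow_le_exp[of "t - T" \<sigma>] t \<sigma>(1) s M(1) by (intro mult_left_mono) auto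
    also have "\<dots> = M * exp (- (rate * T)) * exp (rate * t)"
      by (simp add: algebra_simps flip: exp_add)
    also have "\<dots> \<le> M * exp (- (rate * T)) * exp (2 * \<kappa> * t)"
      using \<kappa>(4) t0 M(1) by (intro mult_left_mono) (auto intro: mult_right_mono_neg)
    finally have 2: "norm (v t) \<le> M * exp (- (rate * T)) * exp (2 * \<kappa> * t)" .
    have "norm (d t) \<le> norm (u t) + norm (v t)" unfolding d_def by (rule norm_triangle_ineq4)
    with 1 2 show ?thesis by (simp add: E_def distrib_right)
  qed
  have "\<phi> t \<le> K * E\<^sup>2 * exp (2 * \<kappa> * t)" if t: "t \<le> T" for t
  proof -
    have "Q (d t) (d t) \<le> norm (d t) * norm (d t) * K" using K(2)[of "d t" "d t"] by simp
    also have "\<dots> \<le> (E * exp (2 * \<kappa> * t)) * (E * exp (2 * \<kappa> * t)) * K"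
      using d_le[OF t] K(1) order_trans[OF norm_ge_zero d_le[OF t]] by (intro mult_right_mono mult_mono) auto
    finally have "\<phi> t \<le> exp (- (2 * \<kappa>) * t) * ((E * exp (2 * \<kappa> * t)) * (E * exp (2 * \<kappa> * t)) * K)"
      unfolding \<phi>_def by (intro mult_left_mono) auto
    also have "\<dots> = K * E\<^sup>2 * exp (2 * \<kappa> * t) * (exp (- (2 * \<kappa>) * t) * exp (2 * \<kappa> * t))"
      by (simp add: power2_eq_square)
    also have "exp (- (2 * \<kappa>) * t) * exp (2 * \<kappa> * t) = 1" by (simp flip: exp_add)
    finally show ?thesis by simp
  qed
  then have bound: "\<phi> T \<le> K * E\<^sup>2 * exp (2 * \<kappa> * t)" if "t \<le> T" for t
    using \<phi>_mono[OF that] that order_trans by blast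
  have "((\<lambda>t. K * E\<^sup>2 * exp (2 * \<kappa> * t)) \<longlongrightarrow> 0) at_bot"
    using \<kappa>(1) by real_asymp
  then have "\<phi> T \<le> 0"
    by (rule tendsto_lowerbound) (use bound in \<open>auto simp: eventually_at_bot_linorder\<close>)
  then have "Q (d T) (d T) \<le> 0" by (simp add: \<phi>_def mult_le_0_iff)
  moreover have "B *v d T = 0" by (simp add: d_def v_def matrix_vector_mult_diff_distrib \<sigma>(2))
  ultimately have "d T = 0" using Q(4)[of "d T"] by fastforce
  then have "u T = P \<sigma>" by (simp add: d_def v_def)
  moreover have "\<sigma> \<in> ball 0 1" using \<sigma>(1) s by auto
  ultimately show ?thesis using that T by blast
qed

lemma local_unstable_set_subset_param:
  "local_unstable_set f (U - P ` sphere 0 1) \<subseteq> P ` ball 0 1"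
proof
  fix w assume "w \<in> local_unstable_set f (U - P ` sphere 0 1)"
  then obtain u C \<gamma> where u: "u 0 = w" "\<And>t. t \<le> 0 \<Longrightarrow> u t \<in> U - P ` sphere 0 1"
    "\<And>t. t \<le> 0 \<Longrightarrow> (u has_vector_derivative f (u t)) (at t within {..0})"
    and decay: "\<gamma> > 0" "\<And>t. t \<le> 0 \<Longrightarrow> norm (u t) \<le> C * exp (\<gamma> * t)"
    unfolding local_unstable_set_def by blast
  have u': "(u has_vector_derivative f (u t)) (at t)" if "t < 0" for t
    using u(3)[of t] that at_within_interior[of t "{..0}"] by simp
  have u_cont: "continuous_on {..0} u"
    by (rule continuous_on_vector_derivative) (use u(3) in auto)
  obtain T \<sigma> where T: "T < 0" and \<sigma>: "\<sigma> \<in> ball 0 1" "u T = P \<sigma>"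
    using backward_orbit_enters[OF u' decay(2,1)] by blast
  define v where "v t = P (flow (t - T) \<sigma>)" for t
  have uv: "u t = v t" if t: "T \<le> t" "t \<le> 0" and nt: "norm (flow (t - T) \<sigma>) < 1" for t
  proof -
    have in_ball: "flow (x - T) \<sigma> \<in> ball 0 1" if "x \<le> t" for x
      using flow_in_ball'[of "x - t" "flow (t - T) \<sigma>"] that nt by simp
    have "u T = v T \<longleftrightarrow> u t = v t"
    proof (rule solutions_unique[OF t(1)])
      show "continuous_on {T..t} u" by (rule continuous_on_subset[OF u_cont]) (use t in auto)
      show "continuous_on {T..t} v"
        unfolding v_def using in_ball by (intro continuous_on_P_flow) (auto intro: less_imp_le)
      show "(u has_vector_derivative f (u x)) (at x)" if "x < t" for x using u' that t by auto
      show "(v has_vector_derivative f (v x)) (at x)" if "x < t" for x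
        unfolding v_def using in_ball[of x] that by (intro P_flow_solution) auto
      show "u ` {T..t} \<subseteq> U" using u(2) t by auto
      show "v ` {T..t} \<subseteq> U" using in_ball P_U by (auto simp: v_def)
    qed
    then show ?thesis using \<sigma>(2) by (simp add: v_def)
  qed
  show "w \<in> P ` ball 0 1"
  proof (cases "norm (flow (0 - T) \<sigma>) < 1")
    case True
    then have "w = P (flow (0 - T) \<sigma>)" using uv[of 0] T u(1) by (simp add: v_def)
    then show ?thesis using True by auto
  next
    \<comment> \<open>The linear orbit has reached the sphere by time \<open>0\<close>; a crossing
      time \<open>t1\<close> would put \<open>u t1\<close> into the excluded image of the
      sphere.\<close>
    case False
    have "continuous_on {T..0} (\<lambda>t. norm (flow (t - T) \<sigma>))"
      by (intro continuous_on_norm continuous_on_compose2[OF continuous_on_diag_flow[of UNIV]])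
         (auto intro!: continuous_intros)
    moreover have "norm (flow (T - T) \<sigma>) \<le> 1" "1 \<le> norm (flow (0 - T) \<sigma>)"
      using False \<sigma>(1) by auto
    ultimately obtain t1 where t1: "T \<le> t1" "t1 \<le> 0" "norm (flow (t1 - T) \<sigma>) = 1"
      using IVT'[of "\<lambda>t. norm (flow (t - T) \<sigma>)" T 1 0] T by auto
    have "T \<noteq> t1" using t1(3) \<sigma>(1) by auto
    then have Tt1: "T < t1" using t1 by simp
    define \<tau> where "\<tau> = flow (t1 - T) \<sigma>"
    have before: "norm (flow (t - T) \<sigma>) < 1" if "t < t1" for t
      using flow_in_ball[of "t - t1" \<tau>] that t1(3) by (simp add: \<tau>_def)
    \<comment> \<open>Uniqueness works before \<open>t1\<close>, where \<open>v\<close> is known to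
      stay in \<open>U\<close>; continuity carries the agreement of \<open>u\<close> and
      \<open>v\<close> to \<open>t1\<close> itself.\<close>
    have cl: "closure {T..<t1} = {T..t1}" using Tt1 by simp
    have "continuous_on {T..t1} (\<lambda>t. u t - v t)"
    proof (intro continuous_on_diff)
      show "continuous_on {T..t1} u" by (rule continuous_on_subset[OF u_cont]) (use t1 in auto)
      have "norm (flow (t - T) \<sigma>) \<le> 1" if "t \<in> {T..t1}" for t
        using before[of t] t1(3) that by (cases "t = t1") auto
      then show "continuous_on {T..t1} v" unfolding v_def by (rule continuous_on_P_flow)
    qed
    then have "continuous_on (closure {T..<t1}) (\<lambda>t. u t - v t)" unfolding cl .
    moreover have "u t - v t = 0" if "t \<in> {T..<t1}" for t
      using uv[of t] before[of t] that t1(2) by simp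
    moreover have "t1 \<in> closure {T..<t1}" unfolding cl using Tt1 by simp
    ultimately have "u t1 - v t1 = 0" by (rule continuous_constant_on_closure)
    then have "u t1 = P \<tau>" by (simp add: v_def \<tau>_def)
    moreover have "\<tau> \<in> sphere 0 1" using t1(3) by (simp add: \<tau>_def)
    ultimately show ?thesis using u(2)[OF t1(2)] by auto
  qed
qed

theorem param_local_unstable_manifold:
  "local_unstable_manifold TYPE('d) f A U (P ` ball 0 1)"
  unfolding local_unstable_manifold_def
proof (intro conjI)
  show "f 0 = 0" by (rule f_0)
  show "(f has_derivative (*v) A) (at 0)" by (rule f_has_derivative)
  show "\<forall>w\<in>P ` ball 0 1. \<exists>(S :: (complex^'d) set) \<phi> J. local_chart (P ` ball 0 1) w S \<phi> J"
    using P_chart by blast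
  have "local_chart (P ` ball 0 1) 0 (ball (- 0) 1) (\<lambda>s. P (0 + s)) (\<lambda>s. J (0 + s))"
    using P_chart[of 0] by simp
  moreover have "range ((*v) (J (0 + 0))) = unstable_subspace A" using J0_range by simp
  ultimately show "\<exists>(S :: (complex^'d) set) \<phi> J. local_chart (P ` ball 0 1) 0 S \<phi> J \<and>
      range ((*v) (J 0)) = unstable_subspace A" by blast
  have "compact (P ` sphere 0 1)"
    by (intro compact_continuous_image continuous_on_subset[OF P_cont]) auto
  then have "open (U - P ` sphere 0 1)" using open_U by (intro open_Diff compact_imp_closed)
  moreover have "0 \<in> U - P ` sphere 0 1"
  proof -
    have "P 0 \<in> P ` ball 0 1" by (rule imageI) simp
    then have "P 0 \<in> U" using P_U by (rule rev_subsetD)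
    moreover have "P 0 \<noteq> P \<tau>" if "\<tau> \<in> sphere 0 1" for \<tau>
      using P_eq_closed_ball[of 0 \<tau>] that by auto
    ultimately show ?thesis by auto
  qed
  moreover have "P ` ball 0 1 = local_unstable_set f (U - P ` sphere 0 1)"
    using param_subset_local_unstable_set local_unstable_set_subset_param by (rule subset_antisym)
  ultimately show "\<exists>V. open V \<and> 0 \<in> V \<and> V \<subseteq> U \<and> P ` ball 0 1 = local_unstable_set f V"
    by blast
qed

end

section \<open>Identification of the coefficients\<close>

text \<open>Unless it vanishes, \<open>h\<close> factors near \<open>0\<close> as
  \<open>z ^ n * g z\<close> with \<open>g 0 \<noteq> 0\<close>, against flatness of order
  \<open>n + 1\<close>; \<open>h 0 = 0\<close> makes \<open>n\<close> positive, so that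
  \<open>flat\<close> covers it.\<close>

lemma holomorphic_flat_eq_0:
  fixes h :: "complex \<Rightarrow> complex"
  assumes h: "h holomorphic_on ball 0 1" and h0: "h 0 = 0"
    and flat: "\<And>k. k \<ge> 1 \<Longrightarrow> h \<in> O[at 0](\<lambda>z. z ^ Suc k)" and z: "z \<in> ball 0 1"
  shows "h z = 0"
proof (rule ccontr)
  assume nz: "h z \<noteq> 0"
  have "\<not> h constant_on ball 0 1"
  proof
    assume "h constant_on ball 0 1"
    then have "h z = h 0" using z unfolding constant_on_def by (metis centre_in_ball zero_less_one)
    then show False using h0 nz by simp
  qed
  then obtain g r n where n: "0 < n" and r: "0 < r" "ball 0 r \<subseteq> ball (0 :: complex) 1"
    and g: "g holomorphic_on ball 0 r" "\<And>w. w \<in> ball 0 r \<Longrightarrow> h w = (w - 0) ^ n * g w"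
      "\<And>w. w \<in> ball 0 r \<Longrightarrow> g w \<noteq> 0"
    using holomorphic_factor_zero_nonconstant[OF h open_ball connected_ball, of 0] h0
    by (metis centre_in_ball zero_less_one)
  obtain C where C: "eventually (\<lambda>w. norm (h w) \<le> C * norm (w ^ Suc n)) (at 0)"
    using flat[of n] n by (auto elim!: landau_o.bigE)
  have "isCont g 0"
    using holomorphic_on_imp_continuous_on[OF g(1)] r(1) by (simp add: continuous_on_eq_continuous_at)
  then have l: "((\<lambda>w. norm (g w)) \<longlongrightarrow> norm (g 0)) (at 0)"
    by (intro tendsto_norm) (simp add: isCont_def)
  have r': "((\<lambda>w. C * norm w) \<longlongrightarrow> C * norm (0 :: complex)) (at (0 :: complex))" by (intro tendsto_mult tendsto_add tendsto_power tendsto_norm tendsto_const tendsto_ident_at)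
  have "eventually (\<lambda>w. w \<in> ball 0 r) (at (0 :: complex))"
    using r(1) by (intro eventually_at_in_open') auto
  moreover have "eventually (\<lambda>w :: complex. w \<noteq> 0) (at 0)" by (simp add: eventually_at_filter)
  ultimately have ev: "eventually (\<lambda>w. norm (g w) \<le> C * norm w) (at 0)"
    using C by eventually_elim (use g(2) in \<open>auto simp: norm_mult norm_power\<close>)
  then have "norm (g 0) \<le> C * norm (0 :: complex)"
    by (intro tendsto_le[OF _ r' l]) auto
  then show False using g(3)[of 0] r(1) by simp
qed

text \<open>Serves degrees \<open>0\<close> and \<open>1\<close> of the formal composition, where
  the coefficient equations do not mention \<open>H\<close> and the expansion property has to give
  the vanishing.\<close>

lemma affine_bigo_square:
  fixes a b :: complex
  assumes "(\<lambda>z. a + z * b) \<in> O[at 0](\<lambda>z. z ^ 2)"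
  shows "a = 0" "b = 0"
proof -
  obtain C where C: "eventually (\<lambda>z. norm (a + z * b) \<le> C * norm (z ^ 2)) (at 0)"
    using assms by (auto elim!: landau_o.bigE)
  have l: "((\<lambda>z. norm (a + z * b)) \<longlongrightarrow> norm (a + 0 * b)) (at 0)" by (intro tendsto_mult tendsto_add tendsto_power tendsto_norm tendsto_const tendsto_ident_at)
  have r: "((\<lambda>z. C * norm (z ^ 2)) \<longlongrightarrow> C * norm ((0 :: complex) ^ 2)) (at (0 :: complex))" by (intro tendsto_mult tendsto_add tendsto_power tendsto_norm tendsto_const tendsto_ident_at)
  have "norm (a + 0 * b) \<le> C * norm ((0 :: complex) ^ 2)"
    by (rule tendsto_le[OF _ r l C]) simp
  then show a: "a = 0" by simp
  have "eventually (\<lambda>z :: complex. z \<noteq> 0) (at 0)" by (simp add: eventually_at_filter)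
  with C have "eventually (\<lambda>z. norm b \<le> C * norm z) (at (0 :: complex))"
    by eventually_elim (auto simp: a norm_mult norm_power power2_eq_square)
  moreover have "((\<lambda>z. C * norm z) \<longlongrightarrow> C * norm (0 :: complex)) (at (0 :: complex))" by (intro tendsto_mult tendsto_add tendsto_power tendsto_norm tendsto_const tendsto_ident_at)
  ultimately have "norm b \<le> C * norm (0 :: complex)"
    by (intro tendsto_lowerbound) auto
  then show "b = 0" by simp
qed

section \<open>The formal expansion restricted to a complex ray\<close>

lemma interp_sum_scale:
  "interp (\<Sum>\<beta>\<in>S. a \<beta> *s v \<beta>) \<theta> = (\<Sum>\<beta>\<in>S. a \<beta> * interp (v \<beta>) \<theta>)"
  unfolding interp_eq_sum
  by (simp add: sum_distrib_left sum_distrib_right, subst sum.swap, simp add: mult_ac)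

lemma sum_deg_le:
  fixes f :: "'d::finite multi_index \<Rightarrow> 'a::comm_monoid_add"
  shows "(\<Sum>\<beta> | deg \<beta> \<le> k. f \<beta>) = (\<Sum>j\<le>k. \<Sum>\<beta> | deg \<beta> = j. f \<beta>)"
proof -
  have "{\<beta> :: 'd multi_index. deg \<beta> \<le> k} = (\<Union>j\<le>k. {\<beta>. deg \<beta> = j})" by auto
  then show ?thesis
    by (simp only:) (rule sum.UNION_disjoint, auto simp: finite_deg_eq)
qed

definition hom_coeff :: "('d::finite multi_index \<Rightarrow> complex) \<Rightarrow> nat \<Rightarrow> complex^'d \<Rightarrow> complex" where
  "hom_coeff D k \<sigma> = (\<Sum>\<beta> | deg \<beta> = k. D \<beta> * monomial \<sigma> \<beta>)"

lemma hom_coeff_scale: "hom_coeff D k (z *s \<sigma>) = hom_coeff D k \<sigma> * z ^ k"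
  unfolding hom_coeff_def sum_distrib_right by (intro sum.cong refl) (auto simp: monomial_scale)

lemma filterlim_scale_at_0:
  fixes \<tau> :: "complex^'d"
  assumes "\<tau> \<noteq> 0"
  shows "filterlim (\<lambda>z. z *s \<tau>) (at 0) (at 0)"
proof (rule filterlim_atI)
  have "((\<lambda>z. norm z * norm \<tau>) \<longlongrightarrow> norm (0 :: complex) * norm \<tau>) (at (0 :: complex))"
    by (rule tendsto_mult[OF tendsto_norm[OF tendsto_ident_at] tendsto_const])
  then have "((\<lambda>z. norm (z *s \<tau>)) \<longlongrightarrow> 0) (at (0 :: complex))" by simp
  then show "((\<lambda>z. z *s \<tau>) \<longlongrightarrow> 0) (at 0)" by (rule tendsto_norm_zero_cancel)
  show "eventually (\<lambda>z. z *s \<tau> \<noteq> 0) (at 0)"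
    using assms by (simp add: eventually_at_filter)
qed

text \<open>Both sides are holomorphic in \<open>z\<close>, and by the expansion property of \<open>H\<close> they agree to every
  order at \<open>0\<close>.\<close>

lemma nonlin_on_ray:
  fixes U :: "(complex^'n::{finite,linorder} option) set" and lam \<tau> :: "complex^'d::finite"
    and p D :: "'d multi_index \<Rightarrow> complex"
  defines "c \<equiv> \<lambda>\<beta>. p \<beta> *s (ps_exp (pairing lam \<beta>) :: complex^'n option)"
  defines "P \<equiv> \<lambda>\<sigma>. \<Sum>\<^sub>\<infinity>\<beta>. monomial \<sigma> \<beta> *s c \<beta>"
  assumes G: "smooth G" "G 0 = 0" "(G has_derivative (\<lambda>_. 0)) (at 0)"
    and U: "taylor_valid G U" "0 \<in> U"
    and H: "expansion_map TYPE('n) G lam H"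
    and c: "(\<lambda>\<beta>. norm (c \<beta>)) summable_on UNIV"
    and p0: "p (\<lambda>_. 0) = 0"
    and PU: "P ` ball 0 1 \<subseteq> U"
    and DH: "\<And>\<beta>. deg \<beta> \<ge> 2 \<Longrightarrow> D \<beta> = H p \<beta>" and D0: "\<And>\<beta>. deg \<beta> \<le> 1 \<Longrightarrow> D \<beta> = 0"
    and \<tau>: "norm \<tau> < 1" "\<tau> \<noteq> 0" and sm: "summable (\<lambda>k. hom_coeff D k \<tau>)"
    and z: "z \<in> ball 0 1"
  shows "(\<lambda>k. hom_coeff D k \<tau> * z ^ k) sums nonlin G (P (z *s \<tau>))"
proof -
  let ?N = "\<lambda>w :: complex^'n option. nonlin G w"
    and ?T = "taylor_poly G :: nat \<Rightarrow> complex^'n option \<Rightarrow> complex"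
  have c0: "c (\<lambda>_. 0) = 0" by (simp add: c_def p0)
  define a where "a k = hom_part c k \<tau>" for k
  define g where "g z = P (z *s \<tau>)" for z
  have z\<tau>: "norm (z *s \<tau>) < 1" if "z \<in> ball 0 1" for z
    using that mult_strict_mono[of "norm z" 1 "norm \<tau>" 1] \<tau>(1) by simp
  have g_sums: "(\<lambda>k. z ^ k *s a k) sums g z" if "z \<in> ball 0 1" for z
    using sums_hom_part[OF c, of "z *s \<tau>"] z\<tau>[OF that] by (simp add: g_def P_def a_def hom_part_scale)
  have g_hol: "(\<lambda>z. g z $ r) holomorphic_on ball 0 1" for r
  proof (rule power_series_holomorphic)
    fix w assume "w \<in> ball (0 :: complex) 1"
    from bounded_linear.sums[OF bounded_linear_vec_nth g_sums[OF this], of r]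
    show "(\<lambda>k. a k $ r * (w - 0) ^ k) sums g w $ r" by (simp add: mult.commute)
  qed
  have gU: "g ` ball 0 1 \<subseteq> U" using PU z\<tau> by (auto simp: g_def)
  have Ng_hol: "(\<lambda>z. ?N (g z)) holomorphic_on ball 0 1"
    by (rule holomorphic_on_nonlin[OF G(1) U(1) open_ball g_hol gU])
  define b where "b k = hom_coeff D k \<tau>" for k
  define \<psi> where "\<psi> z = (\<Sum>k. b k * z ^ k)" for z
  \<comment> \<open>Summability at \<tau> is convergence of the power series at
    \<open>z = 1\<close>, hence in the whole open unit disc.\<close>
  have \<psi>_sums: "(\<lambda>k. b k * z ^ k) sums \<psi> z" if "z \<in> ball 0 1" for z
    using powser_inside[of b 1 z] sm that by (simp add: b_def \<psi>_def summable_sums)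
  have \<psi>_hol: "\<psi> holomorphic_on ball 0 1"
    by (rule power_series_holomorphic) (use \<psi>_sums in simp)
  define h where "h z = ?N (g z) - \<psi> z" for z
  have h_hol: "h holomorphic_on ball 0 1"
    unfolding h_def by (intro holomorphic_intros Ng_hol \<psi>_hol)
  obtain K where K: "\<And>k. norm (b k) \<le> K"
    using summable_imp_Bseq[OF sm] unfolding b_def Bseq_def by blast
  obtain M where M: "M > 0" "\<And>k. norm (hom_norm c k) \<le> M"
    using summable_imp_Bseq[OF summable_hom_norm[OF c]] unfolding Bseq_def by blast
  have a: "norm (a k) \<le> M" for k
  proof -
    have "norm (a k) \<le> hom_norm c k * norm \<tau> ^ k" unfolding a_def by (rule norm_hom_part_le)
    also have "\<dots> \<le> hom_norm c k * 1"
      using \<tau>(1) by (intro mult_left_mono hom_norm_nonneg power_le_one) auto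
    finally show ?thesis using M(2)[of k] by simp
  qed
  define gk where "gk k z = (\<Sum>j\<le>k. z ^ j *s a j)" for k z
  have tail: "norm (g z - gk k z) \<le> 2 * M * norm z ^ Suc k" if "norm z \<le> 1/2" for z k
    unfolding gk_def
  proof (rule norm_geometric_tail_le)
    show "norm (z ^ j *s a j) \<le> M * norm z ^ j" for j
      using mult_right_mono[OF a[of j], of "norm z ^ j"] by (simp add: norm_power mult.commute)
  qed (use that g_sums in auto)
  have "a 0 = 0" by (simp add: a_def hom_part_def deg_eq_0_iff c0)
  then have g_le: "norm (g z) \<le> 2 * M * norm z" if "norm z \<le> 1/2" for z
    using tail[OF that, of 0] by (simp add: gk_def)
  have small: "eventually (\<lambda>z. norm z \<le> e) (at (0 :: complex))" if "e > 0" for e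
    unfolding eventually_at using that by (intro exI[of _ e]) (auto simp: dist_norm)
  \<comment> \<open>Truncation of the outer series: \<open>g z\<close> is of order \<open>z\<close>,
    so the Taylor remainder is of order \<open>k + 1\<close> in \<open>z\<close>.\<close>
  have t1: "(\<lambda>z. ?N (g z) - (\<Sum>m\<le>k. ?T m (g z))) \<in> O[at 0](\<lambda>z. z ^ Suc k)" for k
  proof -
    obtain r where r: "r > 0" "\<And>k. \<exists>C\<ge>0. \<forall>w :: complex^'n option. norm w \<le> r \<longrightarrow>
        norm (?N w - (\<Sum>m\<le>k. ?T m w)) \<le> C * norm w ^ Suc k"
      using nonlin_Taylor_remainder[OF G(1) U] by blast
    then obtain C where C: "C \<ge> 0" "\<And>w :: complex^'n option. norm w \<le> r \<Longrightarrow>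
        norm (?N w - (\<Sum>m\<le>k. ?T m w)) \<le> C * norm w ^ Suc k" by meson
    have "eventually (\<lambda>z. norm z \<le> min (1/2) (r / (2 * M))) (at (0 :: complex))"
      using r M by (intro small) simp
    then have "eventually (\<lambda>z. norm (?N (g z) - (\<Sum>m\<le>k. ?T m (g z)))
        \<le> C * (2 * M) ^ Suc k * norm (z ^ Suc k)) (at 0)"
    proof eventually_elim
      case (elim z)
      then have z: "norm z \<le> 1/2" "2 * M * norm z \<le> r" using M by (auto simp: field_simps)
      have "norm (?N (g z) - (\<Sum>m\<le>k. ?T m (g z))) \<le> C * norm (g z) ^ Suc k"
        using g_le[OF z(1)] z(2) by (intro C) linarith
      also have "\<dots> \<le> C * (2 * M * norm z) ^ Suc k"
        using g_le[OF z(1)] C(1) by (intro mult_left_mono power_mono) auto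
      finally show ?case by (simp add: power_mult_distrib norm_mult norm_power mult_ac)
    qed
    then show ?thesis by (rule bigoI)
  qed
  \<comment> \<open>Truncation of the inner series: the tail of \<open>g\<close> is of order
    \<open>k + 1\<close>, and each Taylor polynomial is Lipschitz on a ball containing both
    arguments.\<close>
  have t2: "(\<lambda>z. \<Sum>m\<le>k. ?T m (g z) - ?T m (gk k z)) \<in> O[at 0](\<lambda>z. z ^ Suc k)" for k
  proof (rule big_sum_in_bigo)
    fix m
    obtain C where C: "\<And>v w :: complex^'n option. v \<in> cball 0 (2 * M) \<Longrightarrow> w \<in> cball 0 (2 * M) \<Longrightarrow>
        norm (?T m v - ?T m w) \<le> C * norm (v - w)" using taylor_poly_lipschitz by blast
    have "eventually (\<lambda>z. norm z \<le> 1/2) (at (0 :: complex))" by (rule small) simp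
    then have "eventually (\<lambda>z. norm (?T m (g z) - ?T m (gk k z)) \<le> \<bar>C\<bar> * (2 * M) * norm (z ^ Suc k)) (at 0)"
    proof eventually_elim
      case (elim z)
      have "2 * M * norm z \<le> 2 * M * (1/2)" using elim M(1) by (intro mult_left_mono) auto
      then have gM: "norm (g z) \<le> M" using g_le[OF elim] by simp
      have "norm z ^ Suc k \<le> norm z * 1" using elim by (simp add: mult_left_le power_le_one)
      then have "2 * M * norm z ^ Suc k \<le> 2 * M * (1/2)" using elim M(1) by (intro mult_left_mono) auto
      then have "norm (g z - gk k z) \<le> M" using tail[OF elim, of k] by linarith
      then have "norm (gk k z) \<le> 2 * M"
        using gM norm_triangle_ineq4[of "g z" "g z - gk k z"] by simp
      then have "norm (?T m (g z) - ?T m (gk k z)) \<le> C * norm (g z - gk k z)"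
        using gM M(1) by (intro C) auto
      also have "\<dots> \<le> \<bar>C\<bar> * norm (g z - gk k z)" by (intro mult_right_mono) auto
      also have "\<dots> \<le> \<bar>C\<bar> * (2 * M * norm z ^ Suc k)" by (intro mult_left_mono tail elim) auto
      finally show ?case by (simp add: norm_mult norm_power mult_ac)
    qed
    then show "(\<lambda>z. ?T m (g z) - ?T m (gk k z)) \<in> O[at 0](\<lambda>z. z ^ Suc k)" by (rule bigoI)
  qed
  define hb where "hb j = hom_coeff (H p) j \<tau>" for j
  \<comment> \<open>With both series truncated at \<open>k\<close> this is the expansion property of
    \<open>H\<close>, pulled back along the ray.\<close>
  have t3: "(\<lambda>z. (\<Sum>m\<le>k. ?T m (gk k z)) - (\<Sum>j\<le>k. hb j * z ^ j)) \<in> O[at 0](\<lambda>z. z ^ Suc k)" for k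
  proof -
    let ?S = "\<lambda>\<sigma>. \<Sum>\<beta> | deg \<beta> \<le> k. monomial \<sigma> \<beta> *s c \<beta>"
    have arg: "(\<lambda>\<theta>. \<Sum>\<beta> | deg \<beta> \<le> k. p \<beta> * interp (ps_exp (pairing lam \<beta>) :: complex^'n option) \<theta> * monomial \<sigma> \<beta>)
        = interp (?S \<sigma>)" for \<sigma>
      by (rule ext) (simp add: interp_sum_scale c_def vec.scale_scale mult_ac)
    have "(\<lambda>\<sigma>. (\<Sum>m\<le>k. ?T m (?S \<sigma>)) - (\<Sum>\<beta> | deg \<beta> \<le> k. H p \<beta> * monomial \<sigma> \<beta>))
        \<in> O[at 0](\<lambda>\<sigma>. of_real (norm \<sigma> ^ (k + 1)))"
      using H[unfolded expansion_map_def, THEN spec[of _ p], THEN spec[of _ k], THEN mp, OF p0]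
      by (simp only: arg taylor_term_interp[OF G(1)])
    from landau_o.big.compose[OF this filterlim_scale_at_0[OF \<tau>(2)]]
    have "(\<lambda>z. (\<Sum>m\<le>k. ?T m (?S (z *s \<tau>))) - (\<Sum>\<beta> | deg \<beta> \<le> k. H p \<beta> * monomial (z *s \<tau>) \<beta>))
        \<in> O[at 0](\<lambda>z. of_real (norm (z *s \<tau>) ^ (k + 1)))" .
    moreover have "?S (z *s \<tau>) = gk k z" for z
      unfolding sum_deg_le hom_part_def[symmetric] hom_part_scale gk_def a_def ..
    moreover have "(\<Sum>\<beta> | deg \<beta> \<le> k. H p \<beta> * monomial (z *s \<tau>) \<beta>) = (\<Sum>j\<le>k. hb j * z ^ j)" for z
      unfolding sum_deg_le hom_coeff_def[symmetric] hom_coeff_scale hb_def ..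
    moreover have "(\<lambda>z. of_real (norm (z *s \<tau>) ^ (k + 1))) \<in> O[at 0](\<lambda>z. z ^ Suc k :: complex)"
    proof (rule bigoI[of _ 1], rule always_eventually, rule allI)
      fix z :: complex
      have "norm \<tau> ^ Suc k \<le> 1" using \<tau>(1) by (intro power_le_one) auto
      from mult_left_mono[OF this, of "norm z ^ Suc k"]
      show "norm (of_real (norm (z *s \<tau>) ^ (k + 1)) :: complex) \<le> 1 * norm (z ^ Suc k)"
        by (simp add: norm_power norm_mult power_mult_distrib del: of_real_power power_Suc)
    qed
    ultimately show ?thesis by (simp del: power_Suc sum.atMost_Suc) (rule landau_o.big_trans)
  qed
  have T01: "?T 0 w = 0" "?T (Suc 0) w = 0" for w
    using taylor_poly_0[where G = G, OF G(2)] taylor_poly_1[OF G(3)] by auto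
  \<comment> \<open>For \<open>k = 1\<close> all Taylor terms vanish, so an affine function is of
    order \<open>z\<^sup>2\<close>. This settles the two degrees in which \<open>D\<close> is not
    given by \<open>H p\<close>.\<close>
  have "(\<lambda>z. - hb 0 + z * (- hb 1)) \<in> O[at 0](\<lambda>z. z ^ 2)"
    using t3[of 1] by (simp add: T01 numeral_2_eq_2 mult.commute)
  from affine_bigo_square[OF this] have hb01: "hb 0 = 0" "hb 1 = 0" by auto
  have hb: "hb j = b j" for j
  proof (cases "j \<le> 1")
    case True
    then have "b j = 0" unfolding b_def hom_coeff_def by (intro sum.neutral) (auto simp: D0)
    moreover have "j = 0 \<or> j = 1" using True by auto
    ultimately show ?thesis using hb01 by auto
  next
    case False
    then show ?thesis unfolding hb_def b_def hom_coeff_def by (intro sum.cong) (auto simp: DH)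
  qed
  have t4: "(\<lambda>z. (\<Sum>j\<le>k. hb j * z ^ j) - \<psi> z) \<in> O[at 0](\<lambda>z. z ^ Suc k)" for k
  proof -
    have "eventually (\<lambda>z. norm z \<le> 1/2) (at (0 :: complex))" by (rule small) simp
    then have "eventually (\<lambda>z. norm ((\<Sum>j\<le>k. hb j * z ^ j) - \<psi> z) \<le> 2 * K * norm (z ^ Suc k)) (at 0)"
    proof eventually_elim
      case (elim z)
      have "norm (\<psi> z - (\<Sum>j\<le>k. b j * z ^ j)) \<le> 2 * K * norm z ^ Suc k"
      proof (rule norm_geometric_tail_le)
        show "norm (b j * z ^ j) \<le> K * norm z ^ j" for j
          unfolding norm_mult norm_power by (intro mult_right_mono K) simp
      qed (use elim \<psi>_sums in auto)
      then show ?case by (simp add: hb norm_minus_commute norm_power norm_mult)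
    qed
    then show ?thesis by (rule bigoI)
  qed
  have "h z = 0"
  proof (rule holomorphic_flat_eq_0[OF h_hol _ _ z])
    have "g 0 = 0" using g_le[of 0] by simp
    moreover have "\<psi> 0 = 0"
      using \<psi>_sums[of 0] hb[of 0] hb01(1) by (simp add: \<psi>_def)
    moreover have "?N 0 = 0" by (rule nonlin_0[OF G U])
    ultimately show "h 0 = 0" by (simp add: h_def)
    fix k :: nat
    have "h = (\<lambda>z. (?N (g z) - (\<Sum>m\<le>k. ?T m (g z))) + (\<Sum>m\<le>k. ?T m (g z) - ?T m (gk k z))
        + ((\<Sum>m\<le>k. ?T m (gk k z)) - (\<Sum>j\<le>k. hb j * z ^ j)) + ((\<Sum>j\<le>k. hb j * z ^ j) - \<psi> z))"
      by (simp add: fun_eq_iff h_def sum_subtractf)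
    also have "\<dots> \<in> O[at 0](\<lambda>z. z ^ Suc k)"
      by (intro sum_in_bigo(1) t1 t2 t3 t4)
    finally show "h \<in> O[at 0](\<lambda>z. z ^ Suc k)" .
  qed
  then have "?N (g z) = \<psi> z" by (simp add: h_def)
  with \<psi>_sums[OF z] show ?thesis by (simp add: b_def g_def)
qed

section \<open>The linear part of the parametrisation\<close>

definition unit_index :: "'d \<Rightarrow> 'd multi_index" where
  "unit_index i = (\<lambda>j. if j = i then 1 else 0)"

lemma deg_eq_1_iff: "deg \<beta> = 1 \<longleftrightarrow> (\<exists>i. \<beta> = unit_index i)"
proof -
  have "deg \<beta> = 1 \<longleftrightarrow> (\<exists>i. \<beta> i = Suc 0 \<and> (\<forall>j. i \<noteq> j \<longrightarrow> \<beta> j = 0))"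
    unfolding deg_def by (simp add: sum_eq_Suc0_iff)
  also have "\<dots> \<longleftrightarrow> (\<exists>i. \<beta> = unit_index i)"
    by (auto simp: unit_index_def fun_eq_iff)
  finally show ?thesis .
qed

lemma pairing_unit_index: "pairing lam (unit_index i) = lam $ i"
  by (simp add: pairing_def unit_index_def if_distrib cong: if_cong)

lemma inj_unit_index: "inj unit_index"
  by (auto simp: inj_on_def unit_index_def fun_eq_iff split: if_splits)

lemma mon_grad_unit_index: "mon_grad 0 (unit_index i) $ j = (if j = i then 1 else 0)"
  by (auto simp: mon_grad_def unit_index_def)

text \<open>The norm bound is zero at the origin: by the factor \<open>k\<close> in degree
  \<open>0\<close>, by \<open>0 ^ (k - 1)\<close> in degrees above \<open>1\<close>.\<close>

lemma hom_jac_0: "k \<noteq> 1 \<Longrightarrow> hom_jac c k 0 = 0"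
  using norm_hom_jac_le[of c k 0] by (cases k) (auto simp: power_0_left)

lemma hom_jac_1_0:
  fixes c :: "'d::finite multi_index \<Rightarrow> complex^'m::finite"
  shows "hom_jac c 1 0 = (\<chi> r i. c (unit_index i) $ r)"
proof -
  have "{\<beta> :: 'd multi_index. deg \<beta> = 1} = range unit_index" unfolding deg_eq_1_iff by blast
  then show ?thesis
    by (simp add: hom_jac_def vec_eq_iff sum.reindex[OF inj_unit_index] mon_grad_unit_index
        if_distrib cong: if_cong)
qed

lemma norm_axis [simp]: "norm (axis k x) = norm (x :: 'a::real_normed_vector)"
  by (simp add: norm_vec_def L2_set_def axis_def if_distrib if_distribR cong: if_cong)

theorem theorem11:
  fixes L G :: "hist \<Rightarrow> real"
    and \<mu> lam :: "complex^'d::finite"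
    and H :: "('d multi_index \<Rightarrow> complex) \<Rightarrow> ('d multi_index \<Rightarrow> complex)"
    and \<xi> p :: "'d multi_index \<Rightarrow> complex"
    and U :: "(complex^'n::{finite,linorder} option) set"
  assumes "bounded_linear L"
    and "\<And>k. Ck k G"
    and "G 0 = 0"
    and "(G has_derivative (\<lambda>_. 0)) (at 0)"
    and "inj (($) \<mu>)"
    and "range (($) \<mu>) = {z. Re z > 0 \<and> char_fun L z = 0}"
    and "\<And>\<beta>. deg \<beta> > 2 \<Longrightarrow> char_fun L (pairing \<mu> \<beta>) \<noteq> 0"
    and "inj (($) lam)"
    and "range (($) lam) = {z \<in> mat_spectrum (lin_mat L :: complex^'n option^'n option). Re z > 0}"
    and "vec.dim (unstable_subspace (lin_mat L :: complex^'n option^'n option)) = CARD('d)"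
    and "\<And>\<beta>. deg \<beta> \<ge> 2 \<Longrightarrow>
           pairing lam \<beta> \<notin> mat_spectrum (lin_mat L :: complex^'n option^'n option)"
    and "\<And>\<beta>. deg \<beta> \<ge> 1 \<Longrightarrow> pairing lam \<beta> \<notin> mat_spectrum (cdiffmat :: ((complex, 'n) vec, 'n) vec)"
    and "expansion_map TYPE('n) G lam H"
    and "\<And>\<beta>. deg \<beta> = 1 \<Longrightarrow> \<xi> \<beta> \<noteq> 0"
    and "coeff_map TYPE('n) L lam H \<xi> p = (\<lambda>_. 0)"
    and "(\<lambda>\<beta>. norm (p \<beta>)) summable_on UNIV"
    and "open U"
    and "param lam p ` ball 0 1 \<subseteq> U"
    and "taylor_valid G U"
  shows "local_unstable_manifold TYPE('d) (ps_field L G) (lin_mat L) U (param lam p ` ball 0 1)"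
proof -
  note L = assms(1) and G0 = assms(3,4) and lam_inj = assms(8) and specD = assms(12) and H = assms(13)
    and \<xi> = assms(14) and U = assms(17) and PU = assms(18) and valid = assms(19)
  have G: "smooth G" by (rule smooth_if_Ck[OF assms(2)])
  let ?A = "lin_mat L :: complex^'n option^'n option"
  let ?N = "\<lambda>w :: complex^'n option. nonlin G w"
  let ?\<Delta> = "\<lambda>\<beta>. ps_char_fun TYPE('n) L (pairing lam \<beta>)"
  have lam: "Re (lam $ i) > 0" "lam $ i \<in> mat_spectrum ?A" for i
    using assms(9) by (auto simp: set_eq_iff)
  define c where "c \<beta> = p \<beta> *s (ps_exp (pairing lam \<beta>) :: complex^'n option)" for \<beta>
  define P where "P \<sigma> = (\<Sum>\<^sub>\<infinity>\<beta>. monomial \<sigma> \<beta> *s c \<beta>)" for \<sigma>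
  define J where "J \<sigma> = (\<Sum>k. hom_jac c k \<sigma>)" for \<sigma>
  have P: "param lam p = P"
    by (rule ext) (simp add: param_def P_def c_def vec.scale_scale mult.commute)
  have F: "coeff_map TYPE('n) L lam H \<xi> p \<beta> = 0" for \<beta> by (simp add: assms(15))
  have p0: "p (\<lambda>_. 0) = 0" using F[of "\<lambda>_. 0"] by (simp add: coeff_map_def deg_def)
  have p1: "p \<beta> \<noteq> 0" if "deg \<beta> = 1" for \<beta> using F[of \<beta>] \<xi>[OF that] that by (simp add: coeff_map_def)
  have p2: "?\<Delta> \<beta> * p \<beta> = H p \<beta>" if "deg \<beta> \<ge> 2" for \<beta> using F[of \<beta>] that by (simp add: coeff_map_def)
  \<comment> \<open>In degree \<open>1\<close> the pairing is some \<open>lam $ i\<close>, an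
    eigenvalue of the discretised operator outside the spectrum of \<open>D\<close>, hence a zero of
    the discrete characteristic function.\<close>
  have \<Delta>1: "?\<Delta> \<beta> = 0" if deg: "deg \<beta> = 1" for \<beta>
  proof -
    obtain i where "\<beta> = unit_index i" using deg deg_eq_1_iff by blast
    then have z: "pairing lam \<beta> = lam $ i" by (simp add: pairing_unit_index)
    obtain v where "v \<noteq> 0" "?A *v v = pairing lam \<beta> *s v" using lam(2)[of i] z by (auto simp: mat_spectrum_def)
    then show ?thesis using specD[of \<beta>] deg by (intro lin_mat_eigenvector[OF L]) auto
  qed
  have c0: "c (\<lambda>_. 0) = 0" by (simp add: c_def p0)
  have c_summable: "(\<lambda>\<beta>. norm (c \<beta>)) summable_on UNIV"
  proof -
    obtain C where C: "\<And>\<beta>. deg \<beta> \<ge> 1 \<Longrightarrow> norm (ps_exp (pairing lam \<beta>) :: complex^'n option) \<le> C"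
      using ps_exp_bounded[OF lam(1) specD] by blast
    \<comment> \<open>\<open>ps_exp\<close> is bounded in positive degrees; in degree
      \<open>0\<close> the coefficient \<open>p\<close> vanishes.\<close>
    have "norm (c \<beta>) \<le> norm (p \<beta>) * C" for \<beta>
    proof (cases "deg \<beta> = 0")
      case True
      then show ?thesis using c0 p0 by (simp add: deg_eq_0_iff)
    next
      case False
      then show ?thesis unfolding c_def norm_vector_smult by (intro mult_left_mono C) auto
    qed
    then show ?thesis
      by (rule summable_on_comparison_test[OF summable_on_cmult_left[OF assms(16)]]) (rule norm_ge_zero)
  qed
  have Ac: "?A *v c \<beta> = pairing lam \<beta> *s c \<beta> - axis None (?\<Delta> \<beta> * p \<beta>)" for \<beta>
  proof (cases "deg \<beta> = 0")
    case True
    then show ?thesis using c0 p0 by (simp add: deg_eq_0_iff)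
  next
    case False
    then have E: "?A *v ps_exp (pairing lam \<beta>)
        = pairing lam \<beta> *s ps_exp (pairing lam \<beta>) - axis None (?\<Delta> \<beta>)"
      by (intro lin_mat_ps_exp[OF L] specD) simp
    show ?thesis
      unfolding c_def vector_scalar_commute E by (simp add: vec_eq_iff axis_def algebra_simps)
  qed
  have PU': "P ` ball 0 1 \<subseteq> U" using PU by (simp add: P)
  obtain C where C: "C \<ge> 0" "\<And>\<sigma>. norm \<sigma> \<le> 1 \<Longrightarrow> norm (P \<sigma>) \<le> C * norm \<sigma>"
    using norm_hom_series_le[OF c_summable c0] unfolding P_def by blast
  have P0: "P 0 = 0" using C(2)[of 0] by simp
  have "P 0 \<in> P ` ball 0 1" by (rule imageI) simp
  then have U0: "0 \<in> U" using PU' P0 by auto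
  have N0: "?N 0 = 0" by (rule nonlin_0[OF G G0 valid U0])
  have field: "ps_field L G w = ?A *v w + axis None (?N w)" for w :: "complex^'n option"
    by (simp add: ps_field_def)
  have P_deriv: "(P has_derivative (\<lambda>h. J \<sigma> *v h)) (at \<sigma>)" and J_cont: "isCont J \<sigma>"
    and J_sums: "(\<lambda>k. hom_jac c k \<sigma>) sums J \<sigma>" if "\<sigma> \<in> ball 0 1" for \<sigma>
    using hom_series_derivative[OF c_summable that] by (simp_all add: P_def[abs_def] J_def[abs_def])

  \<comment> \<open>The defect of \<open>c \<beta>\<close> in the eigenvalue equation:
    \<open>H p \<beta>\<close> from degree \<open>2\<close> on by the coefficient equations, zero
    below.\<close>
  define D where "D \<beta> = ?\<Delta> \<beta> * p \<beta>" for \<beta>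
  have D0: "D \<beta> = 0" if "deg \<beta> \<le> 1" for \<beta>
  proof (cases "deg \<beta> = 0")
    case True
    then show ?thesis using p0 by (simp add: D_def deg_eq_0_iff)
  next
    case False
    then show ?thesis using that \<Delta>1[of \<beta>] by (simp add: D_def)
  qed
  have defect: "hom_jac c k \<sigma> *v diag_mult lam \<sigma> - ?A *v hom_part c k \<sigma> = axis None (hom_coeff D k \<sigma>)" for k \<sigma>
  proof -
    have "hom_jac c k \<sigma> *v diag_mult lam \<sigma> - ?A *v hom_part c k \<sigma>
        = (\<Sum>\<beta> | deg \<beta> = k. monomial \<sigma> \<beta> *s axis None (D \<beta>))"
      unfolding hom_jac_Euler hom_part_def matrix_vector_mult_sum vector_scalar_commute sum_subtractf[symmetric]
      by (intro sum.cong refl) (simp add: Ac D_def vec.scale_right_diff_distrib)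
    also have "\<dots> = axis None (hom_coeff D k \<sigma>)"
      by (auto simp: vec_eq_iff axis_def hom_coeff_def mult.commute)
    finally show ?thesis .
  qed
  have defect_sums: "(\<lambda>k. axis None (hom_coeff D k \<sigma>)) sums (J \<sigma> *v diag_mult lam \<sigma> - ?A *v P \<sigma>)"
    if \<sigma>: "\<sigma> \<in> ball 0 1" for \<sigma>
  proof -
    have "bounded_linear (\<lambda>M :: complex^'d^'n option. M *v diag_mult lam \<sigma>)"
      by (rule linear_conv_bounded_linear[THEN iffD1])
         (auto intro!: linearI simp: matrix_vector_mult_def vec_eq_iff scaleR_sum_right
             sum.distrib algebra_simps)
    from bounded_linear.sums[OF this J_sums[OF \<sigma>]]
    have "(\<lambda>k. hom_jac c k \<sigma> *v diag_mult lam \<sigma>) sums (J \<sigma> *v diag_mult lam \<sigma>)" .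
    moreover have "(\<lambda>k. hom_part c k \<sigma>) sums P \<sigma>"
      unfolding P_def using \<sigma> by (intro sums_hom_part c_summable) auto
    from bounded_linear.sums[OF matrix_vector_mul_bounded_linear this, of ?A]
    have "(\<lambda>k. ?A *v hom_part c k \<sigma>) sums (?A *v P \<sigma>)" .
    ultimately show ?thesis unfolding defect[symmetric] by (rule sums_diff)
  qed
  \<comment> \<open>Convergence is inherited from the series for \<open>J\<close> and
    \<open>P\<close>, rather than from a bound on \<open>ps_char_fun\<close>, which grows with the
    degree.\<close>
  have coeff_sums: "(\<lambda>k. hom_coeff D k \<sigma>) sums (J \<sigma> *v diag_mult lam \<sigma> - ?A *v P \<sigma>) $ None"
    if "\<sigma> \<in> ball 0 1" for \<sigma>
    using bounded_linear.sums[OF bounded_linear_vec_nth defect_sums[OF that], of None] by (simp add: axis_def)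
  have N_sums: "(\<lambda>k. hom_coeff D k \<sigma>) sums ?N (P \<sigma>)" if \<sigma>: "\<sigma> \<in> ball 0 1" for \<sigma>
  proof (cases "\<sigma> = 0")
    case True
    have "hom_coeff D k 0 = 0" for k
    proof (cases k)
      case 0
      then show ?thesis by (simp add: hom_coeff_def D0)
    next
      case (Suc n)
      then show ?thesis using hom_coeff_scale[of D k 0 0] by simp
    qed
    then show ?thesis using True P0 N0 by simp
  next
    case False
    \<comment> \<open>A number strictly between \<open>norm \<sigma>\<close> and \<open>1\<close>
      splits \<sigma> as \<open>z *s \<tau>\<close> with both \<open>z\<close> and \<tau> inside
      their unit balls, as the identity on rays requires.\<close>
    define z where "z = complex_of_real ((1 + norm \<sigma>) / 2)"
    define \<tau> where "\<tau> = inverse z *s \<sigma>"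
    have "norm z = (1 + norm \<sigma>) / 2"
      unfolding z_def norm_of_real by (simp add: add_nonneg_nonneg)
    then have z: "norm z < 1" "norm \<sigma> < norm z" using \<sigma> by auto
    then have "z \<noteq> 0" by auto
    then have z\<tau>: "z *s \<tau> = \<sigma>" by (simp add: \<tau>_def vec.scale_scale)
    have "norm \<tau> = norm \<sigma> / norm z" by (simp add: \<tau>_def norm_inverse divide_inverse mult.commute)
    then have \<tau>: "norm \<tau> < 1" using z \<open>z \<noteq> 0\<close> by (simp add: divide_less_eq_1)
    have "\<tau> \<noteq> 0" using z\<tau> False by auto
    have "(\<lambda>k. hom_coeff D k \<tau> * z ^ k) sums ?N (P (z *s \<tau>))"
      unfolding P_def c_def
    proof (rule nonlin_on_ray[OF G G0 valid U0 H])
      show "(\<lambda>\<beta>. norm (p \<beta> *s (ps_exp (pairing lam \<beta>) :: complex^'n option))) summable_on UNIV"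
        using c_summable by (simp add: c_def)
      show "(\<lambda>\<sigma>. \<Sum>\<^sub>\<infinity>\<beta>. monomial \<sigma> \<beta> *s (p \<beta> *s (ps_exp (pairing lam \<beta>) :: complex^'n option))) ` ball 0 1 \<subseteq> U"
        using PU' by (simp add: P_def[abs_def] c_def)
      show "D \<beta> = H p \<beta>" if "deg \<beta> \<ge> 2" for \<beta> using p2[OF that] by (simp add: D_def)
      show "summable (\<lambda>k. hom_coeff D k \<tau>)" using coeff_sums[of \<tau>] \<tau> by (auto intro: sums_summable)
    qed (use p0 D0 \<tau> \<open>\<tau> \<noteq> 0\<close> z in auto)
    then show ?thesis by (simp add: z\<tau> flip: hom_coeff_scale)
  qed
  have invariant: "J \<sigma> *v diag_mult lam \<sigma> = ps_field L G (P \<sigma>)" if \<sigma>: "\<sigma> \<in> ball 0 1" for \<sigma>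
  proof -
    have "(\<lambda>k. axis None (hom_coeff D k \<sigma>)) sums (axis None (?N (P \<sigma>)) :: complex^'n option)"
    proof -
      have "bounded_linear (axis None :: complex \<Rightarrow> complex^'n option)"
        by (rule linear_conv_bounded_linear[THEN iffD1]) (auto intro!: linearI simp: axis_def vec_eq_iff)
      from bounded_linear.sums[OF this N_sums[OF \<sigma>]] show ?thesis .
    qed
    from sums_unique2[OF defect_sums[OF \<sigma>] this] show ?thesis
      unfolding field by (simp add: algebra_simps)
  qed

  have J0: "J 0 = (\<chi> r i. c (unit_index i) $ r)"
  proof -
    have "J 0 = (\<Sum>k\<in>{1}. hom_jac c k 0)"
      unfolding J_def by (rule suminf_finite) (auto simp: hom_jac_0)
    then show ?thesis by (simp add: hom_jac_1_0[simplified])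
  qed
  have J0_mult: "J 0 *v s = (\<Sum>i\<in>UNIV. s $ i *s c (unit_index i))" for s
    by (simp add: J0 matrix_vector_mult_def vec_eq_iff mult.commute)
  have J0_axis: "J 0 *v axis i 1 = c (unit_index i)" for i
    by (simp add: J0_mult axis_def if_distrib if_distribR vec_eq_iff cong: if_cong)
  have deg1: "deg (unit_index i) = 1" for i :: 'd unfolding deg_eq_1_iff by blast
  have "?A *v c (unit_index i) = lam $ i *s c (unit_index i)" for i
    using Ac[of "unit_index i"] \<Delta>1[OF deg1, of i] by (simp add: pairing_unit_index axis_def vec_eq_iff)
  then have J0_eigen: "?A *v (J 0 *v s) = J 0 *v diag_mult lam s" for s
    by (simp add: J0_mult matrix_vector_mult_sum vector_scalar_commute vec.scale_scale mult.commute)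
  \<comment> \<open>\<open>ps_exp\<close> has entry \<open>1\<close> at \<open>None\<close>, so the
    nonzero scalars \<xi> make the eigenvectors nonzero.\<close>
  have "c (unit_index i) $ None \<noteq> 0" for i
    using p1[OF deg1, of i] by (simp add: c_def ps_exp_def)
  then have "J 0 *v axis i 1 \<noteq> 0" for i by (metis J0_axis zero_index)
  then have J0_inj: "inj ((*v) (J 0))" by (rule inj_eigenvector_matrix[OF J0_eigen lam_inj])
  have J0_range: "range ((*v) (J 0)) = unstable_subspace ?A"
    by (rule unstable_subspace_eq_range[OF J0_eigen J0_inj lam(1) assms(10)])

  \<comment> \<open>Transfers the scalar Lipschitz bounds, with the same constants, to the vector
    field that has a single nonzero entry.\<close>
  have axis_diff: "norm (axis None a - axis None b :: complex^'n option) = norm (a - b)" for a b :: complex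
  proof -
    have "axis None a - axis None b = (axis None (a - b) :: complex^'n option)" by (simp add: axis_def vec_eq_iff)
    then show ?thesis by simp
  qed
  interpret unstable_parametrization "ps_field L G" "\<lambda>w. axis None (?N w)" ?A U lam P J
  proof
    show "\<exists>r>0. \<exists>L. L-lipschitz_on (ball w r) (\<lambda>w. axis None (?N w) :: complex^'n option)" if w: "w \<in> U" for w
    proof -
      obtain r L where "r > 0" "L-lipschitz_on (ball w r) ?N"
        using nonlin_locally_lipschitz[OF G valid U w] by blast
      then show ?thesis unfolding lipschitz_on_def dist_norm axis_diff by blast
    qed
    show "\<exists>r>0. \<forall>v\<in>ball 0 r. \<forall>w\<in>ball 0 r. norm (axis None (?N v) - axis None (?N w) :: complex^'n option) \<le> \<rho> * norm (v - w)"
      if \<rho>: "\<rho> > 0" for \<rho>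
      using nonlin_small_lipschitz[OF G G0 valid U U0 \<rho>] unfolding axis_diff by metis
    show "axis None (?N 0) = (0 :: complex^'n option)" by (simp add: N0 axis_def vec_eq_iff)
    show "continuous_on (cball 0 1) P"
      unfolding P_def by (rule continuous_on_hom_series[OF c_summable])
    show "\<exists>C\<ge>0. \<forall>\<sigma>. norm \<sigma> \<le> 1 \<longrightarrow> norm (P \<sigma>) \<le> C * norm \<sigma>" using C by blast
  qed (use field U lam PU' P_deriv J_cont invariant J0_eigen J0_inj J0_range in auto)
  show ?thesis unfolding P by (rule param_local_unstable_manifold)
qed

end
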